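(* Let $p$ be a prime and let $B$ be an unstable Hopf algebra over the mod $p$ Steenrod algebra $\mathcal{A}_p$ which is finitely generated as an unstable $\mathcal{A}_p$-algebra. Then every unstable Hopf subalgebra of $B$ is also finitely generated as an unstable $\mathcal{A}_p$-algebra.
   Context: Hopf algebras are graded, connected (degree-zero part $\mathbb{F}_p$, non-negatively graded), with graded commutative multiplication, over $\mathbb{F}_p$. An unstable Hopf algebra is a Hopf algebra which is an unstable algebra over $\mathcal{A}_p$ and whose structure maps are compatible with the $\mathcal{A}_p$-action. An unstable Hopf subalgebra is a Hopf subalgebra stable under the action of $\mathcal{A}_p$. An unstable algebra is a finitely generated unstable $\mathcal{A}_p$-algebra if finitely many elements together with all their images under Steenrod operations generate it as an $\mathbb{F}_p$-algebra. *)

theory Defs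
  imports
    Complex_Main
    "HOL-Library.Poly_Mapping"
    "HOL-Library.Cardinality"
    "HOL-Computational_Algebra.Primes"
begin

section \<open>Tensor products\<close>

text \<open>
  The tensor product of two abelian groups, as the free abelian group on the pairs modulo the
  biadditivity relations. Below it is applied to vector spaces over the prime field of order \<open>p\<close>.
  There, scalar multiplication is iterated addition, so that the relation identifying
  \<open>c x \<otimes> y\<close> and \<open>x \<otimes> c y\<close> is a consequence of biadditivity (lemma \<open>tensor_scale_left_right\<close>)
  and this is the tensor product over the prime field.
\<close>

inductive_set tensor_null :: "(('a::ab_group_add \<times> 'b::ab_group_add) \<Rightarrow>\<^sub>0 int) set" where
  zero: "0 \<in> tensor_null"
| left: "frag_of (x + x', y) - frag_of (x, y) - frag_of (x', y) \<in> tensor_null"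
| right: "frag_of (x, y + y') - frag_of (x, y) - frag_of (x, y') \<in> tensor_null"
| diff: "u \<in> tensor_null \<Longrightarrow> v \<in> tensor_null \<Longrightarrow> u - v \<in> tensor_null"

lemma tensor_null_uminus: "u \<in> tensor_null \<Longrightarrow> - u \<in> tensor_null"
  using tensor_null.diff[OF tensor_null.zero, of u] by simp

lemma tensor_null_add: "u \<in> tensor_null \<Longrightarrow> v \<in> tensor_null \<Longrightarrow> u + v \<in> tensor_null"
  using tensor_null.diff[OF _ tensor_null_uminus, of u v] by simp

definition tensor_eq ::
  "(('a::ab_group_add \<times> 'b::ab_group_add) \<Rightarrow>\<^sub>0 int) \<Rightarrow> ('a \<times> 'b \<Rightarrow>\<^sub>0 int) \<Rightarrow> bool"
  where "tensor_eq u v \<longleftrightarrow> u - v \<in> tensor_null"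

quotient_type (overloaded) ('a, 'b) tensor =
  "('a::ab_group_add \<times> 'b::ab_group_add) \<Rightarrow>\<^sub>0 int" / tensor_eq
proof (rule equivpI)
  show "reflp tensor_eq"
    by (auto simp: reflp_def tensor_eq_def tensor_null.zero)
  show "symp tensor_eq"
    using tensor_null_uminus by (fastforce simp: symp_def tensor_eq_def)
  show "transp tensor_eq"
    using tensor_null_add by (fastforce simp: transp_def tensor_eq_def)
qed

instantiation tensor :: (ab_group_add, ab_group_add) ab_group_add
begin

lift_definition zero_tensor :: "('a, 'b) tensor" is 0 .

lift_definition plus_tensor :: "('a, 'b) tensor \<Rightarrow> ('a, 'b) tensor \<Rightarrow> ('a, 'b) tensor" is "(+)"
  unfolding tensor_eq_def using tensor_null_add by (metis add_diff_add)

lift_definition minus_tensor :: "('a, 'b) tensor \<Rightarrow> ('a, 'b) tensor \<Rightarrow> ('a, 'b) tensor" is "(-)"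
  unfolding tensor_eq_def using tensor_null.diff
  by (metis (no_types, lifting) add_diff_add diff_conv_add_uminus minus_diff_eq minus_diff_minus)

lift_definition uminus_tensor :: "('a, 'b) tensor \<Rightarrow> ('a, 'b) tensor" is "uminus"
  unfolding tensor_eq_def using tensor_null_uminus by (metis minus_diff_minus)

instance
  by standard (transfer; simp add: tensor_eq_def tensor_null.zero algebra_simps)+

end

lift_definition tensor :: "'a::ab_group_add \<Rightarrow> 'b::ab_group_add \<Rightarrow> ('a, 'b) tensor"
    (infixl \<open>\<otimes>\<^sub>t\<close> 72)
  is "\<lambda>x y. frag_of (x, y)" .

lemma tensor_add_left: "(x + x') \<otimes>\<^sub>t y = x \<otimes>\<^sub>t y + x' \<otimes>\<^sub>t y"
  by transfer (use tensor_null.left in \<open>auto simp: tensor_eq_def algebra_simps\<close>)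

lemma tensor_add_right: "x \<otimes>\<^sub>t (y + y') = x \<otimes>\<^sub>t y + x \<otimes>\<^sub>t y'"
  by transfer (use tensor_null.right in \<open>auto simp: tensor_eq_def algebra_simps\<close>)

definition biadditive :: "('a::ab_group_add \<Rightarrow> 'b::ab_group_add \<Rightarrow> 'c::ab_group_add) \<Rightarrow> bool" where
  "biadditive h \<longleftrightarrow> (\<forall>y. additive (\<lambda>x. h x y)) \<and> (\<forall>x. additive (h x))"

text \<open>
  The universal property: for biadditive \<open>h\<close> (only then is this meaningful), \<open>tensor_lift h\<close> is
  the additive map with value \<open>h x y\<close> at \<open>x \<otimes> y\<close>; see \<open>tensor_lift\<close> and \<open>tensor_lift_unique\<close>.
\<close>

definition tensor_lift ::
  "('a::ab_group_add \<Rightarrow> 'b::ab_group_add \<Rightarrow> 'c::ab_group_add) \<Rightarrow> ('a, 'b) tensor \<Rightarrow> 'c" where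
  "tensor_lift h = (THE F. additive F \<and> (\<forall>x y. F (x \<otimes>\<^sub>t y) = h x y))"

lemma abs_tensor_diff: "abs_tensor (a - b) = abs_tensor a - abs_tensor b"
  by (simp add: minus_tensor.abs_eq)

lemma tensor_induct [case_names zero tensor diff]:
  assumes "Q 0" and "\<And>x y. Q (x \<otimes>\<^sub>t y)" and "\<And>s t. Q s \<Longrightarrow> Q t \<Longrightarrow> Q (s - t)"
  shows "Q t"
proof -
  have "Q (abs_tensor u)" for u
  proof (rule frag_induction[of u UNIV "\<lambda>u. Q (abs_tensor u)"])
    show "Q (abs_tensor 0)" using assms(1) by (simp add: zero_tensor.abs_eq)
    show "Q (abs_tensor (frag_of z))" for z
      using assms(2)[of "fst z" "snd z"] by (simp add: tensor.abs_eq)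
  qed (simp_all add: abs_tensor_diff assms(3))
  then show ?thesis by (metis Quotient_abs_rep Quotient_tensor)
qed

lemma tensor_lift_unique_aux:
  assumes "additive F" "additive F'" and "\<And>x y. F (x \<otimes>\<^sub>t y) = F' (x \<otimes>\<^sub>t y)"
  shows "F t = F' t"
  by (induction t rule: tensor_induct)
    (simp_all add: assms(3) additive.zero[OF assms(1)] additive.zero[OF assms(2)]
      additive.diff[OF assms(1)] additive.diff[OF assms(2)])

definition zscale :: "int \<Rightarrow> 'c::ab_group_add \<Rightarrow> 'c" where
  "zscale n x = (\<Sum>i<nat n. x) - (\<Sum>i<nat (- n). x)"

lemma sum_lessThan_const_add:
  "(\<Sum>i<m + n. x) = (\<Sum>i<m. x) + (\<Sum>i<n. (x::'c::ab_group_add))" for m n :: nat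
  by (induction n) (simp_all add: add_ac)

lemma zscale_diff_nat: "zscale (int m - int n) x = (\<Sum>i<m. x) - (\<Sum>i<n. x)"
proof (cases "m \<ge> n")
  case True
  then obtain k where "m = n + k" using le_Suc_ex by blast
  then show ?thesis by (simp add: zscale_def sum_lessThan_const_add)
next
  case False
  then obtain k where "n = m + k" using le_Suc_ex by (metis nat_le_linear)
  then show ?thesis by (simp add: zscale_def sum_lessThan_const_add)
qed

lemma zscale_add: "zscale (m + n) x = zscale m x + zscale n x"
proof -
  obtain a b c d where "m = int a - int b" "n = int c - int d"
    by (metis int_diff_cases)
  moreover from this have "m + n = int (a + c) - int (b + d)" by simp
  ultimately show ?thesis
    by (simp only: zscale_diff_nat sum_lessThan_const_add) simp
qed

lemma tensor_lift_exists:
  fixes h :: "'a::ab_group_add \<Rightarrow> 'b::ab_group_add \<Rightarrow> 'c::ab_group_add"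
  assumes h: "biadditive h"
  shows "\<exists>F. additive F \<and> (\<forall>x y. F (x \<otimes>\<^sub>t y) = h x y)"
proof -
  define E where "E u = (\<Sum>z\<in>Poly_Mapping.keys u.
    zscale (Poly_Mapping.lookup u z) (h (fst z) (snd z)))" for u
  have add: "E (u + v) = E u + E v" for u v
    unfolding E_def by (rule setsum_keys_plus_distrib) (simp add: zscale_def, rule zscale_add)
  have "additive E" using add by unfold_locales
  then interpret E: additive E .
  have of: "E (frag_of z) = h (fst z) (snd z)" for z
    by (simp add: E_def zscale_def)
  have hl: "h (x + x') y = h x y + h x' y" and hr: "h x (y + y') = h x y + h x y'" for x x' y y'
    using h by (simp_all add: biadditive_def additive_def)
  have null: "E u = 0" if "u \<in> tensor_null" for u
    using that by induction (simp_all add: E.zero E.diff of hl hr)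
  define F where "F t = E (rep_tensor t)" for t
  have F: "F (abs_tensor u) = E u" for u
  proof -
    have "tensor_eq (rep_tensor (abs_tensor u)) u"
      using Quotient3_rep_abs[OF Quotient3_tensor] Quotient_tensor
      by (metis (mono_tags, lifting) Quotient3_tensor Quotient3_abs_rep Quotient3_rel_abs
          tensor.abs_eq_iff)
    then have "E (rep_tensor (abs_tensor u) - u) = 0" by (simp add: null tensor_eq_def)
    then show ?thesis by (simp add: F_def E.diff)
  qed
  have "additive F"
  proof
    fix s t :: "('a, 'b) tensor"
    obtain u v where "s = abs_tensor u" "t = abs_tensor v"
      by (metis Quotient3_tensor Quotient3_abs_rep)
    then show "F (s + t) = F s + F t" by (simp add: plus_tensor.abs_eq F E.add)
  qed
  moreover have "F (x \<otimes>\<^sub>t y) = h x y" for x y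
    by (simp add: tensor.abs_eq F of)
  ultimately show ?thesis by blast
qed

lemma
  assumes "biadditive h"
  shows additive_tensor_lift: "additive (tensor_lift h)"
    and tensor_lift: "tensor_lift h (x \<otimes>\<^sub>t y) = h x y"
proof -
  have "\<exists>!F. additive F \<and> (\<forall>x y. F (x \<otimes>\<^sub>t y) = h x y)"
    using tensor_lift_exists[OF assms] tensor_lift_unique_aux by (metis ext)
  from theI'[OF this] show "additive (tensor_lift h)" "tensor_lift h (x \<otimes>\<^sub>t y) = h x y"
    unfolding tensor_lift_def by auto
qed

lemma tensor_lift_unique:
  assumes "additive F" and "\<And>x y. F (x \<otimes>\<^sub>t y) = h x y"
  shows "tensor_lift h = F"
  unfolding tensor_lift_def
proof (rule the_equality)
  show "additive F \<and> (\<forall>x y. F (x \<otimes>\<^sub>t y) = h x y)" using assms by blast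
  fix F' assume "additive F' \<and> (\<forall>x y. F' (x \<otimes>\<^sub>t y) = h x y)"
  then have "F' t = F t" for t by (rule_tac tensor_lift_unique_aux) (simp_all add: assms)
  then show "F' = F" by blast
qed

definition tensor_map ::
  "('a::ab_group_add \<Rightarrow> 'c::ab_group_add) \<Rightarrow> ('b::ab_group_add \<Rightarrow> 'd::ab_group_add) \<Rightarrow>
    ('a, 'b) tensor \<Rightarrow> ('c, 'd) tensor" where
  "tensor_map f g = tensor_lift (\<lambda>x y. f x \<otimes>\<^sub>t g y)"

definition tensor_assoc ::
  "(('a::ab_group_add, 'b::ab_group_add) tensor, 'c::ab_group_add) tensor \<Rightarrow>
    ('a, ('b, 'c) tensor) tensor" where
  "tensor_assoc = tensor_lift (\<lambda>t z. tensor_lift (\<lambda>x y. x \<otimes>\<^sub>t (y \<otimes>\<^sub>t z)) t)"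

definition additive_subgroup :: "'a::ab_group_add set \<Rightarrow> bool" where
  "additive_subgroup H \<longleftrightarrow> 0 \<in> H \<and> (\<forall>x\<in>H. \<forall>y\<in>H. x - y \<in> H)"

text \<open>The image of \<open>X \<otimes> Y\<close> in the tensor product of the ambient spaces.\<close>

definition tensor_sub ::
  "'a::ab_group_add set \<Rightarrow> 'b::ab_group_add set \<Rightarrow> ('a, 'b) tensor set" where
  "tensor_sub X Y = additive_subgroup hull {x \<otimes>\<^sub>t y |x y. x \<in> X \<and> y \<in> Y}"

lemma prime_field_of_nat:
  assumes "prime CARD('k::field)"
  shows "\<exists>n. (c::'k) = of_nat n"
proof -
  let ?p = "CARD('k)"
  have fin: "finite (UNIV :: 'k set)"
    using assms prime_gt_0_nat by (metis card.infinite less_irrefl)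
  have "(\<Sum>x\<in>(UNIV::'k set). x) = (\<Sum>x\<in>UNIV. x + 1)"
    by (rule sum.reindex_bij_witness[of _ "\<lambda>x. x + 1" "\<lambda>x. x - 1"]) auto
  then have p0: "of_nat ?p = (0::'k)" by (simp add: sum.distrib)
  have nz: "of_nat d \<noteq> (0::'k)" if d: "0 < d" "d < ?p" for d
  proof
    assume d0: "of_nat d = (0::'k)"
    have "coprime d ?p"
      using d assms by (metis coprime_commute nat_dvd_not_less prime_imp_coprime)
    then obtain a b where "a * d = b * ?p + 1"
      using d bezout_nat[of d ?p] by (metis coprime_iff_gcd_eq_1 less_not_refl mult.commute)
    then have "of_nat (a * d) = (of_nat (b * ?p + 1) :: 'k)" by simp
    then show False by (simp add: d0 p0)
  qed
  have "inj_on (of_nat :: nat \<Rightarrow> 'k) {..<?p}"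
  proof (rule linorder_inj_onI')
    fix m n assume mn: "m \<in> {..<?p}" "n \<in> {..<?p}" "m < n"
    have "of_nat (n - m) \<noteq> (0::'k)" using mn by (intro nz) auto
    with mn show "of_nat m \<noteq> (of_nat n :: 'k)" by (simp add: of_nat_diff)
  qed
  then have "card (of_nat ` {..<?p} :: 'k set) = ?p" by (simp add: card_image)
  then have "of_nat ` {..<?p} = (UNIV :: 'k set)" using fin by (simp add: card_subset_eq)
  then show ?thesis by blast
qed

lemma tensor_scale_left_right:
  fixes s :: "'k::field \<Rightarrow> 'a::ab_group_add \<Rightarrow> 'a" and s' :: "'k \<Rightarrow> 'b::ab_group_add \<Rightarrow> 'b"
  assumes "prime CARD('k)" and "vector_space s" and "vector_space s'"
  shows "s c x \<otimes>\<^sub>t y = x \<otimes>\<^sub>t s' c y"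
proof -
  interpret s: vector_space s by fact
  interpret s': vector_space s' by fact
  have z: "(0::'a) \<otimes>\<^sub>t y = 0" "x \<otimes>\<^sub>t (0::'b) = 0"
    using tensor_add_left[of 0 0 y] tensor_add_right[of x 0 0] by simp_all
  have "s (of_nat n) x \<otimes>\<^sub>t y = x \<otimes>\<^sub>t s' (of_nat n) y" for n
    by (induction n)
      (simp_all add: z s.scale_left_distrib s'.scale_left_distrib tensor_add_left tensor_add_right)
  then show ?thesis using prime_field_of_nat[OF assms(1), of c] by auto
qed


section \<open>Graded algebras\<close>

text \<open>
  Graded objects are given by their total space, the direct sum of the homogeneous parts \<open>G n\<close>.
\<close>

definition decomposes :: "(nat \<Rightarrow> 'a::ab_group_add set) \<Rightarrow> 'a \<Rightarrow> (nat \<Rightarrow> 'a) \<Rightarrow> bool" where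
  "decomposes G x c \<longleftrightarrow>
    (\<forall>n. c n \<in> G n) \<and> finite {n. c n \<noteq> 0} \<and> x = (\<Sum>n | c n \<noteq> 0. c n)"

definition component :: "(nat \<Rightarrow> 'a::ab_group_add set) \<Rightarrow> 'a \<Rightarrow> nat \<Rightarrow> 'a" where
  "component G x = (THE c. decomposes G x c)"

locale graded_vector_space = vector_space scale
  for scale :: "'k::field \<Rightarrow> 'a::ab_group_add \<Rightarrow> 'a" (infixr \<open>*s\<close> 75) +
  fixes G :: "nat \<Rightarrow> 'a set"
  assumes subspace_G: "subspace (G n)"
    and decomposition: "\<exists>!c. decomposes G x c"

text \<open>The unit is the map sending \<open>c\<close> to \<open>c *s 1\<close>.\<close>

locale graded_commutative_algebra = graded_vector_space scale G
  for scale :: "'k::field \<Rightarrow> 'a::ring_1 \<Rightarrow> 'a" (infixr \<open>*s\<close> 75)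
    and G :: "nat \<Rightarrow> 'a set" +
  assumes scale_mult_left: "c *s (x * y) = (c *s x) * y"
    and scale_mult_right: "c *s (x * y) = x * (c *s y)"
    and one_in_G: "1 \<in> G 0"
    and mult_in_G: "x \<in> G m \<Longrightarrow> y \<in> G n \<Longrightarrow> x * y \<in> G (m + n)"
    and graded_commute: "x \<in> G m \<Longrightarrow> y \<in> G n \<Longrightarrow> x * y = (-1) ^ (m * n) * (y * x)"

definition subalgebra :: "('k::field \<Rightarrow> 'a::ring_1 \<Rightarrow> 'a) \<Rightarrow> 'a set \<Rightarrow> bool" where
  "subalgebra scale A \<longleftrightarrow> module.subspace scale A \<and> 1 \<in> A \<and> (\<forall>x\<in>A. \<forall>y\<in>A. x * y \<in> A)"


section \<open>Hopf algebras\<close>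

definition tensor_degree ::
  "(nat \<Rightarrow> 'a::ab_group_add set) \<Rightarrow> nat \<Rightarrow> ('a, 'a) tensor set" where
  "tensor_degree G n =
    additive_subgroup hull {x \<otimes>\<^sub>t y |x y. \<exists>i j. i + j = n \<and> x \<in> G i \<and> y \<in> G j}"

text \<open>
  The product \<open>(x \<otimes> y) (x' \<otimes> y') = (-1)^(m n) (x x' \<otimes> y y')\<close> for \<open>y\<close> of degree \<open>m\<close> and \<open>x'\<close> of
  degree \<open>n\<close>, extended to inhomogeneous elements through their components.
\<close>

definition tensor_mult ::
  "(nat \<Rightarrow> 'a::ring_1 set) \<Rightarrow> ('a, 'a) tensor \<Rightarrow> ('a, 'a) tensor \<Rightarrow> ('a, 'a) tensor" where
  "tensor_mult G s t =
    tensor_lift (\<lambda>x y. tensor_lift (\<lambda>x' y'.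
      \<Sum>m | component G y m \<noteq> 0. \<Sum>n | component G x' n \<noteq> 0.
        ((-1) ^ (m * n) * (x * component G x' n)) \<otimes>\<^sub>t (component G y m * y')) t) s"

text \<open>
  Hopf algebras in the sense of Milnor and Moore, connected and with graded commutative
  multiplication; by connectedness an antipode exists and is unique, so it is not part of the data.
  Over a prime field an additive map is linear, so additivity of \<open>\<Delta>\<close> suffices.
\<close>

locale hopf_algebra = graded_commutative_algebra scale G
  for scale :: "'k::field \<Rightarrow> 'a::ring_1 \<Rightarrow> 'a" (infixr \<open>*s\<close> 75)
    and G :: "nat \<Rightarrow> 'a set" +
  fixes \<Delta> :: "'a \<Rightarrow> ('a, 'a) tensor"
    and \<epsilon> :: "'a \<Rightarrow> 'k"
  assumes connected: "G 0 = range (\<lambda>c. c *s 1)"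
    and comult_additive: "additive \<Delta>"
    and comult_degree: "x \<in> G n \<Longrightarrow> \<Delta> x \<in> tensor_degree G n"
    and comult_one: "\<Delta> 1 = 1 \<otimes>\<^sub>t 1"
    and comult_mult: "\<Delta> (x * y) = tensor_mult G (\<Delta> x) (\<Delta> y)"
    and counit_linear: "Vector_Spaces.linear scale (*) \<epsilon>"
    and counit_degree: "x \<in> G n \<Longrightarrow> n > 0 \<Longrightarrow> \<epsilon> x = 0"
    and counit_one: "\<epsilon> 1 = 1"
    and counit_mult: "\<epsilon> (x * y) = \<epsilon> x * \<epsilon> y"
    and coassoc: "tensor_assoc (tensor_map \<Delta> id (\<Delta> x)) = tensor_map id \<Delta> (\<Delta> x)"
    and counit_left: "tensor_lift (\<lambda>y z. \<epsilon> y *s z) (\<Delta> x) = x"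
    and counit_right: "tensor_lift (\<lambda>y z. \<epsilon> z *s y) (\<Delta> x) = x"

definition hopf_subalgebra ::
  "('k::field \<Rightarrow> 'a::ring_1 \<Rightarrow> 'a) \<Rightarrow> (nat \<Rightarrow> 'a set) \<Rightarrow> ('a \<Rightarrow> ('a, 'a) tensor) \<Rightarrow>
    'a set \<Rightarrow> bool" where
  "hopf_subalgebra scale G \<Delta> C \<longleftrightarrow>
    subalgebra scale C \<and> (\<forall>x\<in>C. \<forall>n. component G x n \<in> C) \<and> (\<forall>x\<in>C. \<Delta> x \<in> tensor_sub C C)"


section \<open>The Steenrod algebra and unstable algebras\<close>

text \<open>
  The mod \<open>p\<close> Steenrod algebra is the quotient of the free associative algebra on
  the generators below by the Adem relations, together with \<open>Sq\<^sup>0 = 1\<close> if \<open>p = 2\<close>, and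
  \<open>P\<^sup>0 = 1\<close> and \<open>\<beta>\<^sup>2 = 0\<close> if \<open>p\<close> is odd. Accordingly, a graded module over it is given by the
  action of the generators, subject to these relations. Here \<open>RP i\<close> is the reduced power \<open>P\<^sup>i\<close>.
\<close>

datatype steenrod_gen = Sq nat | RP nat | Bockstein

definition steenrod_gens :: "nat \<Rightarrow> steenrod_gen set" where
  "steenrod_gens p = (if p = 2 then range Sq else insert Bockstein (range RP))"

fun gen_degree :: "nat \<Rightarrow> steenrod_gen \<Rightarrow> nat" where
  "gen_degree p (Sq i) = i"
| "gen_degree p (RP i) = 2 * i * (p - 1)"
| "gen_degree p Bockstein = 1"

text \<open>
  The action of generators not in \<open>steenrod_gens p\<close> is irrelevant. The natural number
  subtractions in the Adem relations do not truncate.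
\<close>

locale steenrod_module = graded_vector_space scale G
  for p :: nat
    and scale :: "'k::field \<Rightarrow> 'a::ab_group_add \<Rightarrow> 'a" (infixr \<open>*s\<close> 75)
    and G :: "nat \<Rightarrow> 'a set" +
  fixes act :: "steenrod_gen \<Rightarrow> 'a \<Rightarrow> 'a"
  assumes act_linear: "g \<in> steenrod_gens p \<Longrightarrow> Vector_Spaces.linear scale scale (act g)"
    and act_degree: "g \<in> steenrod_gens p \<Longrightarrow> x \<in> G n \<Longrightarrow> act g x \<in> G (n + gen_degree p g)"
    and Sq_0: "p = 2 \<Longrightarrow> act (Sq 0) x = x"
    and Sq_adem: "p = 2 \<Longrightarrow> 0 < a \<Longrightarrow> a < 2 * b \<Longrightarrow>
      act (Sq a) (act (Sq b) x) =
        (\<Sum>j | 2 * j \<le> a. of_nat ((b - 1 - j) choose (a - 2 * j)) *s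
          act (Sq (a + b - j)) (act (Sq j) x))"
    and RP_0: "p \<noteq> 2 \<Longrightarrow> act (RP 0) x = x"
    and Bockstein_Bockstein: "p \<noteq> 2 \<Longrightarrow> act Bockstein (act Bockstein x) = 0"
    and RP_adem: "p \<noteq> 2 \<Longrightarrow> 0 < a \<Longrightarrow> a < p * b \<Longrightarrow>
      act (RP a) (act (RP b) x) =
        (\<Sum>j | p * j \<le> a.
          ((-1) ^ (a + j) * of_nat (((p - 1) * (b - j) - 1) choose (a - p * j))) *s
            act (RP (a + b - j)) (act (RP j) x))"
    and RP_Bockstein_adem: "p \<noteq> 2 \<Longrightarrow> 0 < a \<Longrightarrow> a \<le> p * b \<Longrightarrow>
      act (RP a) (act Bockstein (act (RP b) x)) =
        (\<Sum>j | p * j \<le> a.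
          ((-1) ^ (a + j) * of_nat (((p - 1) * (b - j)) choose (a - p * j))) *s
            act Bockstein (act (RP (a + b - j)) (act (RP j) x))) +
        (\<Sum>j | p * j \<le> a - 1.
          ((-1) ^ (a + j - 1) * of_nat (((p - 1) * (b - j) - 1) choose (a - p * j - 1))) *s
            act (RP (a + b - j)) (act Bockstein (act (RP j) x)))"

locale unstable_module = steenrod_module +
  assumes Sq_unstable: "p = 2 \<Longrightarrow> x \<in> G n \<Longrightarrow> n < i \<Longrightarrow> act (Sq i) x = 0"
    and RP_unstable: "p \<noteq> 2 \<Longrightarrow> x \<in> G n \<Longrightarrow> n < 2 * i \<Longrightarrow> act (RP i) x = 0"
    and Bockstein_RP_unstable:
      "p \<noteq> 2 \<Longrightarrow> x \<in> G n \<Longrightarrow> n < 2 * i + 1 \<Longrightarrow> act Bockstein (act (RP i) x) = 0"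

text \<open>
  That the unit is compatible with the action follows from instability in degree \<open>0\<close>.
\<close>

locale unstable_algebra = graded_commutative_algebra scale G + unstable_module p scale G act
  for p :: nat
    and scale :: "'k::field \<Rightarrow> 'a::ring_1 \<Rightarrow> 'a" (infixr \<open>*s\<close> 75)
    and G :: "nat \<Rightarrow> 'a set"
    and act :: "steenrod_gen \<Rightarrow> 'a \<Rightarrow> 'a" +
  assumes Sq_cartan: "p = 2 \<Longrightarrow> act (Sq n) (x * y) = (\<Sum>i\<le>n. act (Sq i) x * act (Sq (n - i)) y)"
    and RP_cartan: "p \<noteq> 2 \<Longrightarrow> act (RP n) (x * y) = (\<Sum>i\<le>n. act (RP i) x * act (RP (n - i)) y)"
    and Bockstein_cartan: "p \<noteq> 2 \<Longrightarrow> x \<in> G n \<Longrightarrow>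
      act Bockstein (x * y) = act Bockstein x * y + (-1) ^ n * (x * act Bockstein y)"
    and Sq_top: "p = 2 \<Longrightarrow> x \<in> G n \<Longrightarrow> act (Sq n) x = x ^ 2"
    and RP_top: "p \<noteq> 2 \<Longrightarrow> x \<in> G (2 * n) \<Longrightarrow> act (RP n) x = x ^ p"

text \<open>
  The action on the tensor square, through the diagonal of the Steenrod algebra.
\<close>

fun tensor_act ::
  "(nat \<Rightarrow> 'a::ring_1 set) \<Rightarrow> (steenrod_gen \<Rightarrow> 'a \<Rightarrow> 'a) \<Rightarrow> steenrod_gen \<Rightarrow>
    ('a, 'a) tensor \<Rightarrow> ('a, 'a) tensor" where
  "tensor_act G act (Sq n) = tensor_lift (\<lambda>x y. \<Sum>i\<le>n. act (Sq i) x \<otimes>\<^sub>t act (Sq (n - i)) y)"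
| "tensor_act G act (RP n) = tensor_lift (\<lambda>x y. \<Sum>i\<le>n. act (RP i) x \<otimes>\<^sub>t act (RP (n - i)) y)"
| "tensor_act G act Bockstein = tensor_lift (\<lambda>x y. act Bockstein x \<otimes>\<^sub>t y +
    (\<Sum>m | component G x m \<noteq> 0. ((-1) ^ m * component G x m) \<otimes>\<^sub>t act Bockstein y))"

text \<open>
  The counit is compatible with the action for degree reasons, so only the coproduct needs a
  condition.
\<close>

locale unstable_hopf_algebra = hopf_algebra scale G \<Delta> \<epsilon> + unstable_algebra p scale G act
  for p :: nat
    and scale :: "'k::field \<Rightarrow> 'a::ring_1 \<Rightarrow> 'a" (infixr \<open>*s\<close> 75)
    and G :: "nat \<Rightarrow> 'a set"
    and \<Delta> :: "'a \<Rightarrow> ('a, 'a) tensor"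
    and \<epsilon> :: "'a \<Rightarrow> 'k"
    and act :: "steenrod_gen \<Rightarrow> 'a \<Rightarrow> 'a" +
  assumes comult_act: "g \<in> steenrod_gens p \<Longrightarrow> \<Delta> (act g x) = tensor_act G act g (\<Delta> x)"

definition unstable_hopf_subalgebra ::
  "nat \<Rightarrow> ('k::field \<Rightarrow> 'a::ring_1 \<Rightarrow> 'a) \<Rightarrow> (nat \<Rightarrow> 'a set) \<Rightarrow>
    ('a \<Rightarrow> ('a, 'a) tensor) \<Rightarrow> (steenrod_gen \<Rightarrow> 'a \<Rightarrow> 'a) \<Rightarrow> 'a set \<Rightarrow> bool" where
  "unstable_hopf_subalgebra p scale G \<Delta> act C \<longleftrightarrow>
    hopf_subalgebra scale G \<Delta> C \<and> (\<forall>g\<in>steenrod_gens p. \<forall>x\<in>C. act g x \<in> C)"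

text \<open>
  The operators by which the elements of the Steenrod algebra act.
\<close>

inductive_set steenrod_operations ::
  "nat \<Rightarrow> ('k::field \<Rightarrow> 'a::ab_group_add \<Rightarrow> 'a) \<Rightarrow> (steenrod_gen \<Rightarrow> 'a \<Rightarrow> 'a) \<Rightarrow>
    ('a \<Rightarrow> 'a) set"
  for p :: nat and scale :: "'k::field \<Rightarrow> 'a::ab_group_add \<Rightarrow> 'a"
    and act :: "steenrod_gen \<Rightarrow> 'a \<Rightarrow> 'a" where
  one: "(\<lambda>x. x) \<in> steenrod_operations p scale act"
| gen_mult: "g \<in> steenrod_gens p \<Longrightarrow> \<theta> \<in> steenrod_operations p scale act \<Longrightarrow>
    (\<lambda>x. act g (\<theta> x)) \<in> steenrod_operations p scale act"
| add: "\<theta> \<in> steenrod_operations p scale act \<Longrightarrow> \<theta>' \<in> steenrod_operations p scale act \<Longrightarrow>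
    (\<lambda>x. \<theta> x + \<theta>' x) \<in> steenrod_operations p scale act"
| scale: "\<theta> \<in> steenrod_operations p scale act \<Longrightarrow>
    (\<lambda>x. scale c (\<theta> x)) \<in> steenrod_operations p scale act"

definition finitely_generated_unstable ::
  "nat \<Rightarrow> ('k::field \<Rightarrow> 'a::ring_1 \<Rightarrow> 'a) \<Rightarrow> (steenrod_gen \<Rightarrow> 'a \<Rightarrow> 'a) \<Rightarrow>
    'a set \<Rightarrow> bool" where
  "finitely_generated_unstable p scale act A \<longleftrightarrow>
    (\<exists>S. finite S \<and> S \<subseteq> A \<and>
      A = subalgebra scale hull {\<theta> x |\<theta> x. \<theta> \<in> steenrod_operations p scale act \<and> x \<in> S})"

end

theory Submission
  imports Defs
begin

text \<open>
  The argument has the shape of Hilbert's basis theorem, with the Frobenius map in the place of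
  multiplication by the variable. Let \<open>B\<close> be the Hopf algebra and \<open>C\<close> the subalgebra. Adjoining one element
  of \<open>C\<close> after the other, always one of least possible degree, gives an increasing sequence of finitely
  generated unstable subalgebras \<open>A\<^sub>i\<close> of \<open>C\<close>, and one has to show that it reaches \<open>C\<close>. By the choice of the
  degrees, each new element \<open>c\<close> is primitive modulo the previous subalgebra, in the sense that
  \<open>\<Delta> c - 1 \<otimes> c\<close> lies in \<open>B \<otimes> A\<^sub>i\<close>.

  The leading coefficients of a subalgebra \<open>A\<close> are its Frobenius roots: for each \<open>k\<close>, the classes of the
  elements \<open>y\<close> with \<open>y\<^bsup>p^k\<^esup> \<in> A\<close> in the module \<open>Q B\<close> of indecomposables (\<open>frobenius_roots\<close>). They grow with
  \<open>k\<close> and with \<open>A\<close>, and they are submodules over the algebra generated by the Steenrod powers. Two facts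
  carry the proof.

  First, \<open>Q B\<close> is noetherian over the powers (\<open>acc_indecomposables\<close>), so that two consecutive \<open>A\<^sub>i\<close> have
  the same roots for all \<open>k\<close> at once. More generally this holds for finitely generated unstable modules
  (\<open>acc_submodules_of_finitely_generated\<close>), for the following reason. By the Adem relations, the last
  operation allowed by instability has a submodule as its image, and the quotient by it is the suspension
  of an unstable module, in which the generators have smaller degrees. This quotient is noetherian by
  induction, and the property is lifted back by an argument of the same shape, with that operation in the
  place of the Frobenius map. For odd primes it is essential to drop the Bockstein from the closure
  properties of submodules: preimages under the top operation and under the Frobenius map are closed under
  the powers but not under the Bockstein.

  Secondly, a decomposable element that is primitive modulo \<open>A\<close> is a \<open>p\<close>-th power modulo \<open>A\<close>
  (\<open>decomposable_primitive_modulo_subalgebra\<close>). For \<open>A\<close> the ground field this is a theorem of Milnor and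
  Moore. It is proved by letting functionals \<open>\<phi>\<close> act by \<open>D \<phi> = (id \<otimes> \<phi>) \<Delta>\<close>. A functional that vanishes on
  decomposables acts as a derivation, and this places the element in the subalgebra generated by \<open>A\<close> and
  the \<open>p\<close>-th powers (\<open>decomposable_primitive_in_subalgebra\<close>); a functional that vanishes on the ideal
  generated by \<open>A\<close> acts linearly over \<open>A\<close> and reads off coefficients, and this separates the two
  contributions (\<open>product_of_subalgebras_splits\<close>).

  If now \<open>c\<close> is a \<open>p\<^sup>k\<close>-th power modulo \<open>A\<^sub>i\<close>, then equality of the roots allows one to take the \<open>p\<^sup>k\<close>-th
  power of a decomposable element, and the second fact, applied to the Hopf algebra of \<open>p\<^sup>k\<close>-th powers,
  turns it into a \<open>p\<^bsup>k+1\<^esup>\<close>-th power. As this is impossible for large \<open>k\<close>, the element \<open>c\<close> was in \<open>A\<^sub>i\<close> already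
  (\<open>mem_of_equal_frobenius_roots\<close>).
\<close>

section \<open>Ascending chains\<close>

text \<open>
  The condition is stated for the members of a class \<open>S\<close> of elements of an order; in the applications
  these are graded submodules, ordered degree by degree.
\<close>

definition ascending_chain_condition :: "('b::order \<Rightarrow> bool) \<Rightarrow> bool" where
  "ascending_chain_condition S \<longleftrightarrow>
    (\<forall>U. (\<forall>i::nat. S (U i)) \<and> mono U \<longrightarrow> (\<exists>N. \<forall>i\<ge>N. U i = U N))"

lemma ascending_chain_conditionD:
  fixes U :: "nat \<Rightarrow> 'b::order"
  assumes "ascending_chain_condition S" and "\<And>i. S (U i)" and "mono U"
  shows "\<exists>N. \<forall>i\<ge>N. U i = U N"
  using assms unfolding ascending_chain_condition_def by simp

text \<open>
  The diagonal \<open>g k k\<close> is a chain, so it stops at some \<open>K\<close>, and beyond \<open>(K, K)\<close> every term is squeezed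
  between two diagonal terms. Only the finitely many rows \<open>k < K\<close> are left. The point is that the bound
  \<open>N\<close> does not depend on the row.
\<close>

lemma double_chain_stabilizes:
  fixes g :: "nat \<Rightarrow> nat \<Rightarrow> 'b::order"
  assumes acc: "ascending_chain_condition S" and S: "\<And>k i. S (g k i)"
    and mono_k: "\<And>k i. g k i \<le> g (Suc k) i" and mono_i: "\<And>k i. g k i \<le> g k (Suc i)"
  obtains N where "\<And>k i. N \<le> i \<Longrightarrow> g k i = g k N"
proof -
  have mk: "g k i \<le> g k' i" if "k \<le> k'" for k k' i
    using lift_Suc_mono_le[of "\<lambda>k. g k i" k k', OF mono_k that] .
  have mi: "g k i \<le> g k i'" if "i \<le> i'" for k i i'
    using lift_Suc_mono_le[of "g k" i i', OF mono_i that] .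
  have "mono (\<lambda>k. g k k)"
    by (rule monoI) (rule order_trans[OF mk mi])
  from ascending_chain_conditionD[OF acc S this]
  obtain K where K: "\<And>k. K \<le> k \<Longrightarrow> g k k = g K K" by auto
  have big: "g k i = g K K" if "K \<le> k" "K \<le> i" for k i
  proof (rule antisym)
    have "g k i \<le> g (max k i) (max k i)" 
      by (rule order_trans[OF mk mi]) simp_all
    then show "g k i \<le> g K K" using K[of "max k i"] that by simp
    show "g K K \<le> g k i" by (rule order_trans[OF mk mi]) (use that in simp_all)
  qed
  have "\<exists>N. \<forall>i\<ge>N. g k i = g k N" for k
    by (rule ascending_chain_conditionD[OF acc S]) (rule monoI, rule mi)
  then obtain N where N: "\<And>k i. N k \<le> i \<Longrightarrow> g k i = g k (N k)" by metis
  define M where "M = Max (insert K (N ` {..K}))"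
  have "K \<le> M" unfolding M_def by (rule Max_ge) auto
  have "N k \<le> M" if "k \<le> K" for k unfolding M_def by (rule Max_ge) (use that in auto)
  have "g k i = g k M" if "M \<le> i" for k i
  proof (cases "k \<le> K")
    case True
    then show ?thesis using N[of k i] N[of k M] \<open>M \<le> i\<close> \<open>k \<le> K \<Longrightarrow> N k \<le> M\<close> by simp
  next
    case False
    then show ?thesis using big[of k i] big[of k M] \<open>M \<le> i\<close> \<open>K \<le> M\<close> by simp
  qed
  then show thesis by (rule that)
qed

section \<open>Homogeneous components\<close>

context graded_vector_space
begin

lemma decomposes_component: "decomposes G x (component G x)"
  unfolding component_def using decomposition by (rule theI')

lemma component_unique: "decomposes G x c \<Longrightarrow> component G x = c"
  using decomposition[of x] decomposes_component[of x] by blast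

lemma component_in: "component G x n \<in> G n"
  and finite_component: "finite {n. component G x n \<noteq> 0}"
  and sum_component: "(\<Sum>n | component G x n \<noteq> 0. component G x n) = x"
proof -
  note * = decomposes_component[of x, unfolded decomposes_def]
  show "component G x n \<in> G n" using conjunct1[OF *] by (rule spec)
  show "finite {n. component G x n \<noteq> 0}" using * by (elim conjE)
  show "(\<Sum>n | component G x n \<noteq> 0. component G x n) = x" using * by (elim conjE) (rule sym)
qed

lemma sum_component_superset:
  assumes "finite I" "{n. component G x n \<noteq> 0} \<subseteq> I"
  shows "(\<Sum>n\<in>I. component G x n) = x"
  using sum.mono_neutral_left[OF assms, of "component G x"] sum_component[of x] by auto

lemma component_eqI:
  assumes "\<And>n. c n \<in> G n" "finite I" "\<And>n. c n \<noteq> 0 \<Longrightarrow> n \<in> I" "x = (\<Sum>n\<in>I. c n)"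
  shows "component G x = c"
proof (rule component_unique, unfold decomposes_def, intro conjI allI)
  have sub: "{n. c n \<noteq> 0} \<subseteq> I" using assms(3) by blast
  then show "finite {n. c n \<noteq> 0}" using assms(2) finite_subset by blast
  show "x = (\<Sum>n | c n \<noteq> 0. c n)"
    using sum.mono_neutral_left[OF assms(2) sub, of c] assms(4) by auto
qed (rule assms(1))

lemma zero_in_G [simp]: "0 \<in> G n"
  by (rule subspace_0[OF subspace_G])

lemma component_add: "component G (x + y) n = component G x n + component G y n"
proof -
  let ?I = "{n. component G x n \<noteq> 0} \<union> {n. component G y n \<noteq> 0}"
  have "component G (x + y) = (\<lambda>n. component G x n + component G y n)"
  proof (rule component_eqI[where I = ?I])
    show "x + y = (\<Sum>n\<in>?I. component G x n + component G y n)"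
      unfolding sum.distrib by (subst (1 2) sum_component_superset) (auto simp: finite_component)
  qed (auto simp: component_in finite_component subspace_add[OF subspace_G])
  then show ?thesis by simp
qed

lemma component_scale: "component G (c *s x) n = c *s component G x n"
proof -
  have "component G (c *s x) = (\<lambda>n. c *s component G x n)"
    by (rule component_eqI[where I = "{n. component G x n \<noteq> 0}"])
      (auto simp: component_in finite_component sum_component scale_sum_right[symmetric]
        subspace_scale[OF subspace_G])
  then show ?thesis by simp
qed

lemma component_homogeneous: "x \<in> G n \<Longrightarrow> component G x m = (if m = n then x else 0)"
proof -
  assume x: "x \<in> G n"
  have "component G x = (\<lambda>m. if m = n then x else 0)"
    by (rule component_eqI[where I = "{n}"]) (use x in \<open>auto split: if_splits\<close>)
  then show ?thesis by simp
qed

lemma homogeneous_degree_unique: "x \<in> G m \<Longrightarrow> x \<in> G n \<Longrightarrow> m \<noteq> n \<Longrightarrow> x = 0"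
  using component_homogeneous[of x m m] component_homogeneous[of x n m] by simp

lemma component_zero: "component G 0 n = 0"
  using component_homogeneous[of 0 0 n] by simp

text \<open>
  Graded subobjects are given by their homogeneous parts, as functions of the degree. Their elements are
  then homogeneous, which keeps signs and powers under control.
\<close>

definition graded_subspace :: "(nat \<Rightarrow> 'a set) \<Rightarrow> bool" where
  "graded_subspace U \<longleftrightarrow> (\<forall>n. subspace (U n) \<and> U n \<subseteq> G n)"

lemma graded_subspaceD:
  assumes "graded_subspace U"
  shows "subspace (U n)" "x \<in> U n \<Longrightarrow> x \<in> G n" "0 \<in> U n"
    "x \<in> U n \<Longrightarrow> y \<in> U n \<Longrightarrow> x + y \<in> U n" "x \<in> U n \<Longrightarrow> y \<in> U n \<Longrightarrow> x - y \<in> U n"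
    "x \<in> U n \<Longrightarrow> c *s x \<in> U n" "x \<in> U n \<Longrightarrow> - x \<in> U n"
proof -
  have *: "subspace (U n) \<and> U n \<subseteq> G n" using assms unfolding graded_subspace_def by (rule spec)
  then show U: "subspace (U n)" by (rule conjunct1)
  from * show "x \<in> U n \<Longrightarrow> x \<in> G n" by blast
  show "0 \<in> U n" using U by (rule subspace_0)
  show "x \<in> U n \<Longrightarrow> y \<in> U n \<Longrightarrow> x + y \<in> U n" using U by (rule subspace_add)
  show "x \<in> U n \<Longrightarrow> y \<in> U n \<Longrightarrow> x - y \<in> U n" using U by (rule subspace_diff)
  show "x \<in> U n \<Longrightarrow> c *s x \<in> U n" using U by (rule subspace_scale)
  show "x \<in> U n \<Longrightarrow> - x \<in> U n" using U by (rule subspace_neg)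
qed

lemma graded_subspace_G: "graded_subspace G"
  by (simp add: graded_subspace_def subspace_G)

end

section \<open>Steenrod powers and the Adem relations\<close>

text \<open>
  The prime 2 and the odd primes are treated together: \<open>\<P> i\<close> is the Steenrod square or the reduced power,
  \<open>\<P> i\<close> is the \<open>p\<close>-th power on an unstable algebra in degree \<open>w i\<close> and zero in smaller degrees, and the Bockstein is replaced by \<open>0\<close> if \<open>p = 2\<close>, where \<open>Sq\<^sup>1\<close> is already among the
  \<open>\<P> i\<close>. The operation \<open>\<P> i\<close> raises degrees by \<open>\<delta> i\<close>.
\<close>

locale fp_unstable_module = unstable_module p scale G act
  for p :: nat
    and scale :: "'k::field \<Rightarrow> 'a::ab_group_add \<Rightarrow> 'a" (infixr \<open>*s\<close> 75)
    and G :: "nat \<Rightarrow> 'a set"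
    and act :: "steenrod_gen \<Rightarrow> 'a \<Rightarrow> 'a" +
  assumes prime_p: "prime p" and card_k: "CARD('k) = p"
begin

definition w :: nat where "w = (if p = 2 then 1 else 2)"

definition \<delta> :: "nat \<Rightarrow> nat" where "\<delta> i = w * i * (p - 1)"

definition \<P> :: "nat \<Rightarrow> 'a \<Rightarrow> 'a" where "\<P> i = (if p = 2 then act (Sq i) else act (RP i))"

definition \<beta> :: "'a \<Rightarrow> 'a" where "\<beta> = (if p = 2 then (\<lambda>x. 0) else act Bockstein)"

lemma p_eq_2:
  assumes "p = 2"
  shows "w = 1" "\<P> i = act (Sq i)" "\<beta> = (\<lambda>x. 0)" "\<delta> i = i"
  unfolding w_def \<P>_def \<beta>_def \<delta>_def using assms by simp_all

lemma p_neq_2: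
  assumes "p \<noteq> 2"
  shows "w = 2" "\<P> i = act (RP i)" "\<beta> = act Bockstein" "\<delta> i = 2 * i * (p - 1)"
  unfolding w_def \<P>_def \<beta>_def \<delta>_def using assms by simp_all

lemma p_ge_2: "2 \<le> p" using prime_p prime_ge_2_nat by blast

lemma odd_p: "p \<noteq> 2 \<Longrightarrow> odd p"
  using prime_p p_ge_2 prime_odd_nat by force

lemma w_pos: "0 < w" by (simp add: w_def)

lemma w_cases: obtains "w = 1" | "w = 2" using p_eq_2(1) p_neq_2(1) by blast

lemma \<delta>_0: "\<delta> 0 = 0" and \<delta>_add: "\<delta> (i + j) = \<delta> i + \<delta> j"
  by (simp_all add: \<delta>_def algebra_simps)

lemma \<delta>_plus: "w * i + \<delta> i = w * (p * i)"
proof -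
  have "p * i = i + i * (p - 1)" using p_ge_2 by (cases p) auto
  then have "w * (p * i) = w * (i + i * (p - 1))" by (rule arg_cong)
  then show ?thesis by (simp only: \<delta>_def distrib_left mult.assoc)
qed

lemma \<delta>_pos: "0 < i \<Longrightarrow> 0 < \<delta> i"
  using w_pos p_ge_2 by (simp add: \<delta>_def)

lemma \<delta>_mult: "\<delta> (p * i) = p * \<delta> i" by (simp add: \<delta>_def)

lemma gens_cases:
  assumes "g \<in> steenrod_gens p"
  obtains i where "act g = \<P> i" "gen_degree p g = \<delta> i" | "act g = \<beta>" "gen_degree p g = 1"
proof (cases "p = 2")
  case True
  with assms obtain i where "g = Sq i" unfolding steenrod_gens_def by auto
  then show thesis by (intro that(1)[of i]) (simp_all add: p_eq_2[OF True])
next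
  case False
  with assms consider "g = Bockstein" | i where "g = RP i" unfolding steenrod_gens_def by auto
  then show thesis
  proof cases
    case 1
    then show thesis by (intro that(2)) (simp_all add: p_neq_2[OF False])
  next
    case (2 i)
    then show thesis by (intro that(1)[of i]) (simp_all add: p_neq_2[OF False])
  qed
qed

lemma \<P>_act: "\<exists>g\<in>steenrod_gens p. \<P> i = act g"
  unfolding \<P>_def steenrod_gens_def by auto

lemma \<beta>_act: "\<beta> = (\<lambda>x. 0) \<or> (\<exists>g\<in>steenrod_gens p. \<beta> = act g)"
  unfolding \<beta>_def steenrod_gens_def by auto

lemma \<P>_linear: "Vector_Spaces.linear scale scale (\<P> i)"
  using \<P>_act[of i] act_linear by auto

lemma \<beta>_linear: "Vector_Spaces.linear scale scale \<beta>"
proof (cases "p = 2")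
  case True
  interpret vector_space_pair scale scale by unfold_locales
  show ?thesis using module_hom_zero by (simp add: p_eq_2[OF True] linear_iff_module_hom)
qed (simp add: \<beta>_def act_linear steenrod_gens_def)

sublocale \<P>: Vector_Spaces.linear scale scale "\<P> i" for i by (rule \<P>_linear)
sublocale \<beta>: Vector_Spaces.linear scale scale \<beta> by (rule \<beta>_linear)

lemma \<P>_in_G: "x \<in> G n \<Longrightarrow> \<P> i x \<in> G (n + \<delta> i)"
  using act_degree[of "Sq i" x n] act_degree[of "RP i" x n]
  unfolding \<P>_def w_def \<delta>_def steenrod_gens_def by auto

lemma \<beta>_in_G: "x \<in> G n \<Longrightarrow> \<beta> x \<in> G (n + 1)"
  using act_degree[of Bockstein x n]
  unfolding \<beta>_def steenrod_gens_def by auto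

lemma \<P>_0: "\<P> 0 x = x"
  by (simp add: \<P>_def Sq_0 RP_0)

lemma \<beta>_\<beta>: "\<beta> (\<beta> x) = 0"
  by (simp add: \<beta>_def Bockstein_Bockstein)

lemma finite_mult_le: "finite {j. p * j \<le> (a::nat)}"
proof (rule finite_subset)
  show "{j. p * j \<le> a} \<subseteq> {..a}"
  proof
    fix j assume j: "j \<in> {j. p * j \<le> a}"
    have "1 * j \<le> p * j" by (rule mult_le_mono1) (use p_ge_2 in simp)
    then have "j \<le> a" using j by (simp only: mem_Collect_eq nat_mult_1)
    then show "j \<in> {..a}" by simp
  qed
qed simp

text \<open>
  Of the Adem coefficients only one matters below: the one of the term with \<open>p j = a\<close>, which is
  \<open>(- 1)\<^bsup>(p + 1) j\<^esup> = 1\<close>. All other terms will vanish by instability.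
\<close>

lemma \<P>_\<P>:
  assumes "0 < a" "a < p * b"
  shows "\<exists>f. (\<forall>j. p * j = a \<longrightarrow> f j = 1) \<and>
    \<P> a (\<P> b x) = (\<Sum>j | p * j \<le> a. f j *s \<P> (a + b - j) (\<P> j x))"
proof (cases "p = 2")
  case True
  let ?f = "\<lambda>j. of_nat ((b - 1 - j) choose (a - 2 * j)) :: 'k"
  show ?thesis
    unfolding p_eq_2[OF True]
    by (rule exI[of _ ?f]) (use True assms Sq_adem[of a b x] in simp)
next
  case False
  let ?f = "\<lambda>j. (-1) ^ (a + j) * of_nat (((p - 1) * (b - j) - 1) choose (a - p * j)) :: 'k"
  have "?f j = 1" if "p * j = a" for j
    using odd_p[OF False] that by auto
  moreover have "\<P> a (\<P> b x) = (\<Sum>j | p * j \<le> a. ?f j *s \<P> (a + b - j) (\<P> j x))"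
    using RP_adem[OF False assms, of x] by (simp add: p_neq_2[OF False])
  ultimately show ?thesis by (intro exI[of _ ?f] conjI allI impI)
qed

lemma \<P>_\<beta>_\<P>:
  assumes "0 < a" "a \<le> p * b"
  shows "\<exists>f g. (\<forall>j. p * j = a \<longrightarrow> f j = 1) \<and> (\<forall>j. p * j + 1 = a \<longrightarrow> g j = 1) \<and>
    \<P> a (\<beta> (\<P> b x)) = (\<Sum>j | p * j \<le> a. f j *s \<beta> (\<P> (a + b - j) (\<P> j x))) +
      (\<Sum>j | p * j \<le> a - 1. g j *s \<P> (a + b - j) (\<beta> (\<P> j x)))"
proof (cases "p = 2")
  case True
  show ?thesis by (intro exI[of _ "\<lambda>_. 1"]) (simp add: \<P>.zero p_eq_2(3)[OF True])
next
  case False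
  let ?f = "\<lambda>j. (-1) ^ (a + j) * of_nat (((p - 1) * (b - j)) choose (a - p * j)) :: 'k"
  let ?g = "\<lambda>j. (-1) ^ (a + j - 1) * of_nat (((p - 1) * (b - j) - 1) choose (a - p * j - 1)) :: 'k"
  have "?f j = 1" if "p * j = a" for j
    using odd_p[OF False] that by auto
  moreover have "?g j = 1" if "p * j + 1 = a" for j
  proof -
    have "a + j - 1 = (p + 1) * j" "a - p * j - 1 = 0" using that by (auto simp: algebra_simps)
    then show ?thesis using odd_p[OF False] by simp
  qed
  moreover have "\<P> a (\<beta> (\<P> b x)) = (\<Sum>j | p * j \<le> a. ?f j *s \<beta> (\<P> (a + b - j) (\<P> j x))) +
      (\<Sum>j | p * j \<le> a - 1. ?g j *s \<P> (a + b - j) (\<beta> (\<P> j x)))"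
    using RP_Bockstein_adem[OF False assms, of x] by (simp add: p_neq_2[OF False])
  ultimately show ?thesis by (intro exI[of _ ?f] exI[of _ ?g] conjI allI impI)
qed

lemma sum_minus_summand_in_subspace:
  assumes V: "subspace V" and I: "finite I" and t: "\<And>j. j \<in> I \<Longrightarrow> j \<noteq> j0 \<Longrightarrow> t j \<in> V"
    and j0: "j0 \<in> I"
  shows "sum t I - t j0 \<in> V"
proof -
  have "sum t I = t j0 + sum t (I - {j0})" using sum.remove[OF I j0] .
  moreover have "sum t (I - {j0}) \<in> V" by (rule subspace_sum[OF V]) (use t in auto)
  ultimately show ?thesis by simp
qed

lemma \<P>_unstable: "x \<in> G n \<Longrightarrow> n < w * i \<Longrightarrow> \<P> i x = 0"
proof (cases "p = 2")
  case True
  then show "x \<in> G n \<Longrightarrow> n < w * i \<Longrightarrow> \<P> i x = 0"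
    unfolding p_eq_2[OF True] using Sq_unstable[of x n i] by simp
next
  case False
  then show "x \<in> G n \<Longrightarrow> n < w * i \<Longrightarrow> \<P> i x = 0"
    unfolding p_neq_2[OF False] using RP_unstable[of x n i] by simp
qed

lemma \<beta>_\<P>_unstable: "x \<in> G n \<Longrightarrow> n < w * i + 1 \<Longrightarrow> \<beta> (\<P> i x) = 0"
proof (cases "p = 2")
  case True
  then show "\<beta> (\<P> i x) = 0" unfolding p_eq_2[OF True] by simp
next
  case False
  then show "x \<in> G n \<Longrightarrow> n < w * i + 1 \<Longrightarrow> \<beta> (\<P> i x) = 0"
    unfolding p_neq_2[OF False] using Bockstein_RP_unstable[of x n i] by simp
qed

text \<open>
  The Bockstein is kept apart: the submodules in the chain condition below are closed under the powers only.
\<close>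

definition \<P>_closed :: "(nat \<Rightarrow> 'a set) \<Rightarrow> bool" where
  "\<P>_closed U \<longleftrightarrow> (\<forall>n i. \<forall>x\<in>U n. \<P> i x \<in> U (n + \<delta> i))"

definition \<beta>_closed :: "(nat \<Rightarrow> 'a set) \<Rightarrow> bool" where
  "\<beta>_closed U \<longleftrightarrow> (\<forall>n. \<forall>x\<in>U n. \<beta> x \<in> U (n + 1))"

definition stable :: "(nat \<Rightarrow> 'a set) \<Rightarrow> bool" where
  "stable U \<longleftrightarrow> graded_subspace U \<and> \<P>_closed U \<and> \<beta>_closed U"

text \<open>
  The condition says that the quotient by \<open>J\<close> is the \<open>s\<close>-fold suspension of an unstable module. Working modulo
  families \<open>J\<close> in one fixed module takes the place of forming quotients.
\<close>

definition unstable_modulo :: "nat \<Rightarrow> (nat \<Rightarrow> 'a set) \<Rightarrow> bool" where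
  "unstable_modulo s J \<longleftrightarrow>
    (\<forall>n i. \<forall>x\<in>G n. n < w * i + s \<longrightarrow> \<P> i x \<in> J (n + \<delta> i)) \<and>
    (\<forall>n i. \<forall>x\<in>G n. n < w * i + 1 + s \<longrightarrow> \<beta> (\<P> i x) \<in> J (n + \<delta> i + 1))"

text \<open>
  On an \<open>s\<close>-fold suspension, this is the last operation that instability allows on an element of degree
  \<open>n\<close>: with \<open>e = n - s\<close>, it is \<open>\<P> b\<close> if \<open>e = w b\<close>, and \<open>\<beta> \<P> b\<close> if \<open>p\<close> is odd and \<open>e = 2 b + 1\<close>. For
  \<open>p = 2\<close> and \<open>s = 0\<close> this is the operation usually written \<open>Sq\<^sub>0\<close>. In degrees up to \<open>s\<close> it is the identity.
\<close>

definition top_op :: "nat \<Rightarrow> nat \<Rightarrow> 'a \<Rightarrow> 'a" where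
  "top_op s n x = (if w dvd n - s then \<P> ((n - s) div w) x else \<beta> (\<P> ((n - s) div w) x))"

definition top_degree :: "nat \<Rightarrow> nat \<Rightarrow> nat" where
  "top_degree s n = n + \<delta> ((n - s) div w) + (n - s) mod w"

lemma excess_cases [consumes 1, case_names even odd]:
  assumes "s \<le> n"
  obtains b where "n = s + w * b" | b where "w = 2" "n = s + 2 * b + 1"
proof (cases "w dvd n - s")
  case True
  then obtain b where "n - s = w * b" by (elim dvdE)
  with assms show thesis by (intro that(1)[of b]) simp
next
  case False
  then have w: "w = 2" by (cases rule: w_cases) simp_all
  with False have "odd (n - s)" by metis
  then obtain b where "n - s = 2 * b + 1" by (rule oddE)
  with assms show thesis by (intro that(2)[of b] w) simp
qed

lemma top_even: "top_op s (s + w * b) x = \<P> b x" "top_degree s (s + w * b) = s + w * (p * b)"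
  using w_pos by (simp_all add: top_op_def top_degree_def \<delta>_plus[symmetric])

lemma top_odd:
  assumes "w = 2"
  shows "top_op s (s + 2 * b + 1) x = \<beta> (\<P> b x)"
    "top_degree s (s + 2 * b + 1) = s + w * (p * b + 1)"
proof -
  have "(2 * b + 1) mod 2 = 1" "(2 * b + 1) div 2 = b" by presburger+
  moreover have "s + 2 * b + 1 - s = 2 * b + 1" by simp
  ultimately show "top_op s (s + 2 * b + 1) x = \<beta> (\<P> b x)"
    "top_degree s (s + 2 * b + 1) = s + w * (p * b + 1)"
    unfolding top_op_def top_degree_def using \<delta>_plus[of b] assms by simp_all
qed

lemma top_below: "n \<le> s \<Longrightarrow> top_op s n x = x" "n \<le> s \<Longrightarrow> top_degree s n = n"
  by (simp_all add: top_op_def top_degree_def \<P>_0 \<delta>_0)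

lemma top_linear: "Vector_Spaces.linear scale scale (top_op s n)"
proof (cases "w dvd n - s")
  case True
  then have "top_op s n = \<P> ((n - s) div w)" by (auto simp: top_op_def)
  then show ?thesis using \<P>_linear by simp
next
  case False
  then have "top_op s n = \<beta> \<circ> \<P> ((n - s) div w)" by (auto simp: top_op_def)
  then show ?thesis using Vector_Spaces.linear_compose[OF \<P>_linear \<beta>_linear] by simp
qed

sublocale top_op: Vector_Spaces.linear scale scale "top_op s n" for s n by (rule top_linear)

lemma top_degree_eq: "top_degree s n = (if w dvd n - s then n + \<delta> ((n - s) div w)
    else n + \<delta> ((n - s) div w) + 1)"
proof (cases "w dvd n - s")
  case False
  then have "w = 2" by (cases rule: w_cases) simp_all
  then have "(n - s) mod w = 1" using False by (metis odd_iff_mod_2_eq_one)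
  then show ?thesis using False by (simp add: top_degree_def)
qed (simp add: top_degree_def)

lemma top_in_stable: "stable J \<Longrightarrow> x \<in> J n \<Longrightarrow> top_op s n x \<in> J (top_degree s n)"
  by (simp add: top_op_def top_degree_eq stable_def \<P>_closed_def \<beta>_closed_def)

lemma stable_G: "stable G"
  using graded_subspace_G \<P>_in_G \<beta>_in_G by (simp add: stable_def \<P>_closed_def \<beta>_closed_def)

lemma top_in_G: "x \<in> G n \<Longrightarrow> top_op s n x \<in> G (top_degree s n)"
  using top_in_stable[OF stable_G] .

text \<open>
  Injectivity of the degree shift ensures that an element of the image of \<open>top_op s\<close> in a given degree comes
  from a single degree.
\<close>

lemma top_degree_strict_mono: "strict_mono (top_degree s)"
proof (subst strict_mono_Suc_iff, rule allI)
  fix n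
  show "top_degree s n < top_degree s (Suc n)"
  proof (cases "Suc n \<le> s")
    case True
    then show ?thesis by (simp add: top_below)
  next
    case False
    then have "s \<le> n" by simp
    then show ?thesis
    proof (cases rule: excess_cases)
      case (even b)
      show ?thesis
      proof (cases "w = 2")
        case True
        have "Suc n = s + 2 * b + 1" using even True by simp
        moreover have "top_degree s n < s + w * (p * b + 1)"
          using even top_even(2)[of s b] w_pos by simp
        ultimately show ?thesis using top_odd(2)[OF True, of s b] by metis
      next
        case False
        then have w: "w = 1" by (cases rule: w_cases) simp_all
        have "Suc n = s + w * Suc b" using even w by simp
        then show ?thesis
          using top_even(2)[of s b] top_even(2)[of s "Suc b"] even w p_ge_2 by simp
      qed
    next
      case (odd b)
      have "Suc n = s + w * Suc b" using odd by simp
      then show ?thesis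
        using top_odd(2)[OF odd(1), of s b] top_even(2)[of s "Suc b"] odd p_ge_2 by simp
    qed
  qed
qed

lemma less_top_degree: "s < n \<Longrightarrow> n < top_degree s n"
proof (induction n)
  case (Suc n)
  show ?case
  proof (cases "n = s")
    case True
    have "top_degree s s = s" by (simp add: top_below)
    moreover have "top_degree s (Suc s) \<noteq> Suc s"
      using p_ge_2 by (cases rule: w_cases) (auto simp: top_degree_def \<delta>_def)
    ultimately show ?thesis
      using True strict_monoD[OF top_degree_strict_mono, of s "Suc s" s] by simp
  next
    case False
    then show ?thesis
      using Suc strict_monoD[OF top_degree_strict_mono, of n "Suc n" s] by simp
  qed
qed simp

section \<open>The top operation and the Adem relations\<close>

lemma stableD:
  assumes "stable J"
  shows "graded_subspace J" "x \<in> J n \<Longrightarrow> \<P> i x \<in> J (n + \<delta> i)" "x \<in> J n \<Longrightarrow> \<beta> x \<in> J (n + 1)"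
    "x \<in> J n \<Longrightarrow> n + \<delta> i = m \<Longrightarrow> \<P> i x \<in> J m" "x \<in> J n \<Longrightarrow> n + 1 = m \<Longrightarrow> \<beta> x \<in> J m"
  using assms unfolding stable_def \<P>_closed_def \<beta>_closed_def by auto

lemma unstable_moduloD:
  assumes "unstable_modulo s J"
  shows "x \<in> G n \<Longrightarrow> n < w * i + s \<Longrightarrow> n + \<delta> i = m \<Longrightarrow> \<P> i x \<in> J m"
    "x \<in> G n \<Longrightarrow> n < w * i + 1 + s \<Longrightarrow> n + \<delta> i + 1 = m \<Longrightarrow> \<beta> (\<P> i x) \<in> J m"
  using assms unfolding unstable_modulo_def by auto

text \<open>
  The difference between \<open>p i\<close> and \<open>i\<close>, so that the Adem index \<open>a + b - j\<close> is \<open>b + \<rho> j\<close> for \<open>a = p j\<close>.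
\<close>

definition \<rho> :: "nat \<Rightarrow> nat" where "\<rho> i = i * (p - 1)"

lemma \<delta>_\<rho>: "\<delta> i = w * \<rho> i" by (simp add: \<delta>_def \<rho>_def)

lemma plus_\<rho>: "i + \<rho> i = p * i"
  unfolding \<rho>_def using p_ge_2 by (cases p) auto

lemma sum_minus_optional_summand:
  assumes V: "subspace V" and I: "finite I" and t: "\<And>j. j \<in> I \<Longrightarrow> \<not> (c \<and> j = j0) \<Longrightarrow> t j \<in> V"
    and j0: "c \<Longrightarrow> j0 \<in> I"
  shows "sum t I - (if c then t j0 else 0) \<in> V"
proof (cases c)
  case True
  then show ?thesis using sum_minus_summand_in_subspace[OF V I, of j0 t] t j0 by simp
next
  case False
  then show ?thesis using subspace_sum[OF V, of I t] t by simp
qed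

text \<open>
  In the Adem relation for \<open>\<P> a \<P> b x\<close>, the term of index \<open>j\<close> has \<open>\<P> (a + b - j)\<close> applied to an element of
  excess \<open>w (b + \<rho> j)\<close>. As \<open>j + \<rho> j = p j \<le> a\<close>, it vanishes by instability unless \<open>p j = a\<close>.
\<close>

lemma \<P>_top_even:
  assumes J: "stable J" and u: "unstable_modulo s J" and x: "x \<in> G (s + w * b)"
  shows "\<P> a (\<P> b x) - (if p dvd a then \<P> (b + \<rho> (a div p)) (\<P> (a div p) x) else 0)
    \<in> J (s + w * (p * b) + \<delta> a)" (is "_ - ?R \<in> J ?n")
proof -
  note gJ = graded_subspaceD[OF stableD(1)[OF J]]
  have n: "?n = s + w * b + \<delta> (a + b)" by (simp add: \<delta>_add \<delta>_plus[symmetric])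
  consider "a = 0" | "0 < a" "a < p * b" | "a = p * b" | "p * b < a" by linarith
  then show ?thesis
  proof cases
    case 1
    then show ?thesis by (simp add: \<P>_0 \<rho>_def gJ)
  next
    case 2
    obtain f where f: "\<And>j. p * j = a \<Longrightarrow> f j = 1"
      and e: "\<P> a (\<P> b x) = (\<Sum>j | p * j \<le> a. f j *s \<P> (a + b - j) (\<P> j x))"
      using \<P>_\<P>[OF 2, of x] by blast
    let ?t = "\<lambda>j. f j *s \<P> (a + b - j) (\<P> j x)"
    have "(\<Sum>j | p * j \<le> a. ?t j) - (if p dvd a then ?t (a div p) else 0) \<in> J ?n"
    proof (rule sum_minus_optional_summand[OF gJ(1) finite_mult_le])
      fix j assume j: "j \<in> {j. p * j \<le> a}" "\<not> (p dvd a \<and> j = a div p)"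
      then have "p * j \<noteq> a" using p_ge_2 by auto
      with j have lt: "j + \<rho> j < a" by (simp add: plus_\<rho>)
      then have "b + \<rho> j < a + b - j" by simp
      then have "w * b + \<delta> j < w * (a + b - j)"
        unfolding \<delta>_\<rho> distrib_left[symmetric] using w_pos by simp
      moreover have "j \<le> a + b" using lt by simp
      then have "\<delta> j + \<delta> (a + b - j) = \<delta> (a + b)" by (simp add: \<delta>_add[symmetric])
      ultimately show "?t j \<in> J ?n"
        by (intro gJ unstable_moduloD(1)[OF u \<P>_in_G[OF x]]) (simp_all add: n)
    qed simp
    moreover have "?R = (if p dvd a then ?t (a div p) else 0)"
    proof (cases "p dvd a")
      case True
      then have "f (a div p) = 1" by (intro f) simp
      moreover have "a + b - a div p = b + \<rho> (a div p)"
        using plus_\<rho>[of "a div p"] True by simp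
      ultimately show ?thesis using True by simp
    qed simp
    ultimately show ?thesis using e by simp
  next
    case 3
    then show ?thesis using plus_\<rho>[of b] p_ge_2 gJ by simp
  next
    case 4
    have "\<P> a (\<P> b x) \<in> J ?n"
    proof (rule unstable_moduloD(1)[OF u \<P>_in_G[OF x]])
      have "w * (p * b) < w * a" using 4 w_pos by simp
      then show "s + w * b + \<delta> b < w * a + s" using \<delta>_plus[of b] by simp
    qed (simp add: n \<delta>_add)
    moreover have "?R \<in> J ?n"
    proof (cases "p dvd a")
      case True
      then obtain i where i: "a = p * i" by (elim dvdE)
      have "\<P> i x \<in> J (s + w * b + \<delta> i)"
        by (rule unstable_moduloD(1)[OF u x]) (use 4 w_pos p_ge_2 i in auto)
      then have "\<P> (b + \<rho> i) (\<P> i x) \<in> J ?n"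
      proof (rule stableD(4)[OF J])
        have "a + b = i + (b + \<rho> i)" using i plus_\<rho>[of i] by simp
        then show "s + w * b + \<delta> i + \<delta> (b + \<rho> i) = ?n" unfolding n by (simp add: \<delta>_add)
      qed
      then show ?thesis using p_ge_2 i by simp
    qed (use gJ in simp)
    ultimately show ?thesis using gJ by blast
  qed
qed

text \<open>
  The same computation with the Adem relation for \<open>\<P> a \<beta> \<P> b\<close>: the first sum contributes the index with
  \<open>p j = a\<close> and the second one the index with \<open>p j + 1 = a\<close>; they exclude each other.
\<close>

lemma \<P>_top_odd:
  assumes J: "stable J" and u: "unstable_modulo s J" and w2: "w = 2"
    and x: "x \<in> G (s + 2 * b + 1)"
  shows "\<P> a (\<beta> (\<P> b x)) -
      ((if p dvd a then \<beta> (\<P> (b + \<rho> (a div p)) (\<P> (a div p) x)) else 0) +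
       (if 0 < a \<and> p dvd a - 1 then \<P> (b + 1 + \<rho> ((a - 1) div p)) (\<beta> (\<P> ((a - 1) div p) x)) else 0))
    \<in> J (s + w * (p * b + 1) + \<delta> a)" (is "_ - (?R + ?S) \<in> J ?n")
proof -
  note gJ = graded_subspaceD[OF stableD(1)[OF J]]
  have n: "?n = s + 2 * b + 2 + \<delta> (a + b)" using \<delta>_plus[of b] w2 by (simp add: \<delta>_add)
  have not_both: "\<not> (p dvd a \<and> p dvd a - 1)" if "0 < a"
  proof
    assume "p dvd a \<and> p dvd a - 1"
    then have "p dvd a - (a - 1)" using dvd_diff_nat by blast
    then show False using that p_ge_2 by simp
  qed
  consider "a = 0" | "0 < a" "a \<le> p * b" | "a = p * b + 1" | "p * b + 1 < a" by linarith
  then show ?thesis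
  proof cases
    case 1
    then show ?thesis by (simp add: \<P>_0 \<rho>_def gJ)
  next
    case 2
    obtain f g where f: "\<And>j. p * j = a \<Longrightarrow> f j = 1" and g: "\<And>j. p * j + 1 = a \<Longrightarrow> g j = 1"
      and e: "\<P> a (\<beta> (\<P> b x)) = (\<Sum>j | p * j \<le> a. f j *s \<beta> (\<P> (a + b - j) (\<P> j x))) +
      (\<Sum>j | p * j \<le> a - 1. g j *s \<P> (a + b - j) (\<beta> (\<P> j x)))"
      using \<P>_\<beta>_\<P>[OF 2, of x] by blast
    let ?t = "\<lambda>j. f j *s \<beta> (\<P> (a + b - j) (\<P> j x))"
    let ?v = "\<lambda>j. g j *s \<P> (a + b - j) (\<beta> (\<P> j x))"
    have T: "(\<Sum>j | p * j \<le> a. ?t j) - (if p dvd a then ?t (a div p) else 0) \<in> J ?n"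
    proof (rule sum_minus_optional_summand[OF gJ(1) finite_mult_le])
      fix j assume j: "j \<in> {j. p * j \<le> a}" "\<not> (p dvd a \<and> j = a div p)"
      then have "p * j \<noteq> a" using p_ge_2 by auto
      with j have lt: "j + \<rho> j < a" by (simp add: plus_\<rho>)
      then have "b + \<rho> j < a + b - j" by simp
      then have "2 * b + \<delta> j < w * (a + b - j)" unfolding \<delta>_\<rho> w2 by simp
      moreover have "j \<le> a + b" using lt by simp
      then have "\<delta> j + \<delta> (a + b - j) = \<delta> (a + b)" by (simp add: \<delta>_add[symmetric])
      then have "s + 2 * b + 1 + \<delta> j + \<delta> (a + b - j) + 1 = ?n" unfolding n by simp
      ultimately show "?t j \<in> J ?n"
        by (intro gJ unstable_moduloD(2)[OF u \<P>_in_G[OF x]]) (linarith | assumption)+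
    qed simp
    have V: "(\<Sum>j | p * j \<le> a - 1. ?v j) -
      (if 0 < a \<and> p dvd a - 1 then ?v ((a - 1) div p) else 0) \<in> J ?n"
    proof (rule sum_minus_optional_summand[OF gJ(1) finite_mult_le])
      fix j assume j: "j \<in> {j. p * j \<le> a - 1}" "\<not> ((0 < a \<and> p dvd a - 1) \<and> j = (a - 1) div p)"
      have "p * j \<noteq> a - 1"
      proof
        assume e: "p * j = a - 1"
        have "p dvd a - 1" "(a - 1) div p = j" unfolding e[symmetric] using p_ge_2 by simp_all
        with j(2) \<open>0 < a\<close> show False by simp
      qed
      with j have lt: "j + \<rho> j < a - 1" by (simp add: plus_\<rho>)
      then have "b + \<rho> j + 1 < a + b - j" by simp
      then have "2 * b + \<delta> j + 2 < w * (a + b - j)" unfolding \<delta>_\<rho> w2 by simp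
      moreover have "j \<le> a + b" using lt by simp
      then have "\<delta> j + \<delta> (a + b - j) = \<delta> (a + b)" by (simp add: \<delta>_add[symmetric])
      then have "s + 2 * b + 1 + \<delta> j + 1 + \<delta> (a + b - j) = ?n" unfolding n by simp
      ultimately show "?v j \<in> J ?n"
        by (intro gJ unstable_moduloD(1)[OF u \<beta>_in_G[OF \<P>_in_G[OF x]]]) (linarith | assumption)+
    qed simp
    have R: "?R = (if p dvd a then ?t (a div p) else 0)"
    proof (cases "p dvd a")
      case True
      then have "f (a div p) = 1" by (intro f) simp
      moreover have "a + b - a div p = b + \<rho> (a div p)"
        using plus_\<rho>[of "a div p"] True by simp
      ultimately show ?thesis using True by simp
    qed simp
    have S: "?S = (if 0 < a \<and> p dvd a - 1 then ?v ((a - 1) div p) else 0)"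
    proof (cases "p dvd a - 1")
      case True
      then have "g ((a - 1) div p) = 1" using 2 by (intro g) simp
      moreover have "a + b - (a - 1) div p = b + 1 + \<rho> ((a - 1) div p)"
        using plus_\<rho>[of "(a - 1) div p"] True 2 by simp
      ultimately show ?thesis using True by simp
    qed simp
    have "((\<Sum>j | p * j \<le> a. ?t j) - ?R) + ((\<Sum>j | p * j \<le> a - 1. ?v j) - ?S) \<in> J ?n"
      unfolding R S by (rule gJ(4)[OF T V])
    then show ?thesis unfolding e by (simp only: add_diff_add)
  next
    case 3
    then have "?R = 0" using not_both by auto
    moreover have "?S = \<P> a (\<beta> (\<P> b x))" using 3 plus_\<rho>[of b] p_ge_2 by simp
    ultimately show ?thesis using gJ by simp
  next
    case 4
    have "\<P> a (\<beta> (\<P> b x)) \<in> J ?n"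
    proof (rule unstable_moduloD(1)[OF u \<beta>_in_G[OF \<P>_in_G[OF x]]])
      show "s + 2 * b + 1 + \<delta> b + 1 < w * a + s" using 4 \<delta>_plus[of b] w2 by simp
      show "s + 2 * b + 1 + \<delta> b + 1 + \<delta> a = ?n" unfolding n by (simp add: \<delta>_add)
    qed
    moreover have "?R \<in> J ?n"
    proof (cases "p dvd a")
      case True
      then obtain i where i: "a = p * i" by (elim dvdE)
      then have "b < i" using 4 by (metis add_lessD1 mult_less_cancel1)
      then have "\<P> i x \<in> J (s + 2 * b + 1 + \<delta> i)"
        by (intro unstable_moduloD(1)[OF u x]) (use w2 in auto)
      then have "\<P> (b + \<rho> i) (\<P> i x) \<in> J (s + 2 * b + 1 + \<delta> (a + b))"
      proof (rule stableD(4)[OF J])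
        have "a + b = i + (b + \<rho> i)" using i plus_\<rho>[of i] by simp
        then show "s + 2 * b + 1 + \<delta> i + \<delta> (b + \<rho> i) = s + 2 * b + 1 + \<delta> (a + b)"
          by (simp add: \<delta>_add)
      qed
      then have "\<beta> (\<P> (b + \<rho> i) (\<P> i x)) \<in> J ?n"
        by (rule stableD(5)[OF J]) (use n in linarith)
      then show ?thesis using p_ge_2 i by simp
    qed (use gJ in simp)
    moreover have "?S \<in> J ?n"
    proof (cases "0 < a \<and> p dvd a - 1")
      case True
      then obtain i where i: "a - 1 = p * i" by (elim conjE dvdE)
      then have "p * b < p * i" using 4 by linarith
      then have "b < i" by simp
      then have "\<P> i x \<in> J (s + 2 * b + 1 + \<delta> i)"
        by (intro unstable_moduloD(1)[OF u x]) (use w2 in auto)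
      then have "\<beta> (\<P> i x) \<in> J (s + 2 * b + 2 + \<delta> i)"
        by (rule stableD(5)[OF J]) simp
      then have "\<P> (b + 1 + \<rho> i) (\<beta> (\<P> i x)) \<in> J ?n"
      proof (rule stableD(4)[OF J])
        have "a = Suc (i + \<rho> i)" using i True plus_\<rho>[of i] by simp
        then have "a + b = i + (b + 1 + \<rho> i)" by simp
        then have "\<delta> (a + b) = \<delta> i + \<delta> (b + 1 + \<rho> i)" by (simp only: \<delta>_add[of i])
        with n show "s + 2 * b + 2 + \<delta> i + \<delta> (b + 1 + \<rho> i) = ?n" by linarith
      qed
      then show ?thesis using p_ge_2 i True by simp
    next
      case False
      show ?thesis by (subst if_not_P[OF False]) (rule gJ(3))
    qed
    ultimately show ?thesis by (intro gJ(4,5))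
  qed
qed

lemma top_degree_\<delta>:
  assumes "s \<le> n"
  shows "top_degree s (n + \<delta> i) = top_degree s n + \<delta> (p * i)"
  using assms
proof (cases rule: excess_cases)
  case (even b)
  have "n + \<delta> i = s + w * (b + \<rho> i)" using even by (simp add: \<delta>_\<rho> algebra_simps)
  moreover have "s + w * (p * (b + \<rho> i)) = s + w * (p * b) + \<delta> (p * i)"
    unfolding \<delta>_mult unfolding \<delta>_\<rho> by (simp add: algebra_simps)
  ultimately show ?thesis using even top_even(2) by metis
next
  case (odd b)
  have "n + \<delta> i = s + 2 * (b + \<rho> i) + 1" using odd by (simp add: \<delta>_\<rho> algebra_simps)
  moreover have "s + w * (p * (b + \<rho> i) + 1) = s + w * (p * b + 1) + \<delta> (p * i)"
    unfolding \<delta>_mult unfolding \<delta>_\<rho> by (simp add: algebra_simps)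
  ultimately show ?thesis using odd top_odd(2)[OF odd(1)] by metis
qed

text \<open>
  The top operation is linear over the powers up to the substitution of \<open>p i\<close> for \<open>i\<close>. Hence preimages of
  \<open>\<P>\<close>-closed families under it are \<open>\<P>\<close>-closed. There is no such relation for the Bockstein.
\<close>

lemma top_\<P>:
  assumes J: "stable J" and u: "unstable_modulo s J" and x: "x \<in> G n" and n: "s \<le> n"
  shows "\<P> (p * i) (top_op s n x) - top_op s (n + \<delta> i) (\<P> i x) \<in> J (top_degree s n + \<delta> (p * i))"
  using n
proof (cases rule: excess_cases)
  case (even b)
  have "n + \<delta> i = s + w * (b + \<rho> i)" using even by (simp add: \<delta>_\<rho> algebra_simps)
  then have "top_op s (n + \<delta> i) (\<P> i x) = \<P> (b + \<rho> i) (\<P> i x)" by (simp add: top_even)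
  then show ?thesis using \<P>_top_even[OF J u, of x b "p * i"] x even p_ge_2 by (simp add: top_even)
next
  case (odd b)
  have "n + \<delta> i = s + 2 * (b + \<rho> i) + 1" using odd by (simp add: \<delta>_\<rho> algebra_simps)
  then have "top_op s (n + \<delta> i) (\<P> i x) = \<beta> (\<P> (b + \<rho> i) (\<P> i x))" by (simp only: top_odd(1)[OF odd(1)])
  moreover have no: "\<not> (0 < p * i \<and> p dvd p * i - 1)"
  proof
    assume "0 < p * i \<and> p dvd p * i - 1"
    then have "p dvd p * i - (p * i - 1)" "0 < p * i" using dvd_diff_nat[of p "p * i" "p * i - 1"] by (blast intro: dvd_triv_left)+
    then show False using p_ge_2 by simp
  qed
  moreover have "(p * i) div p = i" using p_ge_2 by simp
  ultimately show ?thesis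
    using \<P>_top_odd[OF J u odd(1) x[unfolded odd(2)], of "p * i"]
    unfolding odd(2) top_odd[OF odd(1)]
    by (simp only: if_not_P[OF no] dvd_triv_left if_True if_False add_0_right)
qed

text \<open>
  Dividing out the image of the top operation means to pass from \<open>J\<close> to this family. In each degree at most
  one \<open>m\<close> contributes, so that it is a subspace without taking sums.
\<close>

definition adjoin_top :: "nat \<Rightarrow> (nat \<Rightarrow> 'a set) \<Rightarrow> nat \<Rightarrow> 'a set" where
  "adjoin_top s J n = {x \<in> G n. x \<in> J n \<or>
    (\<exists>m y. y \<in> G m \<and> top_degree s m = n \<and> x - top_op s m y \<in> J n)}"

lemma adjoin_top_cases:
  assumes "graded_subspace J"
  shows "adjoin_top s J n = (if n \<in> range (top_degree s)
    then {j + top_op s m y |j m y. j \<in> J n \<and> y \<in> G m \<and> top_degree s m = n} else J n)"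
proof (cases "n \<in> range (top_degree s)")
  case False
  then show ?thesis using graded_subspaceD(2)[OF assms] by (auto simp: adjoin_top_def)
next
  case True
  then obtain m where m: "top_degree s m = n" by auto
  have "x \<in> {j + top_op s m y |j m y. j \<in> J n \<and> y \<in> G m \<and> top_degree s m = n}"
    if "x \<in> adjoin_top s J n" for x
  proof -
    consider "x \<in> J n" | m y where "y \<in> G m" "top_degree s m = n" "x - top_op s m y \<in> J n"
      using \<open>x \<in> adjoin_top s J n\<close> by (auto simp: adjoin_top_def)
    then show ?thesis
    proof cases
      case 1
      then have "x = x + top_op s m 0" by (simp add: top_op.zero)
      with 1 m show ?thesis using zero_in_G by blast
    next
      case (2 m y)
      then have "x = (x - top_op s m y) + top_op s m y" by simp
      with 2 show ?thesis by blast
    qed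
  qed
  moreover have "j + top_op s m y \<in> adjoin_top s J n" if "j \<in> J n" "y \<in> G m" "top_degree s m = n" for j m y
  proof -
    have "j + top_op s m y \<in> G n" using that graded_subspaceD(2)[OF assms] top_in_G[of y m s]
      subspace_add[OF subspace_G, of j n "top_op s m y"] by simp
    moreover have "j + top_op s m y - top_op s m y \<in> J n" using that by simp
    ultimately show ?thesis using that unfolding adjoin_top_def by blast
  qed
  ultimately show ?thesis using True by auto
qed

lemma graded_subspace_adjoin_top:
  assumes J: "graded_subspace J"
  shows "graded_subspace (adjoin_top s J)"
  unfolding graded_subspace_def
proof (intro allI conjI)
  fix n
  note gJ = graded_subspaceD[OF J]
  show "adjoin_top s J n \<subseteq> G n" by (auto simp: adjoin_top_def)
  show "subspace (adjoin_top s J n)"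
  proof (cases "n \<in> range (top_degree s)")
    case False
    then show ?thesis using adjoin_top_cases[OF J] gJ by simp
  next
    case True
    then obtain m where m: "top_degree s m = n" by auto
    have uniq: "m' = m" if "top_degree s m' = n" for m'
      using that m strict_mono_eq[OF top_degree_strict_mono] by metis
    have "adjoin_top s J n = {j + top_op s m y |j m y. j \<in> J n \<and> y \<in> G m \<and> top_degree s m = n}"
      by (subst adjoin_top_cases[OF J]) (use True in simp)
    also have "\<dots> = {j + top_op s m y |j y. j \<in> J n \<and> y \<in> G m}" using m uniq by blast
    finally have "adjoin_top s J n = {j + top_op s m y |j y. j \<in> J n \<and> y \<in> G m}" .
    moreover have "subspace {j + top_op s m y |j y. j \<in> J n \<and> y \<in> G m}"
    proof -
      have "{j + top_op s m y |j y. j \<in> J n \<and> y \<in> G m} =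
        {x + y |x y. x \<in> J n \<and> y \<in> top_op s m ` G m}" by blast
      then show ?thesis
        using subspace_sums[OF gJ(1)[of n] top_op.subspace_image[OF subspace_G[of m]], of s] by simp
    qed
    ultimately show ?thesis by simp
  qed
qed

lemma subset_adjoin_top: "graded_subspace J \<Longrightarrow> x \<in> J n \<Longrightarrow> x \<in> adjoin_top s J n"
  using graded_subspaceD(2) by (auto simp: adjoin_top_def)

lemma adjoin_top_intro:
  assumes "x \<in> G n" "y \<in> G m" "top_degree s m = n" "x - top_op s m y \<in> J n"
  shows "x \<in> adjoin_top s J n"
  using assms unfolding adjoin_top_def by blast

lemma top_in_adjoin_top: "graded_subspace J \<Longrightarrow> y \<in> G m \<Longrightarrow> top_op s m y \<in> adjoin_top s J (top_degree s m)"
  by (rule adjoin_top_intro[OF top_in_G _ refl]) (auto simp: graded_subspaceD(3))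

text \<open>
  The surviving terms of the Adem relations are again top operations, applied to \<open>\<P> i y\<close> and \<open>\<beta> (\<P> i y)\<close>. So
  the image of \<open>top_op s\<close> is a submodule.
\<close>

lemma \<P>_top_in_adjoin_top:
  assumes J: "stable J" and u: "unstable_modulo s J" and y: "y \<in> G n" and n: "s \<le> n"
  shows "\<P> a (top_op s n y) \<in> adjoin_top s J (top_degree s n + \<delta> a)"
  using n
proof (cases rule: excess_cases)
  note gJ = graded_subspaceD[OF stableD(1)[OF J]]
  note gA = graded_subspaceD[OF graded_subspace_adjoin_top[OF stableD(1)[OF J], of s]]
  note sub = subset_adjoin_top[OF stableD(1)[OF J]]
  {
    case (even b)
    let ?R = "if p dvd a then \<P> (b + \<rho> (a div p)) (\<P> (a div p) y) else 0"
    have "\<P> a (\<P> b y) - ?R \<in> adjoin_top s J (s + w * (p * b) + \<delta> a)"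
      using \<P>_top_even[OF J u y[unfolded even]] by (rule sub)
    moreover have "?R \<in> adjoin_top s J (s + w * (p * b) + \<delta> a)"
    proof (cases "p dvd a")
      case True
      then obtain i where i: "a = p * i" by (elim dvdE)
      have eq: "s + w * b + \<delta> i = s + w * (b + \<rho> i)" by (simp add: \<delta>_\<rho> algebra_simps)
      have "top_op s (s + w * b + \<delta> i) (\<P> i y) \<in> adjoin_top s J (top_degree s (s + w * b + \<delta> i))"
        by (rule top_in_adjoin_top[OF stableD(1)[OF J]]) (use \<P>_in_G y even in simp)
      moreover have "s + w * (p * (b + \<rho> i)) = s + w * (p * b) + \<delta> a"
        unfolding i \<delta>_mult unfolding \<delta>_\<rho> by (simp add: algebra_simps)
      ultimately have "\<P> (b + \<rho> i) (\<P> i y) \<in> adjoin_top s J (s + w * (p * b) + \<delta> a)"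
        unfolding eq top_even by simp
      then show ?thesis using i p_ge_2 by simp
    qed (simp add: gA)
    ultimately have "(\<P> a (\<P> b y) - ?R) + ?R \<in> adjoin_top s J (s + w * (p * b) + \<delta> a)" by (rule gA)
    then show ?thesis unfolding even top_even by simp
  next
    case (odd b)
    let ?n = "s + w * (p * b + 1) + \<delta> a"
    let ?R = "if p dvd a then \<beta> (\<P> (b + \<rho> (a div p)) (\<P> (a div p) y)) else 0"
    let ?S = "if 0 < a \<and> p dvd a - 1
      then \<P> (b + 1 + \<rho> ((a - 1) div p)) (\<beta> (\<P> ((a - 1) div p) y)) else 0"
    have 1: "\<P> a (\<beta> (\<P> b y)) - (?R + ?S) \<in> adjoin_top s J ?n"
      using \<P>_top_odd[OF J u odd(1) y[unfolded odd(2)]] by (rule sub)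
    have 2: "?R \<in> adjoin_top s J ?n"
    proof (cases "p dvd a")
      case True
      then obtain i where i: "a = p * i" by (elim dvdE)
      have eq: "s + 2 * b + 1 + \<delta> i = s + 2 * (b + \<rho> i) + 1"
        using odd(1) by (simp add: \<delta>_\<rho> algebra_simps)
      have "top_op s (s + 2 * b + 1 + \<delta> i) (\<P> i y) \<in> adjoin_top s J (top_degree s (s + 2 * b + 1 + \<delta> i))"
        by (rule top_in_adjoin_top[OF stableD(1)[OF J]]) (use \<P>_in_G[of y n i] y odd in simp)
      moreover have "s + w * (p * (b + \<rho> i) + 1) = ?n"
        unfolding i \<delta>_mult unfolding \<delta>_\<rho> by (simp add: algebra_simps)
      ultimately have "\<beta> (\<P> (b + \<rho> i) (\<P> i y)) \<in> adjoin_top s J ?n"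
        unfolding eq top_odd[OF odd(1)] by (simp only:)
      then show ?thesis using i p_ge_2 by simp
    qed (simp add: gA)
    have 3: "?S \<in> adjoin_top s J ?n"
    proof (cases "0 < a \<and> p dvd a - 1")
      case True
      then obtain i where i: "a - 1 = p * i" by (elim conjE dvdE)
      with True have a: "a = p * i + 1" by simp
      have eq: "s + 2 * b + 1 + \<delta> i + 1 = s + w * (b + 1 + \<rho> i)"
        using odd(1) by (simp add: \<delta>_\<rho> algebra_simps)
      have "\<beta> (\<P> i y) \<in> G (s + 2 * b + 1 + \<delta> i + 1)"
        using \<beta>_in_G[OF \<P>_in_G[OF y[unfolded odd(2)]]] by simp
      then have "top_op s (s + w * (b + 1 + \<rho> i)) (\<beta> (\<P> i y))
          \<in> adjoin_top s J (top_degree s (s + w * (b + 1 + \<rho> i)))"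
        unfolding eq by (rule top_in_adjoin_top[OF stableD(1)[OF J]])
      moreover have "s + w * (p * (b + 1 + \<rho> i)) = ?n"
      proof -
        have "\<delta> a = p * \<delta> i + \<delta> 1" unfolding a \<delta>_add \<delta>_mult by simp
        moreover have "w + \<delta> 1 = w * p" using \<delta>_plus[of 1] by simp
        ultimately show ?thesis unfolding \<delta>_\<rho>[of i] by (simp add: algebra_simps)
      qed
      ultimately have "\<P> (b + 1 + \<rho> i) (\<beta> (\<P> i y)) \<in> adjoin_top s J ?n"
        unfolding top_even by (simp only:)
      then show ?thesis using i True p_ge_2 by simp
    next
      case False
      show ?thesis by (subst if_not_P[OF False]) (rule gA(3))
    qed
    have "(\<P> a (\<beta> (\<P> b y)) - (?R + ?S)) + (?R + ?S) \<in> adjoin_top s J ?n"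
      by (rule gA(4)[OF 1 gA(4)[OF 2 3]])
    then show ?thesis unfolding odd(2) top_odd[OF odd(1)] by (simp only: diff_add_cancel)
  }
qed

lemma \<beta>_top_in:
  assumes J: "stable J" and u: "unstable_modulo s J" and y: "y \<in> G n" and n: "s \<le> n"
  shows "\<beta> (top_op s n y) \<in> J (top_degree s n + 1)"
  using n
proof (cases rule: excess_cases)
  case (even b)
  show ?thesis unfolding even top_even
    by (rule unstable_moduloD(2)[OF u y]) (use even \<delta>_plus[of b] in auto)
next
  case (odd b)
  then show ?thesis unfolding odd(2) top_odd[OF odd(1)]
    by (simp add: \<beta>_\<beta> graded_subspaceD(3)[OF stableD(1)[OF J]])
qed

lemma below_in_family:
  assumes "unstable_modulo s J" "n < s" "x \<in> G n"
  shows "x \<in> J n"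
  using unstable_moduloD(1)[OF assms(1,3), of 0 n] assms(2) by (simp add: \<P>_0 \<delta>_0)

lemma stable_adjoin_top:
  assumes J: "stable J" and u: "unstable_modulo s J"
  shows "stable (adjoin_top s J)"
proof -
  note gA = graded_subspaceD[OF graded_subspace_adjoin_top[OF stableD(1)[OF J], of s]]
  note sub = subset_adjoin_top[OF stableD(1)[OF J]]
  have split: "x \<in> J n \<or> (\<exists>m y. s \<le> m \<and> y \<in> G m \<and> top_degree s m = n \<and> x - top_op s m y \<in> J n)"
    if x: "x \<in> adjoin_top s J n" for x n
  proof (rule ccontr)
    assume c: "\<not> ?thesis"
    with x obtain m y where *: "y \<in> G m" "top_degree s m = n" "x - top_op s m y \<in> J n"
      unfolding adjoin_top_def by blast
    with c have "m < s" by force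
    then have "top_op s m y \<in> J n" using * below_in_family[OF u] by (simp add: top_below)
    then have "x - top_op s m y + top_op s m y \<in> J n"
      by (intro graded_subspaceD(4)[OF stableD(1)[OF J]] *)
    with c show False by simp
  qed
  have "\<P> i x \<in> adjoin_top s J (n + \<delta> i)" if x: "x \<in> adjoin_top s J n" for x n i
    using split[OF x]
  proof (elim disjE exE conjE)
    assume "x \<in> J n"
    then show ?thesis by (intro sub stableD(2)[OF J])
  next
    fix m y assume y: "s \<le> m" "y \<in> G m" "top_degree s m = n" "x - top_op s m y \<in> J n"
    have "\<P> i (x - top_op s m y) + \<P> i (top_op s m y) \<in> adjoin_top s J (n + \<delta> i)"
      by (rule gA(4)[OF sub[OF stableD(2)[OF J y(4)]]
            \<P>_top_in_adjoin_top[OF J u y(2,1), unfolded y(3)]])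
    then show ?thesis by (simp add: \<P>.diff)
  qed
  moreover have "\<beta> x \<in> adjoin_top s J (n + 1)" if x: "x \<in> adjoin_top s J n" for x n
    using split[OF x]
  proof (elim disjE exE conjE)
    assume "x \<in> J n"
    then show ?thesis by (intro sub stableD(3)[OF J])
  next
    fix m y assume y: "s \<le> m" "y \<in> G m" "top_degree s m = n" "x - top_op s m y \<in> J n"
    have "\<beta> (x - top_op s m y) + \<beta> (top_op s m y) \<in> adjoin_top s J (n + 1)"
      by (rule gA(4)[OF sub[OF stableD(3)[OF J y(4)]]
            sub[OF \<beta>_top_in[OF J u y(2,1), unfolded y(3)]]])
    then show ?thesis by (simp add: \<beta>.diff)
  qed
  ultimately show ?thesis
    using graded_subspace_adjoin_top[OF stableD(1)[OF J]]
    unfolding stable_def \<P>_closed_def \<beta>_closed_def by blast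
qed

text \<open>
  Dividing out the image of the top operation turns an \<open>s\<close>-fold suspension into an \<open>(s + 1)\<close>-fold one: an
  operation that is newly required to vanish is a top operation.
\<close>

lemma unstable_modulo_adjoin_top:
  assumes J: "stable J" and u: "unstable_modulo s J"
  shows "unstable_modulo (Suc s) (adjoin_top s J)"
proof -
  note sub = subset_adjoin_top[OF stableD(1)[OF J]]
  have "\<P> i x \<in> adjoin_top s J (n + \<delta> i)" if x: "x \<in> G n" "n < w * i + Suc s" for x n i
  proof (cases "n < w * i + s")
    case True
    show ?thesis by (rule sub, rule unstable_moduloD(1)[OF u x(1) True refl])
  next
    case False
    with x have n: "n = s + w * i" by simp
    have "top_op s n x = \<P> i x" "top_degree s n = n + \<delta> i"
      unfolding n top_even using \<delta>_plus[of i] by simp_all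
    then show ?thesis using top_in_adjoin_top[OF stableD(1)[OF J] x(1), of s] by simp
  qed
  moreover have "\<beta> (\<P> i x) \<in> adjoin_top s J (n + \<delta> i + 1)"
    if x: "x \<in> G n" "n < w * i + 1 + Suc s" for x n i
  proof (cases "n < w * i + 1 + s")
    case True
    show ?thesis by (rule sub, rule unstable_moduloD(2)[OF u x(1) True refl])
  next
    case False
    with x have n: "n = s + w * i + 1" by simp
    show ?thesis
    proof (cases rule: w_cases)
      case 1
      then have "p = 2" using p_neq_2(1) by fastforce
      then show ?thesis using p_eq_2(3)
          graded_subspaceD(3)[OF graded_subspace_adjoin_top[OF stableD(1)[OF J]]] by simp
    next
      case 2
      then have n': "n = s + 2 * i + 1" using n by simp
      have "top_op s n x = \<beta> (\<P> i x)" "top_degree s n = n + \<delta> i + 1"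
        unfolding n' top_odd[OF 2] using \<delta>_plus[of i] 2 by simp_all
      then show ?thesis using top_in_adjoin_top[OF stableD(1)[OF J] x(1), of s] by simp
    qed
  qed
  ultimately show ?thesis unfolding unstable_modulo_def by blast
qed

end

section \<open>Finitely generated unstable modules are noetherian\<close>

lemma ascending_chain_in_finite_set:
  fixes U :: "nat \<Rightarrow> 'b set"
  assumes "finite T" and "\<And>i. U i \<subseteq> T" and "mono U"
  shows "\<exists>N. \<forall>i\<ge>N. U i = U N"
proof -
  define ix where "ix e = (LEAST i. e \<in> U i)" for e
  define N where "N = Max (insert 0 (ix ` T))"
  have "U i \<subseteq> U N" for i
  proof
    fix e assume e: "e \<in> U i"
    then have "e \<in> U (ix e)" unfolding ix_def by (rule LeastI)
    moreover have "ix e \<le> N" unfolding N_def by (rule Max_ge) (use e assms in auto)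
    ultimately show "e \<in> U N" using \<open>mono U\<close> by (auto dest: monoD)
  qed
  moreover have "U N \<subseteq> U i" if "N \<le> i" for i using \<open>mono U\<close> that by (rule monoD)
  ultimately show ?thesis by blast
qed

context fp_unstable_module
begin

lemma finite_field: "finite (UNIV :: 'k set)"
  using card_k p_ge_2 by (intro card_ge_0_finite) simp

lemma finite_span: "finite F \<Longrightarrow> finite (span F)"
proof (induction F rule: finite_induct)
  case (insert a F)
  have "span (insert a F) \<subseteq> (\<lambda>(c, x). c *s a + x) ` (UNIV \<times> span F)"
  proof
    fix x assume "x \<in> span (insert a F)"
    then obtain c where "x - c *s a \<in> span F" unfolding span_insert by blast
    then show "x \<in> (\<lambda>(c, x). c *s a + x) ` (UNIV \<times> span F)"
      by (intro image_eqI[of _ _ "(c, x - c *s a)"]) auto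
  qed
  then show ?case by (rule finite_subset) (use finite_field insert.IH in auto)
qed simp

text \<open>
  Submodules over the algebra of powers of the quotient by \<open>J\<close>.
\<close>

definition submodule_above :: "(nat \<Rightarrow> 'a set) \<Rightarrow> (nat \<Rightarrow> 'a set) \<Rightarrow> bool" where
  "submodule_above J U \<longleftrightarrow> graded_subspace U \<and> \<P>_closed U \<and> J \<le> U"

lemma submodule_aboveD:
  assumes "submodule_above J U"
  shows "graded_subspace U" "x \<in> U n \<Longrightarrow> \<P> i x \<in> U (n + \<delta> i)" "x \<in> J n \<Longrightarrow> x \<in> U n"
  using assms unfolding submodule_above_def \<P>_closed_def le_fun_def by blast+

primrec iterated_top :: "nat \<Rightarrow> nat \<Rightarrow> nat \<Rightarrow> 'a \<Rightarrow> 'a" where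
  "iterated_top s 0 n x = x"
| "iterated_top s (Suc k) n x = top_op s ((top_degree s ^^ k) n) (iterated_top s k n x)"

lemma iterated_top_Suc: "iterated_top s (Suc k) n x = iterated_top s k (top_degree s n) (top_op s n x)"
  by (induction k) (simp_all add: funpow_swap1[symmetric])

lemma iterated_top_add: "iterated_top s k n (x + y) = iterated_top s k n x + iterated_top s k n y"
  by (induction k) (simp_all add: top_op.add)

lemma iterated_top_diff: "iterated_top s k n (x - y) = iterated_top s k n x - iterated_top s k n y"
  by (induction k) (simp_all add: top_op.diff)

lemma iterated_top_scale: "iterated_top s k n (c *s x) = c *s iterated_top s k n x"
  by (induction k) (simp_all add: top_op.scale)

lemma iterated_top_zero: "iterated_top s k n 0 = 0"
  by (induction k) (simp_all add: top_op.zero)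

lemma iterated_top_in_stable:
  assumes "stable J" "x \<in> J n"
  shows "iterated_top s k n x \<in> J ((top_degree s ^^ k) n)"
  using assms by (induction k) (auto intro: top_in_stable)

lemma iterated_top_degree_below: "n \<le> s \<Longrightarrow> (top_degree s ^^ k) n = n"
  by (induction k) (simp_all add: top_below)

lemma iterated_top_below: "n \<le> s \<Longrightarrow> iterated_top s k n x = x"
  by (induction k) (simp_all add: top_below iterated_top_degree_below)

lemma le_iterated_top_degree: "s \<le> n \<Longrightarrow> s \<le> (top_degree s ^^ k) n"
proof (induction k)
  case (Suc k)
  then show ?case using less_top_degree[of s "(top_degree s ^^ k) n"] top_below(2)[of _ s]
    by (cases "(top_degree s ^^ k) n = s") auto
qed simp

lemma less_iterated_top_degree: "s < n \<Longrightarrow> n + k \<le> (top_degree s ^^ k) n"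
proof (induction k)
  case (Suc k)
  then show ?case using less_top_degree[of s "(top_degree s ^^ k) n"] by simp
qed simp

lemma iterated_top_\<P>:
  assumes J: "stable J" and u: "unstable_modulo s J" and x: "x \<in> G n" and n: "s \<le> n"
  shows "(top_degree s ^^ k) (n + \<delta> i) = (top_degree s ^^ k) n + \<delta> (p ^ k * i) \<and>
    \<P> (p ^ k * i) (iterated_top s k n x) - iterated_top s k (n + \<delta> i) (\<P> i x)
      \<in> J ((top_degree s ^^ k) n + \<delta> (p ^ k * i))"
proof (induction k)
  case 0
  then show ?case by (simp add: graded_subspaceD(3)[OF stableD(1)[OF J]])
next
  case (Suc k)
  let ?m = "(top_degree s ^^ k) n" and ?i = "p ^ k * i"
  let ?y = "iterated_top s k n x" and ?z = "iterated_top s k (n + \<delta> i) (\<P> i x)"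
  have m: "s \<le> ?m" using n by (rule le_iterated_top_degree)
  have y: "?y \<in> G ?m" using iterated_top_in_stable[OF stable_G x] .
  have pk: "p ^ Suc k * i = p * ?i" by (simp add: mult_ac)
  have deg: "top_degree s (?m + \<delta> ?i) = top_degree s ?m + \<delta> (p * ?i)"
    by (rule top_degree_\<delta>[OF m])
  have "\<P> (p * ?i) (top_op s ?m ?y) - top_op s (?m + \<delta> ?i) (\<P> ?i ?y) \<in> J (top_degree s ?m + \<delta> (p * ?i))"
    by (rule top_\<P>[OF J u y m])
  moreover have "top_op s (?m + \<delta> ?i) (\<P> ?i ?y - ?z) \<in> J (top_degree s ?m + \<delta> (p * ?i))"
    unfolding deg[symmetric] by (rule top_in_stable[OF J]) (use Suc in simp)
  ultimately have "(\<P> (p * ?i) (top_op s ?m ?y) - top_op s (?m + \<delta> ?i) (\<P> ?i ?y)) +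
      top_op s (?m + \<delta> ?i) (\<P> ?i ?y - ?z) \<in> J (top_degree s ?m + \<delta> (p * ?i))"
    by (rule graded_subspaceD(4)[OF stableD(1)[OF J]])
  then show ?case using Suc deg unfolding pk by (simp add: top_op.diff)
qed

text \<open>
  The elements whose class modulo \<open>adjoin_top s J\<close> has a representative sent into \<open>U\<close> by the \<open>k\<close>-fold top
  operation. They play the role of the leading coefficients of degree \<open>k\<close> in Hilbert's basis theorem, with
  the top operation as the variable.
\<close>

definition top_roots :: "nat \<Rightarrow> (nat \<Rightarrow> 'a set) \<Rightarrow> nat \<Rightarrow> (nat \<Rightarrow> 'a set) \<Rightarrow> nat \<Rightarrow> 'a set" where
  "top_roots s J k U n = {x \<in> G n. \<exists>y\<in>G n.
    iterated_top s k n y \<in> U ((top_degree s ^^ k) n) \<and> x - y \<in> adjoin_top s J n}"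

lemma submodule_above_top_roots:
  assumes J: "stable J" and u: "unstable_modulo s J" and U: "submodule_above J U"
  shows "submodule_above (adjoin_top s J) (top_roots s J k U)"
proof -
  note gU = graded_subspaceD[OF submodule_aboveD(1)[OF U]]
  note sA = stable_adjoin_top[OF J u]
  note gA = graded_subspaceD[OF stableD(1)[OF sA]]
  note gG = graded_subspaceD[OF graded_subspace_G]
  have above: "x \<in> top_roots s J k U n" if "x \<in> adjoin_top s J n" for x n
    unfolding top_roots_def using that gA(2)[OF that]
    by (auto intro!: bexI[of _ 0] simp: iterated_top_zero gU)
  have "subspace (top_roots s J k U n)" for n
    unfolding subspace_def
  proof (intro conjI ballI allI)
    show "0 \<in> top_roots s J k U n" by (rule above) (rule gA)
    fix x x' assume "x \<in> top_roots s J k U n" "x' \<in> top_roots s J k U n"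
    then obtain y y' where *: "x \<in> G n" "x' \<in> G n" "y \<in> G n" "y' \<in> G n"
      "iterated_top s k n y \<in> U ((top_degree s ^^ k) n)" "iterated_top s k n y' \<in> U ((top_degree s ^^ k) n)"
      "x - y \<in> adjoin_top s J n" "x' - y' \<in> adjoin_top s J n"
      unfolding top_roots_def by blast
    have "x + x' - (y + y') = (x - y) + (x' - y')" by simp
    then have "x + x' - (y + y') \<in> adjoin_top s J n" using gA(4)[OF *(7,8)] by (simp only:)
    then show "x + x' \<in> top_roots s J k U n"
      unfolding top_roots_def using gG(4)[OF *(1,2)] gG(4)[OF *(3,4)] gU(4)[OF *(5,6)]
      by (auto simp: iterated_top_add intro!: bexI[of _ "y + y'"])
  next
    fix c x assume "x \<in> top_roots s J k U n"
    then obtain y where *: "x \<in> G n" "y \<in> G n"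
      "iterated_top s k n y \<in> U ((top_degree s ^^ k) n)" "x - y \<in> adjoin_top s J n"
      unfolding top_roots_def by blast
    have "c *s x - c *s y \<in> adjoin_top s J n" using gA(6)[OF *(4)] by (simp add: scale_right_diff_distrib)
    then show "c *s x \<in> top_roots s J k U n"
      unfolding top_roots_def using gG(6)[OF *(1)] gG(6)[OF *(2)] gU(6)[OF *(3)]
      by (auto simp: iterated_top_scale intro!: bexI[of _ "c *s y"])
  qed
  moreover have "top_roots s J k U n \<subseteq> G n" for n unfolding top_roots_def by blast
  moreover have "\<P> i x \<in> top_roots s J k U (n + \<delta> i)" if x: "x \<in> top_roots s J k U n" for x n i
  proof (cases "n < s")
    case True
    have "x \<in> G n" using x unfolding top_roots_def by blast
    then have "x \<in> adjoin_top s J n"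
      using below_in_family[OF u True] subset_adjoin_top[OF stableD(1)[OF J]] by blast
    then show ?thesis by (intro above stableD(2)[OF sA])
  next
    case False
    then have sn: "s \<le> n" by simp
    from x obtain y where *: "x \<in> G n" "y \<in> G n"
      "iterated_top s k n y \<in> U ((top_degree s ^^ k) n)" "x - y \<in> adjoin_top s J n"
      unfolding top_roots_def by blast
    note c = iterated_top_\<P>[OF J u *(2) sn, of k i]
    have "\<P> (p ^ k * i) (iterated_top s k n y) \<in> U ((top_degree s ^^ k) n + \<delta> (p ^ k * i))"
      using submodule_aboveD(2)[OF U *(3)] .
    then have "\<P> (p ^ k * i) (iterated_top s k n y) -
      (\<P> (p ^ k * i) (iterated_top s k n y) - iterated_top s k (n + \<delta> i) (\<P> i y))
        \<in> U ((top_degree s ^^ k) n + \<delta> (p ^ k * i))"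
      by (rule gU(5)) (use c submodule_aboveD(3)[OF U] in blast)
    then have "iterated_top s k (n + \<delta> i) (\<P> i y) \<in> U ((top_degree s ^^ k) (n + \<delta> i))"
      using c by simp
    moreover have "\<P> i x - \<P> i y \<in> adjoin_top s J (n + \<delta> i)"
      using stableD(2)[OF sA *(4), of i] by (simp add: \<P>.diff)
    ultimately show ?thesis
      unfolding top_roots_def using \<P>_in_G[OF *(1)] \<P>_in_G[OF *(2)] by blast
  qed
  ultimately show ?thesis
    unfolding submodule_above_def graded_subspace_def \<P>_closed_def le_fun_def using above by blast
qed

lemma top_roots_mono: "U \<le> U' \<Longrightarrow> top_roots s J k U \<le> top_roots s J k U'"
  unfolding top_roots_def le_fun_def by blast

text \<open>
  After one application of the top operation the excess is a multiple of \<open>w\<close>, and from then on the top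
  operation is a power and involves no Bockstein.
\<close>

lemma top_after_top:
  assumes "s \<le> n"
  shows "top_op s ((top_degree s ^^ Suc k) n) x
    = \<P> (((top_degree s ^^ Suc k) n - s) div w) x" 
    "top_degree s ((top_degree s ^^ Suc k) n)
    = (top_degree s ^^ Suc k) n + \<delta> (((top_degree s ^^ Suc k) n - s) div w)"
proof -
  have "w dvd (top_degree s ^^ Suc k) n - s"
    using le_iterated_top_degree[OF assms, of k]
  proof (cases rule: excess_cases)
    case (even b)
    then show ?thesis using top_even(2)[of s b] by simp
  next
    case (odd b)
    then show ?thesis using top_odd(2)[OF odd(1), of s b] by simp
  qed
  then show "top_op s ((top_degree s ^^ Suc k) n) x
    = \<P> (((top_degree s ^^ Suc k) n - s) div w) x" 
    "top_degree s ((top_degree s ^^ Suc k) n)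
    = (top_degree s ^^ Suc k) n + \<delta> (((top_degree s ^^ Suc k) n - s) div w)"
    by (simp_all only: top_op_def top_degree_eq if_True)
qed

text \<open>
  The inclusion may fail from \<open>0\<close> to \<open>1\<close>, because \<open>U\<close> need not be closed under the Bockstein that the first
  top operation may involve.
\<close>

lemma top_roots_Suc_mono:
  assumes U: "submodule_above J U"
  shows "top_roots s J (Suc k) U \<le> top_roots s J (Suc (Suc k)) U"
proof -
  have "iterated_top s (Suc (Suc k)) n y \<in> U ((top_degree s ^^ Suc (Suc k)) n)"
    if y: "iterated_top s (Suc k) n y \<in> U ((top_degree s ^^ Suc k) n)" for n y
  proof (cases "s \<le> n")
    case True
    have "(top_degree s ^^ Suc (Suc k)) n = top_degree s ((top_degree s ^^ Suc k) n)"
      "iterated_top s (Suc (Suc k)) n y = top_op s ((top_degree s ^^ Suc k) n) (iterated_top s (Suc k) n y)"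
      by simp_all
    then show ?thesis unfolding top_after_top[OF True]
      using submodule_aboveD(2)[OF U y] by (simp only:)
  next
    case False
    then show ?thesis using y by (simp only: iterated_top_below iterated_top_degree_below not_le less_imp_le)
  qed
  then show ?thesis unfolding top_roots_def le_fun_def by blast
qed

text \<open>
  If \<open>U\<close> and \<open>V\<close> have the same roots, an element of \<open>V\<close> is modulo \<open>U\<close> a \<open>k\<close>-fold top operation for every \<open>k\<close>: the
  argument \<open>y\<close> is a \<open>k\<close>-th root for \<open>V\<close>, hence for \<open>U\<close>, and so differs by an element of \<open>J\<close> and a top operation from
  one that is sent into \<open>U\<close>. The degree of the argument decreases, which is impossible for \<open>k\<close> large, provided that the degree \<open>n\<close> exceeds \<open>s\<close>, where
  the top operation is not the identity.
\<close>

lemma top_roots_descent: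
  assumes J: "stable J" and u: "unstable_modulo s J"
    and U: "submodule_above J U" and V: "submodule_above J V" and "U \<le> V"
    and eq: "\<And>k. top_roots s J k V \<le> top_roots s J k U" and n: "s < n" and x: "x \<in> V n"
  shows "x \<in> U n"
proof -
  note gU = graded_subspaceD[OF submodule_aboveD(1)[OF U]]
  note gV = graded_subspaceD[OF submodule_aboveD(1)[OF V]]
  have "\<exists>m y. y \<in> G m \<and> (top_degree s ^^ k) m = n \<and> x - iterated_top s k m y \<in> U n" if "x \<notin> U n" for k
  proof (induction k)
    case 0
    show ?case using gV(2)[OF x] gU(3) by (intro exI[of _ n] exI[of _ x]) simp
  next
    case (Suc k)
    then obtain m y where y: "y \<in> G m" and m: "(top_degree s ^^ k) m = n"
      and a: "x - iterated_top s k m y \<in> U n" by blast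
    have "x - (x - iterated_top s k m y) \<in> V n"
      by (rule gV(5)[OF x]) (use a \<open>U \<le> V\<close> in \<open>auto simp: le_fun_def\<close>)
    then have "y \<in> top_roots s J k V m"
      using y m graded_subspaceD(3)[OF graded_subspace_adjoin_top[OF stableD(1)[OF J]]]
      unfolding top_roots_def by auto
    then have "y \<in> top_roots s J k U m" using eq[of k] by (auto simp: le_fun_def)
    then obtain y' where y': "y' \<in> G m" "iterated_top s k m y' \<in> U n" "y - y' \<in> adjoin_top s J m"
      unfolding top_roots_def m by blast
    have *: "x - iterated_top s k m (y - y') \<in> U n"
      using gU(4)[OF a y'(2)] by (simp add: iterated_top_diff algebra_simps)
    from y'(3) consider "y - y' \<in> J m"
      | m' z where "z \<in> G m'" "top_degree s m' = m" "y - y' - top_op s m' z \<in> J m"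
      unfolding adjoin_top_def by blast
    then show ?case
    proof cases
      case 1
      then have "iterated_top s k m (y - y') \<in> U n"
        using iterated_top_in_stable[OF J, of _ m s k] m submodule_aboveD(3)[OF U] by auto
      then have "x \<in> U n" using gU(4)[OF *] by force
      with that show ?thesis by simp
    next
      case 2
      then have "iterated_top s k m (y - y' - top_op s m' z) \<in> U n"
        using iterated_top_in_stable[OF J 2(3), of s k] m submodule_aboveD(3)[OF U] by auto
      then have "x - iterated_top s k m (top_op s m' z) \<in> U n"
        using gU(4)[OF *] by (force simp: iterated_top_diff)
      moreover have "x - iterated_top s (Suc k) m' z \<in> U n"
        unfolding iterated_top_Suc 2(2) by fact
      moreover have "(top_degree s ^^ Suc k) m' = n" using 2(2) m by (simp add: funpow_swap1)
      ultimately show ?thesis using 2(1) by blast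
    qed
  qed
  moreover have False if "(top_degree s ^^ n) m = n" for m
  proof (cases "m \<le> s")
    case True
    then show False using that n iterated_top_degree_below by simp
  next
    case False
    then show False using less_iterated_top_degree[of s m n] that n by simp
  qed
  ultimately show ?thesis by blast
qed

text \<open>
  The roots form a double chain above \<open>adjoin_top s J\<close>, so they stop growing, uniformly in \<open>k\<close>; the row \<open>k = 0\<close>
  is treated on its own since the rows increase only from \<open>k = 1\<close> on. Degree \<open>s\<close>, where the top operation gives no
  information, is finite modulo \<open>J\<close>.
\<close>

lemma acc_of_acc_adjoin_top:
  assumes J: "stable J" and u: "unstable_modulo s J"
    and acc: "ascending_chain_condition (submodule_above (adjoin_top s J))"
    and F: "finite F" "F \<subseteq> G s" and G_s: "\<And>x. x \<in> G s \<Longrightarrow> \<exists>j\<in>J s. x - j \<in> span F"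
  shows "ascending_chain_condition (submodule_above J)"
  unfolding ascending_chain_condition_def
proof (intro allI impI, elim conjE)
  fix U :: "nat \<Rightarrow> nat \<Rightarrow> 'a set"
  assume U: "\<forall>i. submodule_above J (U i)" and "mono U"
  have mono: "U i \<le> U j" if "i \<le> j" for i j using \<open>mono U\<close> that by (rule monoD)
  have roots: "submodule_above (adjoin_top s J) (top_roots s J k (U i))" for k i
    using submodule_above_top_roots[OF J u] U by blast
  have "mono (\<lambda>i. top_roots s J 0 (U i))"
    by (rule monoI) (rule top_roots_mono[OF mono])
  from ascending_chain_conditionD[OF acc roots this]
  obtain N0 where N0: "\<And>i. N0 \<le> i \<Longrightarrow> top_roots s J 0 (U i) = top_roots s J 0 (U N0)" by blast
  obtain N1 where N1: "\<And>k i. N1 \<le> i \<Longrightarrow> top_roots s J (Suc k) (U i) = top_roots s J (Suc k) (U N1)"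
  proof (rule double_chain_stabilizes[OF acc, of "\<lambda>k i. top_roots s J (Suc k) (U i)"])
    show "top_roots s J (Suc k) (U i) \<le> top_roots s J (Suc (Suc k)) (U i)" for k i
      using top_roots_Suc_mono U by blast
    show "top_roots s J (Suc k) (U i) \<le> top_roots s J (Suc k) (U (Suc i))" for k i
      by (rule top_roots_mono[OF mono]) simp
  qed (use roots in blast)+
  have "\<exists>N. \<forall>i\<ge>N. U i s \<inter> span F = U N s \<inter> span F"
  proof (rule ascending_chain_in_finite_set[OF finite_span[OF F(1)]])
    show "mono (\<lambda>i. U i s \<inter> span F)"
      by (rule monoI) (use mono in \<open>auto simp: le_fun_def\<close>)
  qed simp
  then obtain N2 where N2: "\<And>i. N2 \<le> i \<Longrightarrow> U i s \<inter> span F = U N2 s \<inter> span F" by blast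
  define N where "N = max N0 (max N1 N2)"
  then have N: "N0 \<le> N" "N1 \<le> N" "N2 \<le> N" by simp_all
  have "U i \<le> U N" if i: "N \<le> i" for i
    unfolding le_fun_def
  proof (intro allI subsetI)
    fix n x assume x: "x \<in> U i n"
    note UN = U[rule_format, of N] and Ui = U[rule_format, of i]
    note gN = graded_subspaceD[OF submodule_aboveD(1)[OF UN]]
    note gi = graded_subspaceD[OF submodule_aboveD(1)[OF Ui]]
    consider "n < s" | "n = s" | "s < n" by linarith
    then show "x \<in> U N n"
    proof cases
      case 1
      then show ?thesis using below_in_family[OF u 1 gi(2)[OF x]] submodule_aboveD(3)[OF UN] by blast
    next
      case 2
      obtain j where j: "j \<in> J s" "x - j \<in> span F" using G_s gi(2)[OF x] 2 by blast
      then have "x - j \<in> U i s \<inter> span F" using gi(5)[OF x] submodule_aboveD(3)[OF Ui] 2 by blast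
      then have "x - j \<in> U N s" using N2[of i] N2[of N] i N by auto
      then have "x - j + j \<in> U N s" using gN(4) submodule_aboveD(3)[OF UN j(1)] by blast
      then show ?thesis using 2 by simp
    next
      case 3
      show ?thesis
      proof (rule top_roots_descent[OF J u UN Ui mono[OF i] _ 3 x])
        show "top_roots s J k (U i) \<le> top_roots s J k (U N)" for k
          using N0[of i] N0[of N] N1[of i] N1[of N] i N by (cases k) auto
      qed
    qed
  qed
  then show "\<exists>N. \<forall>i\<ge>N. U i = U N" using mono by (intro exI[of _ N]) (auto intro: antisym)
qed

text \<open>
  Induction on \<open>r\<close>, which bounds the degrees of the generators after \<open>s\<close> desuspensions. Passing from \<open>J\<close> to
  \<open>adjoin_top s J\<close> kills degree \<open>s\<close> altogether, as the top operation is the identity there, and when no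
  generators are left, \<open>J\<close> is everything.
\<close>

theorem acc_submodules_of_finitely_generated:
  assumes "stable J" and "unstable_modulo s J"
    and "\<And>n. finite (F n)" and "\<And>n. F n \<subseteq> G n" and "\<And>n. s + r \<le> n \<Longrightarrow> F n = {}"
    and "\<And>K. stable K \<Longrightarrow> J \<le> K \<Longrightarrow> F \<le> K \<Longrightarrow> K = G"
  shows "ascending_chain_condition (submodule_above J)"
  using assms
proof (induction r arbitrary: s J)
  case 0
  have "F n \<subseteq> J n" for n
  proof (cases "n < s")
    case True
    then show ?thesis using below_in_family[OF "0.prems"(2)] "0.prems"(4) by blast
  next
    case False
    then show ?thesis using "0.prems"(5)[of n] by simp
  qed
  then have "J = G" using "0.prems"(1,6) by (simp add: le_fun_def)
  have "U = G" if "submodule_above J U" for U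
  proof (rule antisym)
    show "U \<le> G" using that unfolding submodule_above_def graded_subspace_def by (simp add: le_fun_def)
    show "G \<le> U" using that unfolding submodule_above_def \<open>J = G\<close> by simp
  qed
  then show ?case unfolding ascending_chain_condition_def by metis
next
  case (Suc r)
  note J = Suc.prems(1) and u = Suc.prems(2) and fin = Suc.prems(3) and FG = Suc.prems(4)
    and Fe = Suc.prems(5) and gen = Suc.prems(6)
  have acc: "ascending_chain_condition (submodule_above (adjoin_top s J))"
  proof (rule Suc.IH[OF stable_adjoin_top[OF J u] unstable_modulo_adjoin_top[OF J u] fin FG])
    show "F n = {}" if "Suc s + r \<le> n" for n using Fe that by simp
    show "K = G" if "stable K" "adjoin_top s J \<le> K" "F \<le> K" for K
    proof (rule gen[OF that(1) _ that(3)])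
      have "J \<le> adjoin_top s J"
        unfolding le_fun_def using subset_adjoin_top[OF stableD(1)[OF J]] by blast
      then show "J \<le> K" using that(2) by (rule order_trans)
    qed
  qed
  \<comment> \<open>This family is closed under the operations and contains the generators, so it is everything.\<close>
  define K where "K n = (if n = s then {j + v |j v. j \<in> J s \<and> v \<in> span (F s)} else G n)" for n
  have K_s: "j + v \<in> K s" if "j \<in> J s" "v \<in> span (F s)" for j v
    unfolding K_def using that by auto
  have Ks: "subspace (K s)"
    unfolding K_def using subspace_sums[OF graded_subspaceD(1)[OF stableD(1)[OF J]] subspace_span] by simp
  have JK: "J \<le> K"
  proof (unfold le_fun_def, intro allI subsetI)
    fix n x assume x: "x \<in> J n"
    show "x \<in> K n"
    proof (cases "n = s")
      case True
      then show ?thesis using K_s[of x 0] x span_zero by simp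
    next
      case False
      then show ?thesis unfolding K_def using graded_subspaceD(2)[OF stableD(1)[OF J] x] by simp
    qed
  qed
  have KG: "K n \<subseteq> G n" for n
  proof (cases "n = s")
    case True
    have "span (F s) \<subseteq> G s" by (rule span_minimal[OF FG subspace_G])
    then show ?thesis
      unfolding K_def using True graded_subspaceD(2)[OF stableD(1)[OF J]] subspace_add[OF subspace_G] by auto
  qed (simp add: K_def)
  have "stable K"
    unfolding stable_def \<P>_closed_def \<beta>_closed_def graded_subspace_def
  proof (intro conjI allI ballI)
    show "subspace (K n)" for n using Ks subspace_G by (cases "n = s") (simp_all add: K_def)
    show "K n \<subseteq> G n" for n by (rule KG)
    show "\<P> i x \<in> K (n + \<delta> i)" if x: "x \<in> K n" for n i x
    proof -
      have xG: "x \<in> G n" using KG x by blast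
      consider "i = 0" | "n < s" | "s \<le> n" "0 < i" by linarith
      then show ?thesis
      proof cases
        case 1
        then show ?thesis using x by (simp add: \<P>_0 \<delta>_0)
      next
        case 2
        then show ?thesis
          using stableD(2)[OF J below_in_family[OF u 2 xG], of i] JK by (auto simp: le_fun_def)
      next
        case 3
        then have "n + \<delta> i \<noteq> s" using \<delta>_pos[of i] by linarith
        then show ?thesis using \<P>_in_G[OF xG] by (simp add: K_def)
      qed
    qed
    show "\<beta> x \<in> K (n + 1)" if x: "x \<in> K n" for n x
    proof -
      have xG: "x \<in> G n" using KG x by blast
      show ?thesis
      proof (cases "n < s")
        case True
        then show ?thesis
          using stableD(3)[OF J below_in_family[OF u True xG]] JK by (auto simp: le_fun_def)
      next
        case False
        then show ?thesis using \<beta>_in_G[OF xG] by (simp add: K_def)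
      qed
    qed
  qed
  moreover have "F \<le> K"
  proof (unfold le_fun_def, intro allI subsetI)
    fix n x assume x: "x \<in> F n"
    show "x \<in> K n"
    proof (cases "n = s")
      case True
      then show ?thesis
        using K_s[of 0 x] x graded_subspaceD(3)[OF stableD(1)[OF J]] by (simp add: span_base)
    next
      case False
      then show ?thesis unfolding K_def using FG x by auto
    qed
  qed
  ultimately have "K = G" using gen[OF _ JK] by simp
  then have "K s = G s" by simp
  then have "\<exists>j\<in>J s. x - j \<in> span (F s)" if x: "x \<in> G s" for x
  proof -
    from x have "x \<in> K s" unfolding \<open>K s = G s\<close> .
    then obtain j v where "x = j + v" "j \<in> J s" "v \<in> span (F s)" unfolding K_def by auto
    then show ?thesis by (intro bexI[of _ j]) simp_all
  qed
  from acc_of_acc_adjoin_top[OF J u acc fin FG this] show ?case .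
qed

end

section \<open>Homogeneous tensors\<close>

lemma tensor_zero_left [simp]: "0 \<otimes>\<^sub>t y = 0"
  using tensor_add_left[of 0 0 y] by simp

lemma tensor_zero_right [simp]: "x \<otimes>\<^sub>t 0 = 0"
  using tensor_add_right[of x 0 0] by simp

lemma
  shows hull_zero: "0 \<in> additive_subgroup hull S"
    and hull_diff: "s \<in> additive_subgroup hull S \<Longrightarrow> t \<in> additive_subgroup hull S \<Longrightarrow>
      s - t \<in> additive_subgroup hull S"
    and hull_add: "s \<in> additive_subgroup hull S \<Longrightarrow> t \<in> additive_subgroup hull S \<Longrightarrow>
      s + t \<in> additive_subgroup hull S"
proof -
  have "additive_subgroup (additive_subgroup hull S)"
    by (rule hull_in) (auto simp: additive_subgroup_def)
  then show z: "0 \<in> additive_subgroup hull S"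
    and d: "\<And>s t. s \<in> additive_subgroup hull S \<Longrightarrow> t \<in> additive_subgroup hull S \<Longrightarrow>
      s - t \<in> additive_subgroup hull S"
    unfolding additive_subgroup_def by blast+
  show "s \<in> additive_subgroup hull S \<Longrightarrow> t \<in> additive_subgroup hull S \<Longrightarrow>
      s + t \<in> additive_subgroup hull S"
    using d[of s "0 - t"] d[OF z, of t] by simp
qed

lemma hull_sum: "(\<And>i. i \<in> I \<Longrightarrow> f i \<in> additive_subgroup hull S) \<Longrightarrow> sum f I \<in> additive_subgroup hull S"
  by (induction I rule: infinite_finite_induct) (auto intro: hull_zero hull_add)

lemma additive_subgroup_hull_induct [consumes 1, case_names base zero diff]:
  assumes "t \<in> additive_subgroup hull S"
    and "\<And>x. x \<in> S \<Longrightarrow> Q x" and "Q 0" and "\<And>s t. Q s \<Longrightarrow> Q t \<Longrightarrow> Q (s - t)"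
  shows "Q t"
  using assms(1,2) by (rule hull_induct) (use assms(3,4) in \<open>auto simp: additive_subgroup_def\<close>)

lemma additive_on_hull:
  assumes "additive f" and "t \<in> additive_subgroup hull S" and "\<And>x. x \<in> S \<Longrightarrow> f x \<in> additive_subgroup hull T"
  shows "f t \<in> additive_subgroup hull T"
  using assms(2)
  by (induction rule: additive_subgroup_hull_induct)
    (auto simp: assms(3) additive.zero[OF assms(1)] additive.diff[OF assms(1)] hull_zero hull_diff)

definition htensor :: "(nat \<Rightarrow> 'a::ab_group_add set) \<Rightarrow> (nat \<Rightarrow> 'b::ab_group_add set) \<Rightarrow> nat \<Rightarrow> ('a, 'b) tensor set"
  where "htensor X Y n = additive_subgroup hull {u \<otimes>\<^sub>t v |u v. \<exists>i j. i + j = n \<and> u \<in> X i \<and> v \<in> Y j}"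

lemma htensor_zero: "0 \<in> htensor X Y n"
  and htensor_diff: "s \<in> htensor X Y n \<Longrightarrow> t \<in> htensor X Y n \<Longrightarrow> s - t \<in> htensor X Y n"
  and htensor_add: "s \<in> htensor X Y n \<Longrightarrow> t \<in> htensor X Y n \<Longrightarrow> s + t \<in> htensor X Y n"
  and htensor_sum: "(\<And>i. i \<in> I \<Longrightarrow> f i \<in> htensor X Y n) \<Longrightarrow> sum f I \<in> htensor X Y n"
  unfolding htensor_def by (simp_all add: hull_zero hull_diff hull_add hull_sum)

lemma htensor_base: "u \<in> X i \<Longrightarrow> v \<in> Y j \<Longrightarrow> i + j = n \<Longrightarrow> u \<otimes>\<^sub>t v \<in> htensor X Y n"
  unfolding htensor_def by (rule hull_inc) blast

lemma htensor_induct [consumes 1, case_names tensor zero diff]: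
  assumes "t \<in> htensor X Y n"
    and "\<And>u v i j. i + j = n \<Longrightarrow> u \<in> X i \<Longrightarrow> v \<in> Y j \<Longrightarrow> Q (u \<otimes>\<^sub>t v)"
    and "Q 0" and "\<And>s t. Q s \<Longrightarrow> Q t \<Longrightarrow> Q (s - t)"
  shows "Q t"
  using assms(1) unfolding htensor_def
  by (induction rule: additive_subgroup_hull_induct) (use assms(2-4) in auto)

lemma htensor_image:
  assumes "additive f" and "t \<in> htensor X Y n"
    and "\<And>u v i j. i + j = n \<Longrightarrow> u \<in> X i \<Longrightarrow> v \<in> Y j \<Longrightarrow> f (u \<otimes>\<^sub>t v) \<in> htensor X' Y' n'"
  shows "f t \<in> htensor X' Y' n'"
  using assms(2)
  by (induction rule: htensor_induct)
    (auto simp: assms(3) additive.zero[OF assms(1)] additive.diff[OF assms(1)] htensor_zero htensor_diff)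

lemma htensor_mono:
  assumes "t \<in> htensor X Y n" "X \<le> X'" "Y \<le> Y'"
  shows "t \<in> htensor X' Y' n"
  using htensor_image[OF _ assms(1), of "\<lambda>t. t" X' Y' n] assms(2,3)
  by (auto simp: additive_def le_fun_def intro!: htensor_base)

lemma biadditiveI:
  assumes "\<And>x x' y. h (x + x') y = h x y + h x' y" and "\<And>x y y'. h x (y + y') = h x y + h x y'"
  shows "biadditive h"
  using assms unfolding biadditive_def additive_def by blast

lemma tensor_lift_plus:
  assumes "biadditive h" "biadditive h1" "biadditive h2" and "\<And>x y. h x y = h1 x y + h2 x y"
  shows "tensor_lift h t = tensor_lift h1 t + tensor_lift h2 t"
proof (rule tensor_lift_unique_aux[OF additive_tensor_lift[OF assms(1)]])
  show "additive (\<lambda>t. tensor_lift h1 t + tensor_lift h2 t)"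
    using additive.add[OF additive_tensor_lift[OF assms(2)]] additive.add[OF additive_tensor_lift[OF assms(3)]]
    by (simp add: additive_def)
qed (simp add: tensor_lift assms)

lemma additive_sum: "(\<And>i. i \<in> I \<Longrightarrow> additive (f i)) \<Longrightarrow> additive (\<lambda>x. \<Sum>i\<in>I. f i x)"
  unfolding additive_def by (auto simp: sum.distrib cong: sum.cong)

context graded_vector_space
begin

lemma additive_component_sum:
  assumes h: "\<And>n. additive (h n)"
  shows "additive (\<lambda>x. \<Sum>n | component G x n \<noteq> 0. h n (component G x n))"
proof
  fix x y
  let ?I = "{n. component G x n \<noteq> 0} \<union> {n. component G y n \<noteq> 0}"
  have *: "(\<Sum>n | component G z n \<noteq> 0. h n (component G z n)) = (\<Sum>n\<in>?I. h n (component G z n))"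
    if "{n. component G z n \<noteq> 0} \<subseteq> ?I" for z
    by (rule sum.mono_neutral_left) (use that in \<open>auto simp: finite_component additive.zero[OF h]\<close>)
  have "{n. component G (x + y) n \<noteq> 0} \<subseteq> ?I" by (auto simp: component_add)
  from *[OF this] *[of x] *[of y]
  show "(\<Sum>n | component G (x + y) n \<noteq> 0. h n (component G (x + y) n)) =
    (\<Sum>n | component G x n \<noteq> 0. h n (component G x n)) +
    (\<Sum>n | component G y n \<noteq> 0. h n (component G y n))"
    by (simp add: component_add additive.add[OF h] sum.distrib)
qed

lemma component_sum_homogeneous:
  assumes "x \<in> G n" and "h n 0 = 0"
  shows "(\<Sum>k | component G x k \<noteq> 0. h k (component G x k)) = h n x"
proof (cases "x = 0")
  case True
  then show ?thesis using assms(2) by (simp add: component_zero)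
next
  case False
  then have "{k. component G x k \<noteq> 0} = {n}" using component_homogeneous[OF assms(1)] by auto
  then show ?thesis using component_homogeneous[OF assms(1)] by simp
qed

text \<open>
  The projection of the tensor square to total degree \<open>n\<close> fixes \<open>t\<close> and maps \<open>x \<otimes> y\<close> to a sum of tensors of
  components of \<open>x\<close> and \<open>y\<close>.
\<close>

lemma htensor_of_sub:
  assumes t: "t \<in> htensor G G n" and s: "t \<in> tensor_sub X Y"
    and X: "\<And>x k. x \<in> X \<Longrightarrow> component G x k \<in> X" and Y: "\<And>y k. y \<in> Y \<Longrightarrow> component G y k \<in> Y"
  shows "t \<in> htensor (\<lambda>n. X \<inter> G n) (\<lambda>n. Y \<inter> G n) n"
proof -
  define pr where "pr = (\<lambda>t. \<Sum>i\<le>n. tensor_lift (\<lambda>u v. component G u i \<otimes>\<^sub>t component G v (n - i)) t)"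
  have bi: "biadditive (\<lambda>u v. component G u i \<otimes>\<^sub>t component G v (n - i))" for i
    by (rule biadditiveI) (simp_all add: component_add tensor_add_left tensor_add_right)
  have pr: "additive pr" unfolding pr_def by (rule additive_sum) (rule additive_tensor_lift[OF bi])
  have pr_tensor: "pr (u \<otimes>\<^sub>t v) = (\<Sum>i\<le>n. component G u i \<otimes>\<^sub>t component G v (n - i))" for u v
    unfolding pr_def by (simp add: tensor_lift[OF bi])
  have "pr t = t" using t
  proof (induction rule: htensor_induct)
    case (tensor u v i j)
    have "component G u k \<otimes>\<^sub>t component G v (n - k) = (if k = i then u \<otimes>\<^sub>t v else 0)" for k
      using tensor component_homogeneous[of u i k] component_homogeneous[of v j "n - k"] by auto
    then show ?case unfolding pr_tensor using tensor by simp
  qed (simp_all add: additive.zero[OF pr] additive.diff[OF pr])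
  moreover have "pr t \<in> htensor (\<lambda>n. X \<inter> G n) (\<lambda>n. Y \<inter> G n) n"
    using s unfolding tensor_sub_def htensor_def
  proof (rule additive_on_hull[OF pr])
    fix z assume "z \<in> {x \<otimes>\<^sub>t y |x y. x \<in> X \<and> y \<in> Y}"
    then obtain u v where z: "z = u \<otimes>\<^sub>t v" "u \<in> X" "v \<in> Y" by blast
    have "pr z \<in> htensor (\<lambda>n. X \<inter> G n) (\<lambda>n. Y \<inter> G n) n" unfolding z(1) pr_tensor
    proof (rule htensor_sum)
      fix i assume "i \<in> {..n}"
      then show "component G u i \<otimes>\<^sub>t component G v (n - i)
          \<in> htensor (\<lambda>n. X \<inter> G n) (\<lambda>n. Y \<inter> G n) n"
        using z X Y component_in by (intro htensor_base[of _ _ i _ _ "n - i"]) auto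
    qed
    then show "pr z \<in> additive_subgroup hull
      {u \<otimes>\<^sub>t v |u v. \<exists>i j. i + j = n \<and> u \<in> X \<inter> G i \<and> v \<in> Y \<inter> G j}" unfolding htensor_def .
  qed
  ultimately show ?thesis by simp
qed

end

section \<open>The product and the Steenrod action on the tensor square\<close>

context graded_commutative_algebra
begin

text \<open>
  The function of four arguments from which the product of the tensor square is obtained by linear
  extension.
\<close>

definition tensor_mult_kernel :: "'a \<Rightarrow> 'a \<Rightarrow> 'a \<Rightarrow> 'a \<Rightarrow> ('a, 'a) tensor" where
  "tensor_mult_kernel x y x' y' = (\<Sum>m | component G y m \<noteq> 0. \<Sum>n | component G x' n \<noteq> 0.
        ((-1) ^ (m * n) * (x * component G x' n)) \<otimes>\<^sub>t (component G y m * y'))"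

lemma tensor_mult_kernel_add:
  "tensor_mult_kernel (x1 + x2) y x' y' = tensor_mult_kernel x1 y x' y' + tensor_mult_kernel x2 y x' y'"
  "tensor_mult_kernel x (y1 + y2) x' y' = tensor_mult_kernel x y1 x' y' + tensor_mult_kernel x y2 x' y'"
  "tensor_mult_kernel x y (x1 + x2) y' = tensor_mult_kernel x y x1 y' + tensor_mult_kernel x y x2 y'"
  "tensor_mult_kernel x y x' (y1 + y2) = tensor_mult_kernel x y x' y1 + tensor_mult_kernel x y x' y2"
proof -
  show "tensor_mult_kernel (x1 + x2) y x' y' = tensor_mult_kernel x1 y x' y' + tensor_mult_kernel x2 y x' y'"
    by (simp add: tensor_mult_kernel_def distrib_left distrib_right tensor_add_left sum.distrib)
  show "tensor_mult_kernel x y x' (y1 + y2) = tensor_mult_kernel x y x' y1 + tensor_mult_kernel x y x' y2"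
    by (simp add: tensor_mult_kernel_def distrib_left tensor_add_right sum.distrib)
  have "additive (\<lambda>y. \<Sum>m | component G y m \<noteq> 0. (\<lambda>m z. \<Sum>n | component G x' n \<noteq> 0.
        ((-1) ^ (m * n) * (x * component G x' n)) \<otimes>\<^sub>t (z * y')) m (component G y m))"
    by (rule additive_component_sum)
      (simp add: additive_def distrib_right tensor_add_right sum.distrib)
  then show "tensor_mult_kernel x (y1 + y2) x' y' = tensor_mult_kernel x y1 x' y' + tensor_mult_kernel x y2 x' y'"
    unfolding tensor_mult_kernel_def additive_def by simp
  have "additive (\<lambda>x'. \<Sum>m | component G y m \<noteq> 0. \<Sum>n | component G x' n \<noteq> 0.
        (\<lambda>n z. ((-1) ^ (m * n) * (x * z)) \<otimes>\<^sub>t (component G y m * y')) n (component G x' n))"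
    by (intro additive_sum additive_component_sum)
      (simp add: additive_def distrib_left tensor_add_left)
  then show "tensor_mult_kernel x y (x1 + x2) y' = tensor_mult_kernel x y x1 y' + tensor_mult_kernel x y x2 y'"
    unfolding tensor_mult_kernel_def additive_def by simp
qed

lemma tensor_mult_eq:
  "tensor_mult G s t = tensor_lift (\<lambda>x y. tensor_lift (tensor_mult_kernel x y) t) s"
  unfolding tensor_mult_def tensor_mult_kernel_def ..

lemma biadditive_kernel: "biadditive (tensor_mult_kernel x y)"
  by (rule biadditiveI) (simp_all add: tensor_mult_kernel_add)

lemma biadditive_kernel': "biadditive (\<lambda>x y. tensor_lift (tensor_mult_kernel x y) t)"
  by (rule biadditiveI; rule tensor_lift_plus[OF biadditive_kernel biadditive_kernel biadditive_kernel])
    (simp_all add: tensor_mult_kernel_add)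

lemma additive_tensor_mult_left: "additive (\<lambda>s. tensor_mult G s t)"
  unfolding tensor_mult_eq by (rule additive_tensor_lift[OF biadditive_kernel'])

lemma additive_tensor_mult_right: "additive (tensor_mult G s)"
proof
  fix t t' :: "('a, 'a) tensor"
  show "tensor_mult G s (t + t') = tensor_mult G s t + tensor_mult G s t'"
    unfolding tensor_mult_eq
    by (rule tensor_lift_plus[OF biadditive_kernel' biadditive_kernel' biadditive_kernel'])
      (rule additive.add[OF additive_tensor_lift[OF biadditive_kernel]])
qed

lemma tensor_mult_homogeneous:
  assumes "v \<in> G m" "u' \<in> G n"
  shows "tensor_mult G (u \<otimes>\<^sub>t v) (u' \<otimes>\<^sub>t v') = ((-1) ^ (m * n) * (u * u')) \<otimes>\<^sub>t (v * v')"
proof -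
  have "tensor_mult_kernel u v u' v' = (\<Sum>n | component G u' n \<noteq> 0.
        ((-1) ^ (m * n) * (u * component G u' n)) \<otimes>\<^sub>t (v * v'))"
    unfolding tensor_mult_kernel_def
    by (rule component_sum_homogeneous[OF assms(1), where h = "\<lambda>m z. \<Sum>n | component G u' n \<noteq> 0.
        ((-1) ^ (m * n) * (u * component G u' n)) \<otimes>\<^sub>t (z * v')"]) simp
  also have "\<dots> = ((-1) ^ (m * n) * (u * u')) \<otimes>\<^sub>t (v * v')"
    by (rule component_sum_homogeneous[OF assms(2), where h = "\<lambda>n z.
        ((-1) ^ (m * n) * (u * z)) \<otimes>\<^sub>t (v * v')"]) simp
  also have "tensor_mult_kernel u v u' v' = tensor_mult G (u \<otimes>\<^sub>t v) (u' \<otimes>\<^sub>t v')"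
    unfolding tensor_mult_eq
    by (subst tensor_lift[OF biadditive_kernel']) (rule tensor_lift[OF biadditive_kernel, symmetric])
  finally show ?thesis .
qed

lemma minus_one_power_mult_in:
  assumes "subspace V" "x \<in> V"
  shows "(-1) ^ n * x \<in> V"
  using assms subspace_neg by (cases "even n") auto

definition graded_subalgebra :: "(nat \<Rightarrow> 'a set) \<Rightarrow> bool" where
  "graded_subalgebra A \<longleftrightarrow> graded_subspace A \<and> 1 \<in> A 0 \<and>
    (\<forall>m n. \<forall>x\<in>A m. \<forall>y\<in>A n. x * y \<in> A (m + n))"

lemma graded_subalgebraD:
  assumes "graded_subalgebra A"
  shows "graded_subspace A" "1 \<in> A 0" "x \<in> A m \<Longrightarrow> y \<in> A n \<Longrightarrow> x * y \<in> A (m + n)"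
    "x \<in> A m \<Longrightarrow> y \<in> A n \<Longrightarrow> m + n = k \<Longrightarrow> x * y \<in> A k"
  using assms unfolding graded_subalgebra_def by auto

lemma graded_subalgebra_G: "graded_subalgebra G"
  unfolding graded_subalgebra_def using graded_subspace_G one_in_G mult_in_G by blast

lemma tensor_mult_in_htensor:
  assumes X: "graded_subalgebra X" and Y: "graded_subalgebra Y"
    and s: "s \<in> htensor X Y m" and t: "t \<in> htensor X Y n"
  shows "tensor_mult G s t \<in> htensor X Y (m + n)"
proof (rule htensor_image[OF additive_tensor_mult_left s])
  fix u v i j assume 1: "i + j = m" "u \<in> X i" "v \<in> Y j"
  show "tensor_mult G (u \<otimes>\<^sub>t v) t \<in> htensor X Y (m + n)"
  proof (rule htensor_image[OF additive_tensor_mult_right t])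
    fix u' v' i' j' assume 2: "i' + j' = n" "u' \<in> X i'" "v' \<in> Y j'"
    have "v \<in> G j" "u' \<in> G i'"
      using graded_subspaceD(2)[OF graded_subalgebraD(1)[OF X] 2(2)]
        graded_subspaceD(2)[OF graded_subalgebraD(1)[OF Y] 1(3)] by simp_all
    then show "tensor_mult G (u \<otimes>\<^sub>t v) (u' \<otimes>\<^sub>t v') \<in> htensor X Y (m + n)"
      unfolding tensor_mult_homogeneous[OF \<open>v \<in> G j\<close> \<open>u' \<in> G i'\<close>]
      by (intro htensor_base[where i = "i + i'" and j = "j + j'"] minus_one_power_mult_in
          graded_subalgebraD(3)[OF X] graded_subalgebraD(3)[OF Y]
          graded_subspaceD(1)[OF graded_subalgebraD(1)[OF X]]) (use 1 2 in auto)
  qed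
qed

end

locale fp_unstable_hopf_algebra =
  unstable_hopf_algebra p scale G \<Delta> \<epsilon> act + fp_unstable_module p scale G act
  for p :: nat
    and scale :: "'k::field \<Rightarrow> 'a::ring_1 \<Rightarrow> 'a" (infixr \<open>*s\<close> 75)
    and G :: "nat \<Rightarrow> 'a set"
    and \<Delta> :: "'a \<Rightarrow> ('a, 'a) tensor"
    and \<epsilon> :: "'a \<Rightarrow> 'k"
    and act :: "steenrod_gen \<Rightarrow> 'a \<Rightarrow> 'a"
begin

section \<open>The Frobenius map\<close>

lemma of_nat_eq_0_iff: "(of_nat n :: 'k) = 0 \<longleftrightarrow> p dvd n"
proof -
  have "(\<Sum>x\<in>(UNIV::'k set). x) = (\<Sum>x\<in>UNIV. x + 1)"
    by (rule sum.reindex_bij_witness[of _ "\<lambda>x. x + 1" "\<lambda>x. x - 1"]) auto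
  then have "(of_nat p :: 'k) = 0" using card_k finite_field by (simp add: sum.distrib)
  then have "CHAR('k) dvd p" by (simp add: of_nat_eq_0_iff_char_dvd)
  moreover have "CHAR('k) \<noteq> 1" using of_nat_eq_0_iff_char_dvd[of 1, where 'a = 'k] by auto
  ultimately have "CHAR('k) = p" using prime_p by (metis prime_nat_iff)
  then show ?thesis by (simp add: of_nat_eq_0_iff_char_dvd)
qed

lemma of_nat_mult_eq_scale: "of_nat n * (x :: 'a) = of_nat n *s x"
  by (induction n) (simp_all add: distrib_right scale_left_distrib)

lemma \<P>_cartan: "\<P> n (x * y) = (\<Sum>i\<le>n. \<P> i x * \<P> (n - i) y)"
  unfolding \<P>_def using Sq_cartan RP_cartan by simp

lemma \<beta>_cartan: "x \<in> G n \<Longrightarrow> \<beta> (x * y) = \<beta> x * y + (-1) ^ n * (x * \<beta> y)"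
  unfolding \<beta>_def using Bockstein_cartan by simp

lemma \<P>_power: "x \<in> G (w * i) \<Longrightarrow> \<P> i x = x ^ p"
  unfolding \<P>_def w_def using Sq_top RP_top by (auto split: if_splits)

lemma odd_square_zero:
  assumes "x \<in> G n" "odd n" "p \<noteq> 2"
  shows "x * x = 0"
proof -
  have "x * x = - (x * x)" using graded_commute[OF assms(1,1)] assms(2) by simp
  then have "x * x + x * x = 0" by (metis add.right_inverse)
  then have "(1 + 1 :: 'k) *s (x * x) = 0" by (simp only: scale_left_distrib scale_one)
  moreover have "\<not> p dvd 2" using p_ge_2 assms(3) by (auto dest: dvd_imp_le)
  then have "(1 + 1 :: 'k) \<noteq> 0" using of_nat_eq_0_iff[of 2] by simp
  ultimately show ?thesis by simp
qed

lemma power_odd_zero: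
  assumes "x \<in> G n" "\<not> w dvd n"
  shows "x ^ p = 0"
proof -
  have w2: "w = 2" using assms(2) by (cases rule: w_cases) auto
  then have "p \<noteq> 2" using p_eq_2(1) by auto
  moreover have "odd n" using assms(2) w2 by simp
  ultimately have "x * x = 0" using odd_square_zero[OF assms(1)] by simp
  then have "x ^ 2 = 0" by (simp add: power2_eq_square)
  moreover have "x ^ p = x ^ 2 * x ^ (p - 2)" using p_ge_2 by (metis le_add_diff_inverse power_add)
  ultimately show ?thesis by simp
qed

lemma power_p_cases:
  assumes "x \<in> G n"
  obtains b where "n = w * b" "x ^ p = \<P> b x" | "\<not> w dvd n" "x ^ p = 0"
  using assms \<P>_power power_odd_zero by (metis dvdE)

lemma power_p_add: "x \<in> G n \<Longrightarrow> y \<in> G n \<Longrightarrow> (x + y) ^ p = x ^ p + y ^ p"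
proof (cases "w dvd n")
  case True
  assume "x \<in> G n" "y \<in> G n"
  with True show ?thesis using \<P>_power[of x "n div w"] \<P>_power[of y "n div w"]
      \<P>_power[of "x + y" "n div w"] subspace_add[OF subspace_G, of x n y] by (simp add: \<P>.add)
next
  case False
  assume xy: "x \<in> G n" "y \<in> G n"
  show ?thesis using power_odd_zero[OF xy(1) False] power_odd_zero[OF xy(2) False]
      power_odd_zero[OF subspace_add[OF subspace_G xy] False] by simp
qed

lemma power_p_scale: "x \<in> G n \<Longrightarrow> (c *s x) ^ p = c *s x ^ p"
proof (cases "w dvd n")
  case True
  assume "x \<in> G n"
  with True show ?thesis using \<P>_power[of x "n div w"]
      \<P>_power[of "c *s x" "n div w"] subspace_scale[OF subspace_G, of x n c] by (simp add: \<P>.scale)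
next
  case False
  assume x: "x \<in> G n"
  show ?thesis using power_odd_zero[OF x False]
      power_odd_zero[OF subspace_scale[OF subspace_G x] False] by simp
qed

lemma power_in_G: "x \<in> G n \<Longrightarrow> x ^ k \<in> G (n * k)"
  by (induction k) (auto simp: one_in_G mult_in_G)

text \<open>
  In the Cartan formula for \<open>\<P> n\<close> on a product of degree \<open>w n\<close>, instability on both factors leaves at most the term in
  which both operations are top operations, that is, \<open>p\<close>-th powers.
\<close>

lemma \<P>_\<P>_eq_powers:
  assumes "i \<le> n" "u \<in> G k" "v \<in> G l" "k + l = w * n"
  shows "(i = k div w \<and> w dvd k \<and> \<P> i u = u ^ p \<and> \<P> (n - i) v = v ^ p) \<or>
    ((i \<noteq> k div w \<or> \<not> w dvd k) \<and> (\<P> i u = 0 \<or> \<P> (n - i) v = 0))"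
proof (cases "k = w * i")
  case True
  then have "l = w * (n - i)" using assms by (simp add: diff_mult_distrib2)
  then show ?thesis using True assms \<P>_power w_pos by simp
next
  case False
  have "i \<noteq> k div w \<or> \<not> w dvd k" using False by auto
  moreover have "k < w * i \<or> l < w * (n - i)"
    using False assms by (auto simp: diff_mult_distrib2)
  ultimately show ?thesis using \<P>_unstable assms by blast
qed

lemma sum_\<P>_powers:
  fixes h :: "'a \<Rightarrow> 'a \<Rightarrow> 'c::ab_group_add"
  assumes "u \<in> G k" "v \<in> G l" "k + l = w * n" and h: "\<And>x. h 0 x = 0" "\<And>x. h x 0 = 0"
  shows "(\<Sum>i\<le>n. h (\<P> i u) (\<P> (n - i) v)) = h (u ^ p) (v ^ p)"
proof (cases "w dvd k")
  case True
  then have le: "k div w \<le> n" using assms(3) w_pos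
    by (metis div_le_mono le_add1 nonzero_mult_div_cancel_left not_gr_zero)
  have "h (\<P> i u) (\<P> (n - i) v) = (if i = k div w then h (u ^ p) (v ^ p) else 0)" if "i \<le> n" for i
    using \<P>_\<P>_eq_powers[OF that assms(1-3)] h True by auto
  then show ?thesis using le by simp
next
  case False
  have "h (\<P> i u) (\<P> (n - i) v) = 0" if "i \<le> n" for i
    using \<P>_\<P>_eq_powers[OF that assms(1-3)] False h by auto
  then show ?thesis using power_odd_zero[OF assms(1) False] h by simp
qed

text \<open>
  For odd \<open>p\<close> the elements need not commute, but the Cartan formula for the \<open>p\<close>-th power as a Steenrod
  operation gives the result without signs; if a degree is odd, both sides vanish.
\<close>

lemma power_p_mult:
  assumes "x \<in> G m" "y \<in> G n"
  shows "(x * y) ^ p = x ^ p * y ^ p"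
proof (cases "w dvd m + n")
  case True
  then obtain b where b: "m + n = w * b" by (elim dvdE)
  have "(x * y) ^ p = \<P> b (x * y)" using \<P>_power mult_in_G[OF assms] b by simp
  also have "\<dots> = x ^ p * y ^ p"
    unfolding \<P>_cartan using sum_\<P>_powers[OF assms b, of "(*)"] by simp
  finally show ?thesis .
next
  case False
  then have "\<not> w dvd m \<or> \<not> w dvd n" by auto
  then show ?thesis
    using False power_odd_zero[OF mult_in_G[OF assms]] power_odd_zero[OF assms(1)]
      power_odd_zero[OF assms(2)] by auto
qed

text \<open>
  In degrees divisible by \<open>w\<close> the \<open>p\<close>-th power is the top operation for \<open>s = 0\<close>, so this is a case of the relation
  between powers and the top operation. In the other degrees both sides vanish.
\<close>

lemma \<P>_power_p:
  assumes "x \<in> G n"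
  shows "\<P> (p * i) (x ^ p) = (\<P> i x) ^ p"
  using assms
proof (cases rule: power_p_cases)
  case (1 b)
  have "stable (\<lambda>n. {0})"
    by (simp add: stable_def graded_subspace_def \<P>_closed_def \<beta>_closed_def \<P>.zero \<beta>.zero)
  moreover have "unstable_modulo 0 (\<lambda>n. {0})"
    using \<P>_unstable \<beta>_\<P>_unstable by (simp add: unstable_modulo_def)
  ultimately have "\<P> (p * i) (top_op 0 n x) - top_op 0 (n + \<delta> i) (\<P> i x) \<in> {0}"
    using top_\<P>[OF _ _ assms, of "\<lambda>n. {0}" 0 i] by blast
  moreover have "top_op 0 n x = x ^ p" using top_even(1)[of 0 b x] 1 by simp
  moreover have n: "n + \<delta> i = w * (b + \<rho> i)" using 1 by (simp add: \<delta>_\<rho> distrib_left)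
  then have "top_op 0 (n + \<delta> i) (\<P> i x) = (\<P> i x) ^ p"
    using top_even(1)[of 0 "b + \<rho> i"] \<P>_power[of "\<P> i x" "b + \<rho> i"] \<P>_in_G[OF assms, of i] by simp
  ultimately show ?thesis by simp
next
  case 2
  have "\<not> w dvd n + \<delta> i" using 2 by (simp add: \<delta>_\<rho> dvd_add_left_iff)
  then show ?thesis using 2 power_odd_zero[OF \<P>_in_G[OF assms]] by (simp add: \<P>.zero)
qed

lemma power_p_power: "(x :: 'a) ^ (p ^ Suc k) = (x ^ (p ^ k)) ^ p"
  by (simp only: power_Suc2) (rule power_mult)

lemma power_pk_in_G: "x \<in> G n \<Longrightarrow> x ^ (p ^ k) \<in> G (n * p ^ k)"
  by (rule power_in_G)

lemma power_pk_add: "x \<in> G n \<Longrightarrow> y \<in> G n \<Longrightarrow> (x + y) ^ (p ^ k) = x ^ (p ^ k) + y ^ (p ^ k)"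
  by (induction k) (simp_all only: power_p_power power_p_add[OF power_pk_in_G power_pk_in_G] power_0 power_one_right)

lemma power_pk_scale: "x \<in> G n \<Longrightarrow> (c *s x) ^ (p ^ k) = c *s x ^ (p ^ k)"
  by (induction k) (simp_all only: power_p_power power_p_scale[OF power_pk_in_G] power_0 power_one_right)

lemma power_pk_mult: "x \<in> G m \<Longrightarrow> y \<in> G n \<Longrightarrow> (x * y) ^ (p ^ k) = x ^ (p ^ k) * y ^ (p ^ k)"
  by (induction k) (simp_all only: power_p_power power_p_mult[OF power_pk_in_G power_pk_in_G] power_0 power_one_right)

lemma \<P>_power_pk:
  assumes "x \<in> G n"
  shows "\<P> (p ^ k * i) (x ^ (p ^ k)) = (\<P> i x) ^ (p ^ k)"
proof (induction k)
  case (Suc k)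
  have "\<P> (p ^ Suc k * i) (x ^ (p ^ Suc k)) = \<P> (p * (p ^ k * i)) ((x ^ (p ^ k)) ^ p)"
    unfolding power_p_power by (simp add: mult_ac)
  also have "\<dots> = (\<P> i x) ^ (p ^ Suc k)"
    unfolding \<P>_power_p[OF power_pk_in_G[OF assms]] Suc power_p_power ..
  finally show ?case .
qed simp

section \<open>Coideal subalgebras\<close>

text \<open>
  The one-sided form of the condition on the coproduct of a Hopf subalgebra. It passes to the subalgebra
  generated by \<open>A\<close> and an element \<open>x\<close> as soon as \<open>\<Delta> x - 1 \<otimes> x\<close> lies in \<open>G \<otimes> A\<close>.
\<close>

definition coideal :: "(nat \<Rightarrow> 'a set) \<Rightarrow> bool" where
  "coideal A \<longleftrightarrow> (\<forall>n. \<forall>x\<in>A n. \<Delta> x \<in> htensor G A n)"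

sublocale \<Delta>: additive \<Delta> by (rule comult_additive)

lemma comult_in_htensor: "x \<in> G n \<Longrightarrow> \<Delta> x \<in> htensor G G n"
  using comult_degree[of x n] unfolding tensor_degree_def htensor_def .

lemma scale_tensor: "c *s x \<otimes>\<^sub>t y = x \<otimes>\<^sub>t c *s y"
  using tensor_scale_left_right[of scale scale c x y] prime_p card_k vector_space_axioms by simp

definition tensor_\<P> :: "nat \<Rightarrow> ('a, 'a) tensor \<Rightarrow> ('a, 'a) tensor" where
  "tensor_\<P> n = tensor_lift (\<lambda>x y. \<Sum>i\<le>n. \<P> i x \<otimes>\<^sub>t \<P> (n - i) y)"

lemma biadditive_\<P>: "biadditive (\<lambda>x y. \<Sum>i\<le>n. \<P> i x \<otimes>\<^sub>t \<P> (n - i) y)"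
  by (rule biadditiveI) (simp_all add: \<P>.add tensor_add_left tensor_add_right sum.distrib)

lemma additive_tensor_\<P>: "additive (tensor_\<P> n)"
  unfolding tensor_\<P>_def by (rule additive_tensor_lift[OF biadditive_\<P>])

lemma tensor_\<P>: "tensor_\<P> n (x \<otimes>\<^sub>t y) = (\<Sum>i\<le>n. \<P> i x \<otimes>\<^sub>t \<P> (n - i) y)"
  unfolding tensor_\<P>_def by (rule tensor_lift[OF biadditive_\<P>])

lemma comult_\<P>: "\<Delta> (\<P> n x) = tensor_\<P> n (\<Delta> x)"
  using comult_act[of "Sq n" x] comult_act[of "RP n" x]
  unfolding tensor_\<P>_def \<P>_def steenrod_gens_def by auto

text \<open>
  The bilinear map whose extension is the Bockstein of the tensor square.
\<close>

definition bockstein_kernel :: "'a \<Rightarrow> 'a \<Rightarrow> ('a, 'a) tensor" where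
  "bockstein_kernel x y = \<beta> x \<otimes>\<^sub>t y +
    (\<Sum>m | component G x m \<noteq> 0. ((-1) ^ m * component G x m) \<otimes>\<^sub>t \<beta> y)"

lemma biadditive_bockstein: "biadditive bockstein_kernel"
proof (rule biadditiveI)
  fix x x' y
  have "additive (\<lambda>x. \<Sum>m | component G x m \<noteq> 0. (\<lambda>m z. ((-1) ^ m * z) \<otimes>\<^sub>t \<beta> y) m (component G x m))"
    by (rule additive_component_sum) (simp add: additive_def distrib_left tensor_add_left)
  then show "bockstein_kernel (x + x') y = bockstein_kernel x y + bockstein_kernel x' y"
    unfolding bockstein_kernel_def additive_def by (simp add: \<beta>.add tensor_add_left)
next
  fix x y y'
  show "bockstein_kernel x (y + y') = bockstein_kernel x y + bockstein_kernel x y'"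
    unfolding bockstein_kernel_def by (simp add: \<beta>.add tensor_add_right sum.distrib)
qed

lemma bockstein_kernel_homogeneous:
  "x \<in> G m \<Longrightarrow> bockstein_kernel x y = \<beta> x \<otimes>\<^sub>t y + ((-1) ^ m * x) \<otimes>\<^sub>t \<beta> y"
  unfolding bockstein_kernel_def
  using component_sum_homogeneous[of x m "\<lambda>m z. ((-1) ^ m * z) \<otimes>\<^sub>t \<beta> y"] by simp

lemma comult_\<beta>: "\<Delta> (\<beta> x) = tensor_lift bockstein_kernel (\<Delta> x)"
proof (cases "p = 2")
  case True
  have "bockstein_kernel = (\<lambda>x y. 0)" unfolding bockstein_kernel_def p_eq_2(3)[OF True] by simp
  moreover have "tensor_lift (\<lambda>x y. 0) = (\<lambda>t :: ('a, 'a) tensor. 0 :: ('a, 'a) tensor)"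
    by (rule tensor_lift_unique) (simp_all add: additive_def)
  ultimately show ?thesis unfolding p_eq_2(3)[OF True] by (simp add: \<Delta>.zero)
next
  case False
  then show ?thesis using comult_act[of Bockstein x]
    unfolding bockstein_kernel_def p_neq_2(3)[OF False] steenrod_gens_def by simp
qed

lemma comult_\<P>_in_htensor:
  assumes A: "graded_subspace A" "\<P>_closed A" and x: "\<Delta> x \<in> htensor G A n"
  shows "\<Delta> (\<P> i x) \<in> htensor G A (n + \<delta> i)"
  unfolding comult_\<P>
proof (rule htensor_image[OF additive_tensor_\<P> x])
  fix u v k l assume *: "k + l = n" "u \<in> G k" "v \<in> A l"
  show "tensor_\<P> i (u \<otimes>\<^sub>t v) \<in> htensor G A (n + \<delta> i)"
    unfolding tensor_\<P>
  proof (rule htensor_sum)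
    fix j assume "j \<in> {..i}"
    then have "\<delta> j + \<delta> (i - j) = \<delta> i" by (simp add: \<delta>_add[symmetric])
    then show "\<P> j u \<otimes>\<^sub>t \<P> (i - j) v \<in> htensor G A (n + \<delta> i)"
      using * \<P>_in_G[OF *(2), of j] A(2) unfolding \<P>_closed_def
      by (intro htensor_base[of _ _ "k + \<delta> j" _ _ "l + \<delta> (i - j)"]) auto
  qed
qed

lemma comult_\<beta>_in_htensor:
  assumes A: "graded_subspace A" "\<beta>_closed A" and x: "\<Delta> x \<in> htensor G A n"
  shows "\<Delta> (\<beta> x) \<in> htensor G A (n + 1)"
  unfolding comult_\<beta>
proof (rule htensor_image[OF additive_tensor_lift[OF biadditive_bockstein] x])
  fix u v k l assume *: "k + l = n" "u \<in> G k" "v \<in> A l"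
  have "\<beta> u \<otimes>\<^sub>t v \<in> htensor G A (n + 1)"
    by (rule htensor_base[of _ _ "k + 1" _ _ l]) (use * \<beta>_in_G[OF *(2)] in simp_all)
  moreover have "((-1) ^ k * u) \<otimes>\<^sub>t \<beta> v \<in> htensor G A (n + 1)"
    using A(2) * unfolding \<beta>_closed_def
    by (intro htensor_base[of _ _ k _ _ "l + 1"] minus_one_power_mult_in[OF subspace_G]) auto
  ultimately show "tensor_lift bockstein_kernel (u \<otimes>\<^sub>t v) \<in> htensor G A (n + 1)"
    unfolding tensor_lift[OF biadditive_bockstein] bockstein_kernel_homogeneous[OF *(2)]
    by (rule htensor_add)
qed

section \<open>The action of functionals\<close>

definition functional :: "('a \<Rightarrow> 'k) \<Rightarrow> bool" where
  "functional \<phi> \<longleftrightarrow> Vector_Spaces.linear scale (*) \<phi>"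

lemma functionalD:
  assumes "functional \<phi>"
  shows "\<phi> (x + y) = \<phi> x + \<phi> y" "\<phi> (c *s x) = c * \<phi> x" "\<phi> 0 = 0" "\<phi> (x - y) = \<phi> x - \<phi> y"
proof -
  interpret \<phi>: Vector_Spaces.linear scale "(*)" \<phi> using assms unfolding functional_def .
  show "\<phi> (x + y) = \<phi> x + \<phi> y" "\<phi> (c *s x) = c * \<phi> x" "\<phi> 0 = 0" "\<phi> (x - y) = \<phi> x - \<phi> y"
    by (rule \<phi>.add \<phi>.scale \<phi>.zero \<phi>.diff)+
qed

definition of_degree :: "nat \<Rightarrow> ('a \<Rightarrow> 'k) \<Rightarrow> bool" where
  "of_degree m \<phi> \<longleftrightarrow> (\<forall>n x. n \<noteq> m \<longrightarrow> x \<in> G n \<longrightarrow> \<phi> x = 0)"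

lemma functional_counit: "functional \<epsilon>"
  unfolding functional_def by (rule counit_linear)

lemma functional_vanishing_on:
  assumes V: "subspace V" "V \<subseteq> G m" and x: "x \<in> G m" "x \<notin> V"
  obtains \<phi> where "functional \<phi>" "of_degree m \<phi>" "\<And>v. v \<in> V \<Longrightarrow> \<phi> v = 0" "\<phi> x = 1"
proof -
  interpret vs: vector_space_pair scale "(*) :: 'k \<Rightarrow> 'k \<Rightarrow> 'k" by unfold_locales (simp_all add: algebra_simps)
  define V' where "V' = {y. component G y m \<in> V}"
  have V': "subspace V'"
    using V(1) unfolding V'_def subspace_def by (simp add: component_zero component_add component_scale)
  obtain B where B: "B \<subseteq> V'" "independent B" "V' \<subseteq> span B" using maximal_independent_subset .
  have "span B \<subseteq> V'" using span_minimal[OF B(1) V'] .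
  moreover have "x \<notin> V'" unfolding V'_def using x component_homogeneous[of x m m] by simp
  ultimately have "x \<notin> span B" by blast
  then have "independent (insert x B)" using B(2) independent_insert by auto
  then obtain \<phi> where \<phi>: "Vector_Spaces.linear scale (*) \<phi>"
    "\<And>b. b \<in> insert x B \<Longrightarrow> \<phi> b = (if b = x then 1 else 0)"
    using vs.linear_independent_extend[of "insert x B" "\<lambda>b. if b = x then 1 else 0"] by blast
  have f: "functional \<phi>" unfolding functional_def by (rule \<phi>(1))
  have "\<phi> y = 0" if "y \<in> V'" for y
  proof -
    have "y \<in> span B" using that B(3) by blast
    then show ?thesis
    proof (induction rule: span_induct_alt)
      case (step c b z)
      moreover have "b \<noteq> x" using step(1) \<open>x \<notin> span B\<close> span_base by blast
      ultimately show ?case using \<phi>(2)[of b] functionalD[OF f] by simp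
    qed (rule functionalD(3)[OF f])
  qed
  moreover have "V \<subseteq> V'" unfolding V'_def using V(2) component_homogeneous by fastforce
  moreover have "y \<in> V'" if "y \<in> G n" "n \<noteq> m" for y n
    unfolding V'_def using component_homogeneous[OF that(1), of m] that(2) subspace_0[OF V(1)] by simp
  ultimately show thesis using f \<phi>(2)[of x] by (intro that[of \<phi>]) (auto simp: of_degree_def)
qed

definition slice :: "('a \<Rightarrow> 'k) \<Rightarrow> ('a, 'a) tensor \<Rightarrow> 'a" where
  "slice \<phi> = tensor_lift (\<lambda>y z. \<phi> z *s y)"

text \<open>
  The action of the dual algebra: \<open>D \<phi> = (id \<otimes> \<phi>) \<Delta>\<close>. On the functions on a group these are the differential
  operators that are invariant under translation. They replace computations in tensor products by
  computations in the algebra.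
\<close>

definition D :: "('a \<Rightarrow> 'k) \<Rightarrow> 'a \<Rightarrow> 'a" where
  "D \<phi> x = slice \<phi> (\<Delta> x)"

lemma
  assumes "functional \<phi>"
  shows additive_slice: "additive (slice \<phi>)" and slice_tensor: "slice \<phi> (u \<otimes>\<^sub>t v) = \<phi> v *s u"
proof -
  have "biadditive (\<lambda>y z. \<phi> z *s y)"
    by (rule biadditiveI) (simp_all add: functionalD[OF assms] scale_right_distrib scale_left_distrib)
  from additive_tensor_lift[OF this] tensor_lift[OF this]
  show "additive (slice \<phi>)" "slice \<phi> (u \<otimes>\<^sub>t v) = \<phi> v *s u" unfolding slice_def by simp_all
qed

lemma additive_D: "functional \<phi> \<Longrightarrow> additive (D \<phi>)"
  using additive.add[OF additive_slice] unfolding D_def additive_def by (simp add: \<Delta>.add)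

lemma D_counit: "D \<epsilon> x = x"
  unfolding D_def slice_def by (rule counit_right)

lemma slice_in:
  assumes \<phi>: "functional \<phi>" "of_degree m \<phi>" and X: "graded_subspace X" and Y: "Y \<le> G"
    and t: "t \<in> htensor X Y n"
  shows "if m \<le> n then slice \<phi> t \<in> X (n - m) else slice \<phi> t = 0"
  using t
proof (induction rule: htensor_induct)
  case (tensor u v i j)
  show ?case
  proof (cases "j = m")
    case True
    with tensor show ?thesis using graded_subspaceD(6)[OF X] by (auto simp: slice_tensor[OF \<phi>(1)])
  next
    case False
    with tensor Y \<phi>(2) have "\<phi> v = 0" unfolding of_degree_def le_fun_def by blast
    then show ?thesis using graded_subspaceD(3)[OF X] by (simp add: slice_tensor[OF \<phi>(1)])
  qed
next
  case zero
  show ?case using graded_subspaceD(3)[OF X] by (simp add: additive.zero[OF additive_slice[OF \<phi>(1)]])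
next
  case (diff s t)
  then show ?case using graded_subspaceD(5)[OF X]
    by (auto simp: additive.diff[OF additive_slice[OF \<phi>(1)]] split: if_splits)
qed

lemma slice_zero:
  assumes \<phi>: "functional \<phi>" and "\<And>j v. v \<in> Y j \<Longrightarrow> \<phi> v = 0" and t: "t \<in> htensor X Y n"
  shows "slice \<phi> t = 0"
  using t
  by (induction rule: htensor_induct)
    (simp_all add: slice_tensor[OF \<phi>] assms(2) additive.zero[OF additive_slice[OF \<phi>]]
      additive.diff[OF additive_slice[OF \<phi>]])

definition truncate :: "nat \<Rightarrow> (nat \<Rightarrow> 'a set) \<Rightarrow> nat \<Rightarrow> 'a set" where
  "truncate n A j = (if j < n then A j else {0})"

lemma counit_scale_one: "\<epsilon> (c *s 1) = c"
  using functionalD(2)[OF functional_counit] counit_one by simp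

lemma G_0_cases:
  assumes "x \<in> G 0"
  shows "x = \<epsilon> x *s 1"
  using assms connected counit_scale_one by auto

lemma G_0_mult:
  assumes "v \<in> G 0"
  shows "v * x = \<epsilon> v *s x" and "x * v = \<epsilon> v *s x"
proof -
  have "v = \<epsilon> v *s 1" by (rule G_0_cases[OF assms])
  then show "v * x = \<epsilon> v *s x" "x * v = \<epsilon> v *s x"
    by (metis scale_mult_left mult_1_left, metis scale_mult_right mult_1_right)
qed

text \<open>
  The component of \<open>\<Delta> x\<close> in \<open>G 0 \<otimes> A n\<close> is \<open>1 \<otimes> z\<close> for some \<open>z\<close>, since \<open>G 0\<close> consists of scalars, and the counit on
  the left shows that \<open>z = x\<close>.
\<close>

lemma comult_minus_top:
  assumes A: "graded_subspace A" and x: "\<Delta> x \<in> htensor G A n"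
  shows "\<Delta> x - 1 \<otimes>\<^sub>t x \<in> htensor G (truncate n A) n" and "x \<in> A n"
proof -
  define E where "E = tensor_lift (\<lambda>y z. \<epsilon> y *s z)"
  have bi: "biadditive (\<lambda>y z. \<epsilon> y *s z)"
    by (rule biadditiveI)
      (simp_all add: functionalD[OF functional_counit] scale_right_distrib scale_left_distrib)
  have E: "additive E" and E_tensor: "E (u \<otimes>\<^sub>t v) = \<epsilon> u *s v" for u v
    unfolding E_def using additive_tensor_lift[OF bi] tensor_lift[OF bi] by simp_all
  have "t - 1 \<otimes>\<^sub>t E t \<in> htensor G (truncate n A) n \<and> E t \<in> A n" if "t \<in> htensor G A n" for t
    using that
  proof (induction rule: htensor_induct)
    case (tensor u v i j)
    show ?case
    proof (cases "i = 0")
      case True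
      then have "u \<otimes>\<^sub>t v = 1 \<otimes>\<^sub>t (\<epsilon> u *s v)" using G_0_cases[of u] tensor scale_tensor by metis
      then show ?thesis using graded_subspaceD(6)[OF A] tensor True
        by (simp add: E_tensor htensor_zero counit_one functionalD[OF functional_counit])
    next
      case False
      then have "\<epsilon> u = 0" using counit_degree tensor by simp
      moreover have "u \<otimes>\<^sub>t v \<in> htensor G (truncate n A) n"
        by (rule htensor_base[of _ _ i _ _ j]) (use tensor False in \<open>auto simp: truncate_def\<close>)
      ultimately show ?thesis using graded_subspaceD(3)[OF A] by (simp add: E_tensor)
    qed
  next
    case zero
    show ?case using graded_subspaceD(3)[OF A] by (simp add: additive.zero[OF E] htensor_zero)
  next
    case (diff s t)
    have "s - t - 1 \<otimes>\<^sub>t E (s - t) = (s - 1 \<otimes>\<^sub>t E s) - (t - 1 \<otimes>\<^sub>t E t)"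
      using tensor_add_right[of 1 "E s - E t" "E t"] by (simp add: additive.diff[OF E] algebra_simps)
    then show ?case using diff htensor_diff graded_subspaceD(5)[OF A] additive.diff[OF E] by metis
  qed
  from this[OF x] show "\<Delta> x - 1 \<otimes>\<^sub>t x \<in> htensor G (truncate n A) n" and "x \<in> A n"
    unfolding E_def counit_left by blast+
qed

lemma D_in:
  assumes \<phi>: "functional \<phi>" "of_degree m \<phi>" and X: "graded_subspace X"
    and x: "\<Delta> x \<in> htensor X G n"
  shows "m \<le> n \<Longrightarrow> D \<phi> x \<in> X (n - m)" and "n < m \<Longrightarrow> D \<phi> x = 0"
  using slice_in[OF \<phi> X order_refl x] unfolding D_def by (auto split: if_splits)

lemma D_top_degree:
  assumes \<phi>: "functional \<phi>" "of_degree m \<phi>" and x: "x \<in> G m"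
  shows "D \<phi> x = \<phi> x *s 1"
proof -
  have "slice \<phi> (\<Delta> x - 1 \<otimes>\<^sub>t x) = 0"
    by (rule slice_zero[OF \<phi>(1) _ comult_minus_top(1)[OF graded_subspace_G comult_in_htensor[OF x]]])
      (use \<phi>(2) functionalD(3)[OF \<phi>(1)] in \<open>auto simp: of_degree_def truncate_def split: if_splits\<close>)
  then show ?thesis
    unfolding D_def by (simp add: additive.diff[OF additive_slice[OF \<phi>(1)]] slice_tensor[OF \<phi>(1)])
qed

text \<open>
  If \<open>\<phi>\<close> is multiplicative up to the counit, then the slice of a product is the product of the slices. No signs
  survive, as the counit is zero in positive degrees.
\<close>

lemma slice_tensor_mult:
  assumes \<phi>: "functional \<phi>" and V: "V \<le> G"
    and mult: "\<And>i j v v'. v \<in> V i \<Longrightarrow> v' \<in> E j \<Longrightarrow> \<phi> (v * v') = \<epsilon> v * \<phi> v'"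
    and s: "s \<in> htensor G V m" and t: "t \<in> htensor G E n"
  shows "slice \<phi> (tensor_mult G s t) = slice \<epsilon> s * slice \<phi> t"
  using s
proof (induction rule: htensor_induct)
  note sl = additive_slice[OF \<phi>] additive_slice[OF functional_counit]
  case (tensor u v i j)
  then have v: "v \<in> G j" using V by (auto simp: le_fun_def)
  show ?case using t
  proof (induction rule: htensor_induct)
    case (tensor u' v' i' j')
    have "\<phi> (v * v') *s ((-1) ^ (j * i') * (u * u')) = (\<epsilon> v *s u) * (\<phi> v' *s u')"
    proof (cases "j = 0")
      case True
      then show ?thesis using mult \<open>v \<in> V j\<close> tensor
        by (simp add: scale_mult_left[symmetric] scale_mult_right[symmetric] mult.commute)
    next
      case False
      then have "\<epsilon> v = 0" using counit_degree v by simp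
      then show ?thesis using mult[OF \<open>v \<in> V j\<close>] tensor by simp
    qed
    then show ?case using tensor v
      by (simp add: tensor_mult_homogeneous slice_tensor[OF \<phi>] slice_tensor[OF functional_counit])
  next
    case zero
    show ?case by (simp add: additive.zero[OF additive_tensor_mult_right] additive.zero[OF sl(1)])
  next
    case (diff s t)
    then show ?case by (simp add: additive.diff[OF additive_tensor_mult_right] additive.diff[OF sl(1)]
          right_diff_distrib)
  qed
next
  note sl = additive_slice[OF \<phi>] additive_slice[OF functional_counit]
  case zero
  show ?case by (simp add: additive.zero[OF additive_tensor_mult_left] additive.zero[OF sl(1)]
        additive.zero[OF sl(2)])
next
  note sl = additive_slice[OF \<phi>] additive_slice[OF functional_counit]
  case (diff s t)
  then show ?case by (simp add: additive.diff[OF additive_tensor_mult_left] additive.diff[OF sl(1)]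
        additive.diff[OF sl(2)] left_diff_distrib)
qed

text \<open>
  A functional that vanishes on the ideal generated by the positive part of \<open>A\<close> acts \<open>A\<close>-linearly.
\<close>

lemma D_mult_left:
  assumes \<phi>: "functional \<phi>" and A: "graded_subspace A"
    and mult: "\<And>i j v v'. v \<in> A i \<Longrightarrow> v' \<in> E j \<Longrightarrow> \<phi> (v * v') = \<epsilon> v * \<phi> v'"
    and a: "\<Delta> a \<in> htensor G A m" and y: "\<Delta> y \<in> htensor G E n"
  shows "D \<phi> (a * y) = a * D \<phi> y"
proof -
  have "A \<le> G" using graded_subspaceD(2)[OF A] by (auto simp: le_fun_def)
  from slice_tensor_mult[OF \<phi> this mult a y]
  show ?thesis using D_counit[of a] unfolding D_def comult_mult by simp
qed

text \<open>
  A functional that vanishes on decomposables acts as a derivation. The hypothesis on \<open>m\<close> excludes the signs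
  of a graded derivation.
\<close>

lemma D_derivation:
  assumes \<phi>: "functional \<phi>" "of_degree m \<phi>" and m: "0 < m" "even m \<or> p = 2"
    and E: "graded_subspace E"
    and mult: "\<And>i j v v'. v \<in> E i \<Longrightarrow> v' \<in> E j \<Longrightarrow> 0 < i \<Longrightarrow> 0 < j \<Longrightarrow> \<phi> (v * v') = 0"
    and x: "\<Delta> x \<in> htensor G E m" and f: "\<Delta> f \<in> htensor G E n"
  shows "D \<phi> (x * f) = x * D \<phi> f + \<phi> x *s f"
proof -
  note sl = additive_slice[OF \<phi>(1)] additive_slice[OF functional_counit]
  note gE = graded_subspaceD[OF E]
  have xE: "x \<in> E m" and xlow: "\<Delta> x - 1 \<otimes>\<^sub>t x \<in> htensor G (truncate m E) m"
    using comult_minus_top[OF E x] by simp_all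
  have sign: "(-1) ^ (m * k) = (1 :: 'a)" for k
  proof (cases "p = 2")
    case True
    then have "(of_nat 2 :: 'k) *s (1 :: 'a) = 0" using of_nat_eq_0_iff[of 2] by simp
    then have "(1 + 1 :: 'k) *s (1 :: 'a) = 0" by (simp add: numeral_2_eq_2)
    then have "(1 :: 'a) + 1 = 0" by (simp only: scale_left_distrib scale_one)
    then have "- 1 = (1 :: 'a)" by (rule minus_unique)
    then show ?thesis by simp
  qed (use m in simp)
  have "slice \<phi> (tensor_mult G (1 \<otimes>\<^sub>t x) t) = \<phi> x *s slice \<epsilon> t" if "t \<in> htensor G E n" for t
    using that
  proof (induction rule: htensor_induct)
    case (tensor u v i j)
    have "\<phi> (x * v) = \<phi> x * \<epsilon> v"
    proof (cases "j = 0")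
      case True
      then have "v \<in> G 0" using gE(2) tensor by blast
      then have "x * v = \<epsilon> v *s x" by (rule G_0_mult(2))
      then show ?thesis using functionalD(2)[OF \<phi>(1)] by (simp add: mult.commute)
    next
      case False
      then have "\<epsilon> v = 0" using counit_degree gE(2) tensor by blast
      then show ?thesis using False mult[OF xE, of v j] m(1) tensor by simp
    qed
    then show ?case using tensor gE(2)[OF xE]
      by (simp add: tensor_mult_homogeneous slice_tensor[OF \<phi>(1)] slice_tensor[OF functional_counit] sign)
  next
    case zero
    show ?case by (simp add: additive.zero[OF additive_tensor_mult_right] additive.zero[OF sl(1)]
      additive.zero[OF sl(2)])
  next
    case (diff s t)
    then show ?case by (simp add: additive.diff[OF additive_tensor_mult_right] additive.diff[OF sl(1)]
        additive.diff[OF sl(2)] scale_right_diff_distrib)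
  qed
  from this[OF f] have 1: "slice \<phi> (tensor_mult G (1 \<otimes>\<^sub>t x) (\<Delta> f)) = \<phi> x *s f"
    using D_counit[of f] unfolding D_def by simp
  have low_mult: "\<phi> (v * v') = \<epsilon> v * \<phi> v'" if v: "v \<in> truncate m E i" and v': "v' \<in> E j" for i j v v'
  proof (cases "i < m")
    case False
    then show ?thesis using v functionalD(3)[OF \<phi>(1)] functionalD(3)[OF functional_counit]
      by (simp add: truncate_def)
  next
    case True
    then have vE: "v \<in> E i" using v by (simp add: truncate_def)
    consider "i = 0" | "0 < i" "j = 0" | "0 < i" "0 < j" by blast
    then show ?thesis
    proof cases
      case 1
      then have "v \<in> G 0" using gE(2) vE by blast
      then have "v * v' = \<epsilon> v *s v'" by (rule G_0_mult(1))
      then show ?thesis using functionalD(2)[OF \<phi>(1)] by simp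
    next
      case 2
      then have "v' \<in> G 0" using gE(2) v' by blast
      then have "v * v' = \<epsilon> v' *s v" by (rule G_0_mult(2))
      moreover have "\<phi> v = 0" using \<phi>(2) gE(2)[OF vE] True unfolding of_degree_def by (metis less_not_refl)
      moreover have "\<epsilon> v = 0" using counit_degree[OF gE(2)[OF vE]] 2 by simp
      ultimately show ?thesis using functionalD(2)[OF \<phi>(1)] by simp
    next
      case 3
      then show ?thesis using mult[OF vE v'] counit_degree[OF gE(2)[OF vE]] by simp
    qed
  qed
  have tG: "truncate m E \<le> G" using gE(2) by (auto simp: truncate_def le_fun_def)
  have "\<epsilon> x = 0" using counit_degree[OF gE(2)[OF xE] m(1)] .
  then have "slice \<epsilon> (\<Delta> x - 1 \<otimes>\<^sub>t x) = x"
    using D_counit[of x] unfolding D_def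
    by (simp add: additive.diff[OF sl(2)] slice_tensor[OF functional_counit])
  then have 2: "slice \<phi> (tensor_mult G (\<Delta> x - 1 \<otimes>\<^sub>t x) (\<Delta> f)) = x * D \<phi> f"
    using slice_tensor_mult[OF \<phi>(1) tG low_mult xlow f] unfolding D_def by simp
  have "tensor_mult G (\<Delta> x) (\<Delta> f) =
    tensor_mult G (\<Delta> x - 1 \<otimes>\<^sub>t x) (\<Delta> f) + tensor_mult G (1 \<otimes>\<^sub>t x) (\<Delta> f)"
    by (simp add: additive.diff[OF additive_tensor_mult_left])
  then show ?thesis using 1 2 unfolding D_def comult_mult by (simp add: additive.add[OF sl(1)])
qed

section \<open>Generated subalgebras\<close>

inductive generated :: "(nat \<Rightarrow> 'a set) \<Rightarrow> nat \<Rightarrow> 'a \<Rightarrow> bool" for X where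
  base: "x \<in> X n \<Longrightarrow> generated X n x"
| one: "generated X 0 1"
| zero: "generated X n 0"
| add: "generated X n x \<Longrightarrow> generated X n y \<Longrightarrow> generated X n (x + y)"
| scale: "generated X n x \<Longrightarrow> generated X n (c *s x)"
| mult: "generated X m x \<Longrightarrow> generated X n y \<Longrightarrow> generated X (m + n) (x * y)"

definition gen :: "(nat \<Rightarrow> 'a set) \<Rightarrow> nat \<Rightarrow> 'a set" where
  "gen X n = {x. generated X n x}"

lemma subset_gen: "X \<le> gen X"
  unfolding gen_def le_fun_def using generated.base by blast

lemma gen_least:
  assumes "graded_subalgebra A" "X \<le> A"
  shows "gen X \<le> A"
proof -
  have "x \<in> A n" if "generated X n x" for n x
    using that
    by induction (use assms in \<open>auto simp: le_fun_def graded_subalgebraD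
      graded_subspaceD[OF graded_subalgebraD(1)]\<close>)
  then show ?thesis unfolding gen_def le_fun_def by blast
qed

lemma graded_subalgebra_gen:
  assumes "X \<le> G"
  shows "graded_subalgebra (gen X)"
proof -
  have "gen X \<le> G" by (rule gen_least[OF graded_subalgebra_G assms])
  moreover have "subspace (gen X n)" for n
    unfolding subspace_def gen_def by (auto intro: generated.intros)
  ultimately show ?thesis
    unfolding graded_subalgebra_def graded_subspace_def
    by (auto simp: le_fun_def gen_def intro: generated.intros)
qed

lemma gen_mono: "X \<le> X' \<Longrightarrow> X' \<le> G \<Longrightarrow> gen X \<le> gen X'"
  by (rule gen_least[OF graded_subalgebra_gen]) (auto intro: order_trans[OF _ subset_gen])

lemma comult_scale_in_htensor:
  assumes "\<Delta> x \<in> htensor X Y n"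
  shows "\<Delta> (c *s x) \<in> htensor X Y n"
proof -
  obtain k where c: "c = of_nat k" using prime_field_of_nat[where 'k = 'k] prime_p card_k by metis
  have "\<Delta> (of_nat k *s x) \<in> htensor X Y n"
    by (induction k) (use assms in \<open>simp_all add: \<Delta>.zero \<Delta>.add scale_left_distrib htensor_zero htensor_add\<close>)
  then show ?thesis using c by simp
qed

lemma coideal_gen:
  assumes X: "X \<le> G" and \<Delta>X: "\<And>n x. x \<in> X n \<Longrightarrow> \<Delta> x \<in> htensor G (gen X) n"
  shows "coideal (gen X)"
proof -
  have "\<Delta> x \<in> htensor G (gen X) n" if "generated X n x" for n x
    using that
  proof induction
    case one
    show ?case unfolding comult_one
      by (rule htensor_base[of _ _ 0 _ _ 0]) (simp_all add: one_in_G gen_def generated.one)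
  next
    case (mult m x n y)
    then show ?case unfolding comult_mult
      by (intro tensor_mult_in_htensor graded_subalgebra_G graded_subalgebra_gen[OF X])
  qed (simp_all add: \<Delta>X \<Delta>.zero \<Delta>.add htensor_zero htensor_add comult_scale_in_htensor)
  then show ?thesis unfolding coideal_def gen_def by blast
qed

definition decomposables :: "(nat \<Rightarrow> 'a set) \<Rightarrow> nat \<Rightarrow> 'a set" where
  "decomposables Y n = span {u * v |u v. \<exists>i j. 0 < i \<and> 0 < j \<and> i + j = n \<and> u \<in> Y i \<and> v \<in> Y j}"

section \<open>Decomposable elements that are primitive modulo a subalgebra\<close>

text \<open>
  Zorn's lemma, applied to the graphs of the families.
\<close>

lemma maximal_coideal_subalgebra:
  assumes A: "graded_subalgebra A" "coideal A" and c: "c \<notin> A d"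
  shows "\<exists>B. graded_subalgebra B \<and> coideal B \<and> A \<le> B \<and> c \<notin> B d \<and>
    (\<forall>B'. graded_subalgebra B' \<longrightarrow> coideal B' \<longrightarrow> B \<le> B' \<longrightarrow> c \<notin> B' d \<longrightarrow> B' \<le> B)"
proof -
  define fam where "fam H n = {x. (n, x) \<in> H}" for H :: "(nat \<times> 'a) set" and n
  define graph where "graph B = {(n, x). x \<in> B n}" for B :: "nat \<Rightarrow> 'a set"
  have fam_graph [simp]: "fam (graph B) = B" for B by (auto simp: fam_def graph_def)
  have graph_fam [simp]: "graph (fam H) = H" for H by (auto simp: fam_def graph_def)
  have graph_mono: "graph B \<subseteq> graph B' \<longleftrightarrow> B \<le> B'" for B B'
    by (auto simp: graph_def le_fun_def)
  define ok where "ok B \<longleftrightarrow> graded_subalgebra B \<and> coideal B \<and> A \<le> B \<and> c \<notin> B d" for B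
  have "\<exists>M\<in>graph ` Collect ok. \<forall>H\<in>graph ` Collect ok. M \<subseteq> H \<longrightarrow> H = M"
  proof (rule subset_Zorn_nonempty)
    show "graph ` Collect ok \<noteq> {}" using A c unfolding ok_def by auto
  next
    fix \<C> assume ne: "\<C> \<noteq> {}" and ch: "subset.chain (graph ` Collect ok) \<C>"
    let ?U = "fam (\<Union>\<C>)"
    have okH: "ok (fam H)" if "H \<in> \<C>" for H
      using that ch unfolding subset.chain_def by auto
    have lin: "H \<subseteq> H' \<or> H' \<subseteq> H" if "H \<in> \<C>" "H' \<in> \<C>" for H H'
      using that ch unfolding subset.chain_def by auto
    have sub: "fam H \<le> ?U" if "H \<in> \<C>" for H using that by (auto simp: fam_def le_fun_def)
    have two: "\<exists>H\<in>\<C>. x \<in> fam H m \<and> y \<in> fam H n" if "x \<in> ?U m" "y \<in> ?U n" for x y m n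
    proof -
      obtain H H' where *: "H \<in> \<C>" "(m, x) \<in> H" "H' \<in> \<C>" "(n, y) \<in> H'"
        using \<open>x \<in> ?U m\<close> \<open>y \<in> ?U n\<close> by (auto simp: fam_def)
      then show ?thesis using lin[OF *(1,3)] unfolding fam_def by blast
    qed
    obtain H0 where H0: "H0 \<in> \<C>" using ne by blast
    note a0 = okH[OF H0, unfolded ok_def]
    have "graded_subalgebra ?U"
      unfolding graded_subalgebra_def graded_subspace_def subspace_def
    proof (intro conjI allI ballI subsetI)
      show "0 \<in> ?U n" for n
        using sub[OF H0] a0 graded_subspaceD(3)[OF graded_subalgebraD(1)] by (auto simp: le_fun_def)
      show "1 \<in> ?U 0" using sub[OF H0] a0 graded_subalgebraD(2) by (auto simp: le_fun_def)
    next
      fix n x y assume "x \<in> ?U n" "y \<in> ?U n"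
      then obtain H where H: "H \<in> \<C>" "x \<in> fam H n" "y \<in> fam H n" using two by blast
      then have "x + y \<in> fam H n"
        using okH[OF H(1)] graded_subspaceD(4)[OF graded_subalgebraD(1)] unfolding ok_def by blast
      then show "x + y \<in> ?U n" using sub[OF H(1)] by (auto simp: le_fun_def)
    next
      fix n x b assume "x \<in> ?U n"
      then obtain H where H: "H \<in> \<C>" "x \<in> fam H n" using two by blast
      then have "b *s x \<in> fam H n"
        using okH[OF H(1)] graded_subspaceD(6)[OF graded_subalgebraD(1)] unfolding ok_def by blast
      then show "b *s x \<in> ?U n" using sub[OF H(1)] by (auto simp: le_fun_def)
    next
      fix n x assume "x \<in> ?U n"
      then obtain H where H: "H \<in> \<C>" "x \<in> fam H n" using two by blast
      then show "x \<in> G n"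
        using okH[OF H(1)] graded_subspaceD(2)[OF graded_subalgebraD(1)] unfolding ok_def by blast
    next
      fix m n x y assume "x \<in> ?U m" "y \<in> ?U n"
      then obtain H where H: "H \<in> \<C>" "x \<in> fam H m" "y \<in> fam H n" using two by blast
      then have "x * y \<in> fam H (m + n)"
        using okH[OF H(1)] graded_subalgebraD(3) unfolding ok_def by blast
      then show "x * y \<in> ?U (m + n)" using sub[OF H(1)] by (auto simp: le_fun_def)
    qed
    moreover have "coideal ?U"
      unfolding coideal_def
    proof (intro allI ballI)
      fix n x assume "x \<in> ?U n"
      then obtain H where H: "H \<in> \<C>" "x \<in> fam H n" using two by blast
      then have "\<Delta> x \<in> htensor G (fam H) n" using okH[OF H(1)] unfolding ok_def coideal_def by blast
      then show "\<Delta> x \<in> htensor G ?U n" by (rule htensor_mono[OF _ order_refl sub[OF H(1)]])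
    qed
    moreover have "A \<le> ?U" using a0 sub[OF H0] by (auto intro: order_trans)
    moreover have "c \<notin> ?U d" using okH unfolding ok_def fam_def by blast
    ultimately have "ok ?U" unfolding ok_def by blast
    then have "graph ?U \<in> graph ` Collect ok" by blast
    then show "\<Union>\<C> \<in> graph ` Collect ok" by simp
  qed
  then obtain B where B: "ok B" and max: "\<And>B'. ok B' \<Longrightarrow> graph B \<subseteq> graph B' \<Longrightarrow> graph B' = graph B" by blast
  have "B' \<le> B" if B': "graded_subalgebra B'" "coideal B'" "B \<le> B'" "c \<notin> B' d" for B'
  proof -
    from B' have "ok B'" using B order_trans[of A B B'] unfolding ok_def by blast
    then have "graph B' = graph B" using max B' graph_mono by blast
    then show "B' \<le> B" using graph_mono by blast
  qed
  then show ?thesis using B unfolding ok_def by blast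
qed

text \<open>
  Graded commutativity moves the powers of \<open>x\<close> to the right, and \<open>x\<^sup>N\<close> is absorbed into the coefficients.
\<close>

lemma generated_adjoin_one:
  assumes B: "graded_subalgebra B" and x: "x \<in> G m" and N: "0 < N" "x ^ N \<in> B (m * N)"
    and f: "f \<in> gen (\<lambda>n. B n \<union> (if n = m then {x} else {})) n"
  obtains b where "\<And>j. j < N \<Longrightarrow> b j = 0 \<or> (\<exists>k. b j \<in> B k \<and> k + j * m = n)"
    and "f = (\<Sum>j<N. b j * x ^ j)"
proof -
  note gB = graded_subspaceD[OF graded_subalgebraD(1)[OF B]]
  define R where "R n = span {b * x ^ j |b j. \<exists>k. b \<in> B k \<and> k + j * m = n}" for n
  have R_base: "b * x ^ j \<in> R (k + j * m)" if "b \<in> B k" for b j k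
    unfolding R_def using that by (intro span_base) blast
  have xG: "x ^ j \<in> G (j * m)" for j using power_in_G[OF x, of j] by (simp add: mult.commute)
  have RG: "R n \<subseteq> G n" for n
    unfolding R_def by (rule span_minimal[OF _ subspace_G]) (use gB(2) mult_in_G xG in auto)
  have "graded_subalgebra R"
    unfolding graded_subalgebra_def graded_subspace_def
  proof (intro conjI allI ballI)
    show "R n \<subseteq> G n" for n by (rule RG)
    show "subspace (R n)" for n unfolding R_def by (rule subspace_span)
    show "1 \<in> R 0" using R_base[OF graded_subalgebraD(2)[OF B], of 0] by simp
    fix n n' y y' assume y: "y \<in> R n" "y' \<in> R n'"
    have sub: "subspace (R k)" for k unfolding R_def by (rule subspace_span)
    have "b * x ^ j * y' \<in> R (n + n')" if "b \<in> B k" "k + j * m = n" for b j k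
      using y(2) unfolding R_def[of n']
    proof (induction rule: span_induct_alt)
      case base
      show ?case using subspace_0[OF sub] by simp
    next
      case (step c z z')
      then obtain b' j' k' where z: "z = b' * x ^ j'" "b' \<in> B k'" "k' + j' * m = n'" by blast
      have eq: "k + k' + (j + j') * m = n + n'" using that z by (simp add: algebra_simps)
      have "b * (x ^ j * b') * x ^ j' \<in> R (n + n')"
      proof -
        have "x ^ j * b' = (-1) ^ (j * m * k') * (b' * x ^ j)" by (rule graded_commute[OF xG gB(2)[OF z(2)]])
        moreover have "b * ((-1) ^ (j * m * k') * (b' * x ^ j)) * x ^ j'
          = (-1) ^ (j * m * k') * (b * b' * x ^ (j + j'))"
          by (cases "even (j * m * k')") (simp_all add: power_add mult.assoc)
        moreover have "(-1) ^ (j * m * k') * (b * b' * x ^ (j + j')) \<in> R (n + n')"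
          using minus_one_power_mult_in[OF sub]
            R_base[OF graded_subalgebraD(3)[OF B that(1) z(2)], of "j + j'"] eq by simp
        ultimately show ?thesis by simp
      qed
      then have "c *s (b * x ^ j * z) \<in> R (n + n')"
        unfolding z(1) by (intro subspace_scale[OF sub]) (simp add: mult.assoc)
      then show ?case
        using subspace_add[OF sub _ step(2)] by (simp add: distrib_left scale_mult_right)
    qed
    note mono = this
    show "y * y' \<in> R (n + n')"
      using y(1) unfolding R_def[of n]
    proof (induction rule: span_induct_alt)
      case base
      show ?case using subspace_0[OF sub] by simp
    next
      case (step c z z')
      then obtain b j k where z: "z = b * x ^ j" "b \<in> B k" "k + j * m = n" by blast
      have "c *s (z * y') \<in> R (n + n')" unfolding z(1) by (intro subspace_scale[OF sub] mono[OF z(2,3)])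
      then show ?case
        using subspace_add[OF sub _ step(2)] by (simp add: distrib_right scale_mult_left)
    qed
  qed
  moreover have BR: "(\<lambda>n. B n \<union> (if n = m then {x} else {})) \<le> R"
    using R_base[of _ _ 0] R_base[OF graded_subalgebraD(2)[OF B], of 1] by (auto simp: le_fun_def)
  ultimately have "f \<in> R n" using le_funD[OF gen_least, of R _ n] f by blast
  then have "\<exists>b. (\<forall>j<N. b j = 0 \<or> (\<exists>k. b j \<in> B k \<and> k + j * m = n)) \<and> f = (\<Sum>j<N. b j * x ^ j)"
    unfolding R_def
  proof (induction rule: span_induct_alt)
    case base
    show ?case by (rule exI[of _ "\<lambda>_. 0"]) simp
  next
    case (step c z z')
    then obtain b j k b' where z: "z = b * x ^ j" "b \<in> B k" "k + j * m = n"
      and b': "\<forall>j<N. b' j = 0 \<or> (\<exists>k. b' j \<in> B k \<and> k + j * m = n)" "z' = (\<Sum>j<N. b' j * x ^ j)" by blast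
    let ?r = "j mod N" and ?q = "j div N"
    have "(x ^ N) ^ i \<in> B (i * (m * N))" for i
      by (induction i) (use N graded_subalgebraD(2,3)[OF B] in auto)
    then have bq: "b * (x ^ N) ^ ?q \<in> B (k + ?q * (m * N))" using graded_subalgebraD(3)[OF B z(2)] by blast
    have j: "j = N * ?q + ?r" by simp
    have deg: "k + ?q * (m * N) + ?r * m = n"
    proof -
      have "j * m = ?q * (m * N) + ?r * m"
        using arg_cong[OF j, of "\<lambda>i. i * m"] by (simp only: distrib_left distrib_right mult_ac)
      then show ?thesis using z(3) by linarith
    qed
    have "x ^ j = (x ^ N) ^ ?q * x ^ ?r" unfolding power_mult[symmetric] power_add[symmetric] by simp
    then have "c *s z + z' = (\<Sum>j<N. ((if j = ?r then c *s (b * (x ^ N) ^ ?q) else 0) + b' j) * x ^ j)"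
      using N(1) by (simp add: z(1) b'(2) distrib_right sum.distrib if_distrib[of "\<lambda>y. y * _"]
          scale_mult_left mult.assoc cong: if_cong)
    moreover have "(if i = ?r then c *s (b * (x ^ N) ^ ?q) else 0) + b' i = 0 \<or>
      (\<exists>k. (if i = ?r then c *s (b * (x ^ N) ^ ?q) else 0) + b' i \<in> B k \<and> k + i * m = n)" if "i < N" for i
    proof (cases "i = ?r")
      case True
      have "c *s (b * (x ^ N) ^ ?q) \<in> B (k + ?q * (m * N))" by (rule gB(6)[OF bq])
      moreover have "b' i \<in> B (k + ?q * (m * N))"
      proof -
        consider "b' i = 0" | k' where "b' i \<in> B k'" "k' + i * m = n" using b'(1) \<open>i < N\<close> by blast
        then show ?thesis
        proof cases
          case 2
          then have "k' = k + ?q * (m * N)" using deg True by simp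
          then show ?thesis using 2 by simp
        qed (simp add: gB(3))
      qed
      ultimately have "c *s (b * (x ^ N) ^ ?q) + b' i \<in> B (k + ?q * (m * N))" by (rule gB(4))
      then show ?thesis using deg True by auto
    qed (use b'(1) that in simp)
    ultimately show ?case by (intro exI conjI allI impI)
  qed
  then show thesis using that by blast
qed

lemma decomposables_subset:
  assumes B: "graded_subalgebra B" and Y: "\<And>j. j < n \<Longrightarrow> Y j \<subseteq> B j"
  shows "decomposables Y n \<subseteq> B n"
  unfolding decomposables_def
proof (rule span_minimal[OF _ graded_subspaceD(1)[OF graded_subalgebraD(1)[OF B]]], clarify)
  fix u v i j assume *: "0 < i" "0 < j" "n = i + j" "u \<in> Y i" "v \<in> Y j"
  then have "u \<in> B i" "v \<in> B j" using Y[of i] Y[of j] by auto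
  then show "u * v \<in> B (i + j)" by (rule graded_subalgebraD(3)[OF B])
qed

lemma htensor_one: "x \<in> Y n \<Longrightarrow> 1 \<otimes>\<^sub>t x \<in> htensor G Y n"
  by (rule htensor_base[of _ _ 0 _ _ n]) (simp_all add: one_in_G)

definition bicoideal :: "(nat \<Rightarrow> 'a set) \<Rightarrow> bool" where
  "bicoideal Y \<longleftrightarrow> (\<forall>n. \<forall>x\<in>Y n. \<Delta> x \<in> htensor Y Y n)"

lemma scalar_in_subalgebra:
  assumes B: "graded_subalgebra B" and "x \<in> G 0"
  shows "x \<in> B 0"
  using G_0_cases[OF assms(2)] graded_subspaceD(6)[OF graded_subalgebraD(1)[OF B] graded_subalgebraD(2)[OF B]]
  by metis

text \<open>
  Choose \<open>B\<close> maximal among the coideal subalgebras containing \<open>A\<close> but not \<open>c\<close>, and \<open>x \<in> Y\<close> of least degree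
  outside \<open>B\<close>. Then \<open>B[x]\<close> contains \<open>c\<close> by maximality, and its elements are polynomials in \<open>x\<close> over \<open>B\<close> of degree
  less than \<open>p\<close>, as \<open>x\<^sup>p\<close> lies in \<open>A\<close>. A functional \<open>\<phi>\<close> with \<open>\<phi> x = 1\<close> that vanishes on \<open>B\<close> acts on \<open>B[x]\<close> as
  differentiation by \<open>x\<close>; since \<open>\<phi>\<close> vanishes on decomposables, it kills \<open>c\<close>, so that \<open>c\<close> has degree \<open>0\<close> in \<open>x\<close>
  and lies in \<open>B\<close>.
\<close>

theorem decomposable_primitive_in_subalgebra:
  assumes Y: "graded_subalgebra Y" "bicoideal Y"
    and A: "graded_subalgebra A" "coideal A"
    and power: "\<And>n x. x \<in> Y n \<Longrightarrow> x ^ p \<in> A (n * p)"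
    and c: "c \<in> Y d" "c \<in> decomposables Y d" "\<Delta> c - 1 \<otimes>\<^sub>t c \<in> htensor G A d"
  shows "c \<in> A d"
proof (rule ccontr)
  assume "c \<notin> A d"
  from maximal_coideal_subalgebra[OF A this] obtain B where B: "graded_subalgebra B" "coideal B" and AB: "A \<le> B" and cB: "c \<notin> B d"
    and max: "\<And>B'. graded_subalgebra B' \<Longrightarrow> coideal B' \<Longrightarrow> B \<le> B' \<Longrightarrow> c \<notin> B' d \<Longrightarrow> B' \<le> B"
    by auto
  note gB = graded_subspaceD[OF graded_subalgebraD(1)[OF B(1)]]
  note gY = graded_subspaceD[OF graded_subalgebraD(1)[OF Y(1)]]
  have BG: "B \<le> G" and YG: "Y \<le> G" using gB(2) gY(2) by (auto simp: le_fun_def)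
  define m where "m = (LEAST j. \<not> Y j \<subseteq> B j)"
  have ex: "\<not> Y d \<subseteq> B d" using c(1) cB by blast
  then have mx: "\<not> Y m \<subseteq> B m" unfolding m_def by (rule LeastI)
  have YB: "Y j \<subseteq> B j" if "j < m" for j using not_less_Least[of j "\<lambda>j. \<not> Y j \<subseteq> B j"] that m_def by simp
  have "m \<le> d" unfolding m_def using ex by (rule Least_le)
  from mx obtain x where x: "x \<in> Y m" "x \<notin> B m" by blast
  have xG: "x \<in> G m" using gY(2) x(1) .
  have "0 < m"
  proof (rule ccontr)
    assume "\<not> 0 < m"
    then show False using x scalar_in_subalgebra[OF B(1)] xG by simp
  qed
  define X where "X = (\<lambda>n. B n \<union> (if n = m then {x} else {}))"
  define E where "E = gen X"
  have XG: "X \<le> G" unfolding X_def using BG xG by (auto simp: le_fun_def)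
  have E: "graded_subalgebra E" unfolding E_def by (rule graded_subalgebra_gen[OF XG])
  have XE: "X \<le> E" unfolding E_def by (rule subset_gen)
  then have BE: "B \<le> E" unfolding X_def le_fun_def by auto
  have xE: "x \<in> E m" using le_funD[OF XE, of m] unfolding X_def by simp
  note gE = graded_subspaceD[OF graded_subalgebraD(1)[OF E]]
  have "\<Delta> x \<in> htensor G Y m"
    using Y(2) x(1) htensor_mono[OF _ YG order_refl] unfolding bicoideal_def by blast
  from comult_minus_top(1)[OF graded_subalgebraD(1)[OF Y(1)] this]
  have "\<Delta> x - 1 \<otimes>\<^sub>t x \<in> htensor G E m"
  proof (rule htensor_mono[OF _ order_refl])
    show "truncate m Y \<le> E"
      using YB BE gE(3) unfolding truncate_def le_fun_def by auto
  qed
  moreover have "1 \<otimes>\<^sub>t x \<in> htensor G E m" by (rule htensor_one) (rule xE)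
  ultimately have "\<Delta> x - 1 \<otimes>\<^sub>t x + 1 \<otimes>\<^sub>t x \<in> htensor G E m" by (rule htensor_add)
  then have \<Delta>x: "\<Delta> x \<in> htensor G E m" by simp
  have "coideal E"
    unfolding E_def
  proof (rule coideal_gen[OF XG])
    fix n y assume "y \<in> X n"
    then consider "y \<in> B n" | "n = m" "y = x" unfolding X_def by (auto split: if_splits)
    then show "\<Delta> y \<in> htensor G (gen X) n"
    proof cases
      case 1
      then have "\<Delta> y \<in> htensor G B n" using B(2) unfolding coideal_def by blast
      then show ?thesis using BE htensor_mono[OF _ order_refl] unfolding E_def by blast
    next
      case 2
      then show ?thesis using \<Delta>x unfolding E_def by simp
    qed
  qed
  then have \<Delta>E: "\<Delta> y \<in> htensor G E n" if "y \<in> E n" for y n using that unfolding coideal_def by blast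
  have "c \<in> E d"
  proof (rule ccontr)
    assume "c \<notin> E d"
    from max[OF E \<open>coideal E\<close> BE this] have "E m \<subseteq> B m" by (auto simp: le_fun_def)
    then show False using x(2) xE by blast
  qed
  \<comment> \<open>If x has odd degree and p is odd, then x * x = 0, and no derivation property is needed.\<close>
  define N where "N = (if odd m \<and> p \<noteq> 2 then 2 else p)"
  have N: "0 < N" "N \<le> p" using p_ge_2 unfolding N_def by auto
  have xN: "x ^ N \<in> B (m * N)"
  proof (cases "odd m \<and> p \<noteq> 2")
    case True
    then have "x ^ N = 0" unfolding N_def using odd_square_zero[OF xG] by (simp add: power2_eq_square)
    then show ?thesis using gB(3) by simp
  next
    case False
    then have "N = p" unfolding N_def by auto
    then show ?thesis using power[OF x(1)] AB by (auto simp: le_fun_def)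
  qed
  have low: "E i \<subseteq> B i" if "i < m" for i
  proof
    fix f assume "f \<in> E i"
    then obtain b where b: "\<And>j. j < N \<Longrightarrow> b j = 0 \<or> (\<exists>k. b j \<in> B k \<and> k + j * m = i)"
      and f: "f = (\<Sum>j<N. b j * x ^ j)"
      unfolding E_def X_def using generated_adjoin_one[OF B(1) xG N(1) xN] by blast
    have "b j * x ^ j = (if j = 0 then b 0 else 0)" if "j < N" for j
    proof (cases "j = 0")
      case False
      then have "m \<le> j * m" by simp
      then have "k + j * m \<noteq> i" for k using \<open>i < m\<close> by linarith
      then have "b j = 0" using b[OF that] by blast
      then show ?thesis using False by simp
    qed simp
    then have "f = (\<Sum>j<N. if j = 0 then b 0 else 0)" unfolding f by (intro sum.cong) auto
    then have "f = b 0" using N(1) by simp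
    then show "f \<in> B i" using b[of 0] N(1) gB(3) by auto
  qed
  obtain \<phi> where \<phi>: "functional \<phi>" "of_degree m \<phi>" and \<phi>B: "\<And>v. v \<in> B m \<Longrightarrow> \<phi> v = 0" and \<phi>x: "\<phi> x = 1"
    using functional_vanishing_on[of "B m" m x] gB(1,2) xG x(2) by blast
  have \<phi>_B: "\<phi> v = 0" if "v \<in> B i" for v i
    using \<phi>B \<phi>(2) gB(2) that unfolding of_degree_def by (cases "i = m") auto
  have \<phi>_dec: "\<phi> (v * v') = 0" if "v \<in> E i" "v' \<in> E j" "0 < i" "0 < j" for v v' i j
  proof (cases "i + j = m")
    case True
    then have "v \<in> B i" "v' \<in> B j" using that low[of i] low[of j] by auto
    then show ?thesis using \<phi>_B graded_subalgebraD(3)[OF B(1)] by blast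
  next
    case False
    then show ?thesis using \<phi>(2) gE(2) that mult_in_G unfolding of_degree_def by blast
  qed
  have \<phi>_mult: "\<phi> (v * v') = \<epsilon> v * \<phi> v'" if v: "v \<in> B i" and v': "v' \<in> E j" for v v' i j
  proof -
    consider "i = 0" | "0 < i" "j = 0" | "0 < i" "0 < j" by blast
    then show ?thesis
    proof cases
      case 1
      then have "v \<in> G 0" using gB(2) v by blast
      then have "v * v' = \<epsilon> v *s v'" by (rule G_0_mult(1))
      then show ?thesis using functionalD(2)[OF \<phi>(1)] by simp
    next
      case 2
      then have "v' \<in> G 0" using gE(2) v' by blast
      then have "v * v' = \<epsilon> v' *s v" by (rule G_0_mult(2))
      then have "\<phi> (v * v') = 0" using functionalD(2)[OF \<phi>(1)] \<phi>_B[OF v] by simp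
      moreover have "\<epsilon> v = 0" using counit_degree[OF gB(2)[OF v]] 2 by simp
      ultimately show ?thesis by simp
    next
      case 3
      then have "v \<in> E i" using BE v by (auto simp: le_fun_def)
      then show ?thesis using \<phi>_dec[OF _ v'] 3 counit_degree[OF gB(2)[OF v]] by simp
    qed
  qed
  note D = additive_D[OF \<phi>(1)]
  have x_power: "x ^ j \<in> E (m * j)" for j
    by (induction j) (use graded_subalgebraD(2,3)[OF E] xE in auto)
  have D_one: "D \<phi> 1 = 0"
    unfolding D_def comult_one slice_tensor[OF \<phi>(1)] using \<phi>_B[OF graded_subalgebraD(2)[OF B(1)]] by simp
  have D_power: "D \<phi> (x ^ j) = of_nat j * x ^ (j - 1)" if "j < N" for j
  proof (cases "odd m \<and> p \<noteq> 2")
    case True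
    then have "j = 0 \<or> j = 1" using that unfolding N_def by auto
    then show ?thesis using D_one D_top_degree[OF \<phi> xG] \<phi>x by auto
  next
    case False
    then have "even m \<or> p = 2" by blast
    note der = D_derivation[OF \<phi> \<open>0 < m\<close> this graded_subalgebraD(1)[OF E] \<phi>_dec \<Delta>x]
    show ?thesis
    proof (induction j)
      case (Suc j)
      have "D \<phi> (x * x ^ j) = x * D \<phi> (x ^ j) + x ^ j"
        using der[OF _ _ _ _ \<Delta>E[OF x_power[of j]]] \<phi>x by simp
      also have "\<dots> = x * (of_nat j * x ^ (j - 1)) + x ^ j" using Suc by simp
      also have "x * (of_nat j * x ^ (j - 1)) = of_nat j * x ^ j"
        unfolding of_nat_mult_eq_scale scale_mult_right[symmetric] by (cases j) simp_all
      finally show ?case by (simp add: distrib_right add_ac)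
    qed (simp add: D_one)
  qed
  have D_mono: "D \<phi> (b * x ^ j) = b * (of_nat j * x ^ (j - 1))" if "b \<in> B k" "j < N" for b k j
  proof -
    have \<Delta>b: "\<Delta> b \<in> htensor G B k" using B(2) that(1) unfolding coideal_def by blast
    have "D \<phi> (b * x ^ j) = b * D \<phi> (x ^ j)"
      by (rule D_mult_left[where E = E, OF \<phi>(1) graded_subalgebraD(1)[OF B(1)] _ \<Delta>b \<Delta>E[OF x_power]])
        (rule \<phi>_mult)
    then show ?thesis using D_power[OF that(2)] by simp
  qed
  have D_poly: "D \<phi> (\<Sum>j<J. b j * x ^ j) = (\<Sum>j<J - 1. (of_nat (Suc j) *s b (Suc j)) * x ^ j)"
    if b: "\<And>j. j < J \<Longrightarrow> \<exists>k. b j \<in> B k" and J: "J \<le> N" for J b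
  proof -
    have "D \<phi> (\<Sum>j<J. b j * x ^ j) = (\<Sum>j<J. D \<phi> (b j * x ^ j))"
      by (induction J) (simp_all add: additive.zero[OF D] additive.add[OF D])
    also have "\<dots> = (\<Sum>j<J. b j * (of_nat j * x ^ (j - 1)))"
    proof (rule sum.cong[OF refl])
      fix j assume "j \<in> {..<J}"
      then obtain k where "b j \<in> B k" "j < N" using b[of j] J by auto
      then show "D \<phi> (b j * x ^ j) = b j * (of_nat j * x ^ (j - 1))" by (rule D_mono)
    qed
    also have "\<dots> = (\<Sum>j<J - 1. (of_nat (Suc j) *s b (Suc j)) * x ^ j)"
    proof (cases J)
      case (Suc J')
      have "b (Suc j) * (of_nat (Suc j) * x ^ j) = (of_nat (Suc j) *s b (Suc j)) * x ^ j" for j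
        by (simp only: of_nat_mult_eq_scale scale_mult_left[symmetric] scale_mult_right[symmetric])
      then show ?thesis unfolding Suc sum.lessThan_Suc_shift by simp
    qed simp
    finally show ?thesis .
  qed
  have scale_0: "y = 0" if "of_nat (Suc j) *s y = 0" "Suc j < p" for j y
    using that of_nat_eq_0_iff[of "Suc j"] by (auto dest: dvd_imp_le)
  have indep: "\<forall>j<J. b j = 0"
    if "\<And>j. j < J \<Longrightarrow> \<exists>k. b j \<in> B k" "J \<le> N" "(\<Sum>j<J. b j * x ^ j) = 0" for J b
    using that
  proof (induction J arbitrary: b)
    case (Suc J)
    have "\<forall>j<J. of_nat (Suc j) *s b (Suc j) = 0"
    proof (rule Suc.IH)
      show "\<exists>k. of_nat (Suc j) *s b (Suc j) \<in> B k" if "j < J" for j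
        using Suc.prems(1)[of "Suc j"] that gB(6) by blast
      show "J \<le> N" using Suc.prems(2) by simp
      show "(\<Sum>j<J. (of_nat (Suc j) *s b (Suc j)) * x ^ j) = 0"
        using D_poly[where b = b and J = "Suc J", OF Suc.prems(1,2)]
        unfolding Suc.prems(3) additive.zero[OF D] by simp
    qed
    then have *: "b (Suc j) = 0" if "j < J" for j
      using that scale_0[of j "b (Suc j)"] Suc.prems(2) N(2) by auto
    moreover have "b 0 = 0" using Suc.prems(3) * unfolding sum.lessThan_Suc_shift by simp
    ultimately show ?case by (auto simp: less_Suc_eq_0_disj)
  qed simp
  obtain b where b: "\<And>j. j < N \<Longrightarrow> b j = 0 \<or> (\<exists>k. b j \<in> B k \<and> k + j * m = d)"
    and cb: "c = (\<Sum>j<N. b j * x ^ j)"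
    using \<open>c \<in> E d\<close> unfolding E_def X_def using generated_adjoin_one[OF B(1) xG N(1) xN] by blast
  have bB: "\<exists>k. b j \<in> B k" if "j < N" for j using b[OF that] gB(3) by metis
  have "\<phi> c = 0"
  proof (cases "d = m")
    case True
    have "decomposables Y d \<subseteq> B d" by (rule decomposables_subset[OF B(1)]) (use YB True in auto)
    then show ?thesis using c(2) cB by blast
  next
    case False
    then show ?thesis using \<phi>(2) gY(2)[OF c(1)] unfolding of_degree_def by blast
  qed
  have "slice \<phi> (\<Delta> c - 1 \<otimes>\<^sub>t c) = 0"
    by (rule slice_zero[OF \<phi>(1) _ c(3)]) (use \<phi>_B AB in \<open>auto simp: le_fun_def\<close>)
  then have "D \<phi> c = 0"
    unfolding D_def using \<open>\<phi> c = 0\<close>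
    by (simp add: additive.diff[OF additive_slice[OF \<phi>(1)]] slice_tensor[OF \<phi>(1)])
  then have "(\<Sum>j<N - 1. (of_nat (Suc j) *s b (Suc j)) * x ^ j) = 0"
    using D_poly[where b = b and J = N, OF bB order_refl] unfolding cb[symmetric] by simp
  moreover have "\<exists>k. of_nat (Suc j) *s b (Suc j) \<in> B k" if "j < N - 1" for j
    using bB[of "Suc j"] that gB(6) less_diff_conv by auto
  ultimately have "\<forall>j<N - 1. of_nat (Suc j) *s b (Suc j) = 0" by (intro indep) simp_all
  then have "b (Suc j) = 0" if "j < N - 1" for j
    using that scale_0[of j "b (Suc j)"] N by auto
  moreover obtain N' where N': "N = Suc N'" using N(1) by (cases N) auto
  ultimately have "c = b 0" unfolding cb N' sum.lessThan_Suc_shift by simp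
  then show False using b[of 0] N(1) cB gB(3) by auto
qed

section \<open>The subalgebra of \<open>p\<close>-th powers\<close>

definition power_family :: "(nat \<Rightarrow> 'a set) \<Rightarrow> nat \<Rightarrow> 'a set" where
  "power_family Y n = {y \<in> G n. \<exists>m. \<exists>x\<in>Y m. y = x ^ p}"

lemma power_familyI: "Y \<le> G \<Longrightarrow> x \<in> Y m \<Longrightarrow> x ^ p \<in> power_family Y (m * p)"
  unfolding power_family_def le_fun_def using power_in_G[of x m p] by blast

lemma power_family_cases:
  assumes "Y \<le> G" "y \<in> power_family Y n"
  obtains "y = 0" | m x where "n = m * p" "x \<in> Y m" "y = x ^ p"
proof -
  obtain m x where x: "y \<in> G n" "x \<in> Y m" "y = x ^ p" using assms(2) unfolding power_family_def by blast
  then have "y \<in> G (m * p)" using assms(1) power_in_G[of x m p] by (auto simp: le_fun_def)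
  then show thesis using x that homogeneous_degree_unique[of y n "m * p"] by blast
qed

lemma graded_subalgebra_power_family:
  assumes Y: "graded_subalgebra Y"
  shows "graded_subalgebra (power_family Y)"
proof -
  note gY = graded_subspaceD[OF graded_subalgebraD(1)[OF Y]]
  have YG: "Y \<le> G" using gY(2) by (auto simp: le_fun_def)
  have "(0 :: 'a) = 0 ^ p" using p_ge_2 by (cases p) simp_all
  then have z: "0 \<in> power_family Y n" for n
    unfolding power_family_def using gY(3)[of 0] zero_in_G by blast
  show ?thesis
    unfolding graded_subalgebra_def graded_subspace_def subspace_def
  proof (intro conjI allI ballI)
    show "power_family Y n \<subseteq> G n" for n unfolding power_family_def by blast
    show "0 \<in> power_family Y n" for n by (rule z)
    show "1 \<in> power_family Y 0" using power_familyI[OF YG graded_subalgebraD(2)[OF Y]] by simp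
  next
    fix n y y' assume y: "y \<in> power_family Y n" "y' \<in> power_family Y n"
    show "y + y' \<in> power_family Y n" using YG y(1)
    proof (cases rule: power_family_cases)
      case 1
      then show ?thesis using y by simp
    next
      case (2 m x)
      show ?thesis using YG y(2)
      proof (cases rule: power_family_cases)
        case 1
        then show ?thesis using y by simp
      next
        case (2 m' x')
        then have "m' = m" using \<open>n = m * p\<close> p_ge_2 by simp
        then have "y + y' = (x + x') ^ p" 
          using 2 \<open>y = x ^ p\<close> \<open>x \<in> Y m\<close> power_p_add[of x m x'] gY(2)[of x m] gY(2)[of x' m] by simp
        moreover have "x + x' \<in> Y m" using 2 \<open>x \<in> Y m\<close> \<open>m' = m\<close> gY(4) by simp
        ultimately show ?thesis using power_familyI[OF YG] \<open>n = m * p\<close> by metis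
      qed
    qed
  next
    fix n c y assume y: "y \<in> power_family Y n"
    show "c *s y \<in> power_family Y n" using YG y
    proof (cases rule: power_family_cases)
      case 1
      then show ?thesis using z by simp
    next
      case (2 m x)
      then have "c *s y = (c *s x) ^ p" using power_p_scale[of x m c] gY(2)[of x m] by simp
      moreover have "c *s x \<in> Y m" using 2 gY(6) by simp
      ultimately show ?thesis using power_familyI[OF YG] 2 by metis
    qed
  next
    fix n n' y y' assume y: "y \<in> power_family Y n" "y' \<in> power_family Y n'"
    show "y * y' \<in> power_family Y (n + n')" using YG y(1)
    proof (cases rule: power_family_cases)
      case 1
      then show ?thesis using z by simp
    next
      case (2 m x)
      show ?thesis using YG y(2)
      proof (cases rule: power_family_cases)
        case 1
        then show ?thesis using z by simp
      next
        case (2 m' x')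
        then have "y * y' = (x * x') ^ p" 
          using \<open>y = x ^ p\<close> \<open>x \<in> Y m\<close> power_p_mult[of x m x' m'] gY(2)[of x m] gY(2)[of x' m'] by simp
        moreover have "x * x' \<in> Y (m + m')" using 2 \<open>x \<in> Y m\<close> graded_subalgebraD(3)[OF Y] by simp
        moreover have "n + n' = (m + m') * p" using 2 \<open>n = m * p\<close> by (simp add: distrib_right)
        ultimately show ?thesis using power_familyI[OF YG] by metis
      qed
    qed
  qed
qed

text \<open>
  The coproduct is compatible with the Steenrod operations, and on the part of the tensor square in degree
  \<open>w b\<close>, the operation \<open>\<P> b\<close> maps \<open>u \<otimes> v\<close> to \<open>u\<^sup>p \<otimes> v\<^sup>p\<close>.
\<close>

lemma bicoideal_power_family:
  assumes Y: "graded_subalgebra Y" "bicoideal Y"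
  shows "bicoideal (power_family Y)"
  unfolding bicoideal_def
proof (intro allI ballI)
  note gY = graded_subspaceD[OF graded_subalgebraD(1)[OF Y(1)]]
  have YG: "Y \<le> G" using gY(2) by (auto simp: le_fun_def)
  fix n y assume y: "y \<in> power_family Y n"
  show "\<Delta> y \<in> htensor (power_family Y) (power_family Y) n" using YG y
  proof (cases rule: power_family_cases)
    case 1
    then show ?thesis by (simp add: \<Delta>.zero htensor_zero)
  next
    case (2 m x)
    show ?thesis using gY(2)[OF 2(2)]
    proof (cases rule: power_p_cases)
      case (1 b)
      have "\<Delta> x \<in> htensor Y Y m" using Y(2) 2 unfolding bicoideal_def by blast
      then have "tensor_\<P> b (\<Delta> x) \<in> htensor (power_family Y) (power_family Y) n"
      proof (rule htensor_image[OF additive_tensor_\<P>])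
        fix u v i j assume *: "i + j = m" "u \<in> Y i" "v \<in> Y j"
        have "tensor_\<P> b (u \<otimes>\<^sub>t v) = (u ^ p) \<otimes>\<^sub>t (v ^ p)"
          unfolding tensor_\<P>
          by (rule sum_\<P>_powers[of _ i _ j]) (use * 1 gY(2) in simp_all)
        moreover have "i * p + j * p = n" using * 2 by (simp add: distrib_right[symmetric])
        ultimately show "tensor_\<P> b (u \<otimes>\<^sub>t v) \<in> htensor (power_family Y) (power_family Y) n"
          using power_familyI[OF YG *(2)] power_familyI[OF YG *(3)]
          by (simp add: htensor_base[of _ _ "i * p" _ _ "j * p"])
      qed
      then show ?thesis using 1 2 comult_\<P> by simp
    next
      case 2
      then show ?thesis using \<open>y = x ^ p\<close> by (simp add: \<Delta>.zero htensor_zero)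
    qed
  qed
qed

section \<open>Products of two subalgebras\<close>

lemma span_image_lessThan:
  fixes v :: "nat \<Rightarrow> 'a"
  assumes "x \<in> span (v ` {..<r})"
  shows "\<exists>\<alpha>. x = (\<Sum>i<r. \<alpha> i *s v i)"
  using assms
proof (induction rule: span_induct_alt)
  case base
  show ?case by (rule exI[of _ "\<lambda>_. 0"]) simp
next
  case (step c z y)
  then obtain i \<alpha> where *: "i < r" "z = v i" "y = (\<Sum>i<r. \<alpha> i *s v i)" by auto
  have "c *s z + y = (\<Sum>j<r. ((if j = i then c else 0) + \<alpha> j) *s v j)"
    using * by (simp add: scale_left_distrib sum.distrib if_distrib[of "\<lambda>a. a *s _"] cong: if_cong)
  then show ?case by (intro exI)
qed

text \<open>
  The products \<open>A Y\<close>, filtered by the degree of the factor from \<open>Y\<close>.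
\<close>

definition product_filtration ::
  "(nat \<Rightarrow> 'a set) \<Rightarrow> (nat \<Rightarrow> 'a set) \<Rightarrow> nat \<Rightarrow> nat \<Rightarrow> 'a set" where
  "product_filtration A Y m n =
    span {a * y |a y. \<exists>i j. a \<in> A i \<and> y \<in> Y j \<and> i + j = n \<and> j \<le> m}"

lemma product_filtration_base:
  "a \<in> A i \<Longrightarrow> y \<in> Y j \<Longrightarrow> i + j = n \<Longrightarrow> j \<le> m \<Longrightarrow> a * y \<in> product_filtration A Y m n"
  unfolding product_filtration_def by (rule span_base) blast

lemma subspace_product_filtration: "subspace (product_filtration A Y m n)"
  unfolding product_filtration_def by (rule subspace_span)

lemma product_filtration_mono: "m \<le> m' \<Longrightarrow> product_filtration A Y m n \<subseteq> product_filtration A Y m' n"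
  unfolding product_filtration_def by (rule span_mono) (blast intro: order_trans)

lemma product_filtration_mult_left:
  assumes A: "graded_subalgebra A" and b: "b \<in> A k" and e: "e \<in> product_filtration A Y m n"
  shows "b * e \<in> product_filtration A Y m (k + n)"
  using e unfolding product_filtration_def[of A Y m n]
proof (induction rule: span_induct_alt)
  case base
  show ?case using subspace_0[OF subspace_product_filtration] by simp
next
  case (step c z z')
  then obtain a y i j where z: "z = a * y" "a \<in> A i" "y \<in> Y j" "i + j = n" "j \<le> m" by blast
  have "b * a \<in> A (k + i)" by (rule graded_subalgebraD(3)[OF A b z(2)])
  then have "(b * a) * y \<in> product_filtration A Y m (k + n)"
    by (rule product_filtration_base[of _ _ "k + i" y _ j]) (use z in simp_all)
  then have "c *s ((b * a) * y) + b * z' \<in> product_filtration A Y m (k + n)"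
    by (intro subspace_add[OF subspace_product_filtration] subspace_scale[OF subspace_product_filtration] step(2))
  then show ?case by (simp add: z(1) distrib_left scale_mult_right mult.assoc)
qed

lemma gen_union_subset_products:
  assumes A: "graded_subalgebra A" and Y: "graded_subalgebra Y"
  shows "gen (\<lambda>n. A n \<union> Y n) n \<subseteq> product_filtration A Y n n"
proof -
  note gA = graded_subspaceD[OF graded_subalgebraD(1)[OF A]]
  note gY = graded_subspaceD[OF graded_subalgebraD(1)[OF Y]]
  define R where "R n = product_filtration A Y n n" for n
  note sub = subspace_product_filtration[of A Y n n for n, folded R_def]
  have base: "a * y \<in> R (i + j)" if "a \<in> A i" "y \<in> Y j" for a y i j
    unfolding R_def by (rule product_filtration_base[of a A i y Y j]) (use that in simp_all)
  have "graded_subalgebra R"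
    unfolding graded_subalgebra_def graded_subspace_def
  proof (intro conjI allI ballI)
    show "subspace (R n)" for n by (rule sub)
    show "R n \<subseteq> G n" for n
      unfolding R_def product_filtration_def
      by (rule span_minimal[OF _ subspace_G]) (use gA(2) gY(2) mult_in_G in auto)
    show "1 \<in> R 0" using base[OF graded_subalgebraD(2)[OF A] graded_subalgebraD(2)[OF Y]] by simp
  next
    fix n n' e e' assume e: "e \<in> R n" "e' \<in> R n'"
    have mono: "a * y * e' \<in> R (n + n')" if ay: "a \<in> A i" "y \<in> Y j" "i + j = n" for a y i j
      using e(2) unfolding R_def[of n'] product_filtration_def
    proof (induction rule: span_induct_alt)
      case base
      show ?case using subspace_0[OF sub] by simp
    next
      case (step c z z')
      then obtain a' y' i' j' where z: "z = a' * y'" "a' \<in> A i'" "y' \<in> Y j'" "i' + j' = n'" by blast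
      have "y * a' = (-1) ^ (j * i') * (a' * y)" by (rule graded_commute[OF gY(2)[OF ay(2)] gA(2)[OF z(2)]])
      moreover have "a * y * z = a * (y * a') * y'" unfolding z(1) by (simp only: mult.assoc)
      ultimately have "a * y * z = a * ((-1) ^ (j * i') * (a' * y)) * y'" by simp
      also have "\<dots> = (-1) ^ (j * i') * ((a * a') * (y * y'))"
        by (cases "even (j * i')") (simp_all add: mult.assoc)
      finally have eq: "a * y * z = (-1) ^ (j * i') * ((a * a') * (y * y'))" .
      have "(i + i') + (j + j') = n + n'" using ay(3) z(4) by simp
      then have "(a * a') * (y * y') \<in> R (n + n')"
        using base[OF graded_subalgebraD(3)[OF A ay(1) z(2)] graded_subalgebraD(3)[OF Y ay(2) z(3)]]
        by (simp only:)
      then have "a * y * z \<in> R (n + n')" unfolding eq by (rule minus_one_power_mult_in[OF sub])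
      then have "c *s (a * y * z) + a * y * z' \<in> R (n + n')"
        by (intro subspace_add[OF sub] subspace_scale[OF sub] step(2))
      then show ?case by (simp add: distrib_left scale_mult_right)
    qed
    show "e * e' \<in> R (n + n')"
      using e(1) unfolding R_def[of n] product_filtration_def
    proof (induction rule: span_induct_alt)
      case base
      show ?case using subspace_0[OF sub] by simp
    next
      case (step c z z')
      then obtain a y i j where z: "z = a * y" "a \<in> A i" "y \<in> Y j" "i + j = n" by blast
      have "c *s (z * e') + z' * e' \<in> R (n + n')"
        unfolding z(1) by (intro subspace_add[OF sub] subspace_scale[OF sub] step(2) mono[OF z(2-4)])
      then show ?case by (simp add: distrib_right scale_mult_left)
    qed
  qed
  moreover have "(\<lambda>n. A n \<union> Y n) \<le> R"
    using base[OF _ graded_subalgebraD(2)[OF Y]] base[OF graded_subalgebraD(2)[OF A]]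
    by (fastforce simp: le_fun_def)
  ultimately have "gen (\<lambda>n. A n \<union> Y n) \<le> R" by (rule gen_least)
  then show ?thesis unfolding R_def le_fun_def by blast
qed

text \<open>
  Collecting the summands with a right factor of degree exactly \<open>m + 1\<close>.
\<close>

lemma product_filtration_Suc_cases:
  assumes "z \<in> product_filtration A Y (Suc m) d"
    and A: "graded_subspace A"
  obtains r :: nat and a v f where "\<And>i. i < r \<Longrightarrow> Suc m \<le> d \<and> a i \<in> A (d - Suc m) \<and> v i \<in> Y (Suc m)"
    and "f \<in> product_filtration A Y m d" and "z = (\<Sum>i<r. a i * v i) + f"
proof -
  have "\<exists>r a v f. (\<forall>i<(r :: nat). Suc m \<le> d \<and> a i \<in> A (d - Suc m) \<and> v i \<in> Y (Suc m)) \<and>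
    f \<in> product_filtration A Y m d \<and> z = (\<Sum>i<r. a i * v i) + f"
    using assms(1) unfolding product_filtration_def[of A Y "Suc m"]
  proof (induction rule: span_induct_alt)
    case base
    show ?case using subspace_0[OF subspace_product_filtration[of A Y m d]]
      by (intro exI[of _ "0 :: nat"] exI[of _ "\<lambda>_ :: nat. 0 :: 'a"] exI[of _ "0 :: 'a"]) simp
  next
    case (step c x y)
    then obtain b u i j where x: "x = b * u" "b \<in> A i" "u \<in> Y j" "i + j = d" "j \<le> Suc m" by blast
    from step obtain r :: nat and a v f where *: "\<forall>i<r. Suc m \<le> d \<and> a i \<in> A (d - Suc m) \<and> v i \<in> Y (Suc m)"
      "f \<in> product_filtration A Y m d" "y = (\<Sum>i<r. a i * v i) + f" by blast
    show ?case
    proof (cases "j \<le> m")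
      case True
      have "c *s x + f \<in> product_filtration A Y m d"
        unfolding x(1)
        by (intro subspace_add[OF subspace_product_filtration] subspace_scale[OF subspace_product_filtration]
            product_filtration_base[of b A i u Y j] x(2-4) True *(2))
      moreover have "c *s x + y = (\<Sum>i<r. a i * v i) + (c *s x + f)" using *(3) by simp
      ultimately show ?thesis using *(1) by blast
    next
      case False
      then have j: "j = Suc m" using x(5) by simp
      let ?a = "a(r := c *s b)" and ?v = "v(r := u)"
      have "\<forall>i<Suc r. Suc m \<le> d \<and> ?a i \<in> A (d - Suc m) \<and> ?v i \<in> Y (Suc m)"
        using *(1) x j graded_subspaceD(6)[OF A] by (auto simp: less_Suc_eq)
      moreover have "c *s x + y = (\<Sum>i<Suc r. ?a i * ?v i) + f"
        using *(3) by (simp add: x(1) scale_mult_left add_ac)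
      ultimately show ?thesis using *(2) by blast
    qed
  qed
  then show thesis using that by blast
qed

lemma coideal_bicoideal:
  assumes "graded_subspace Y" "bicoideal Y"
  shows "coideal Y" and "y \<in> Y n \<Longrightarrow> \<Delta> y \<in> htensor Y G n"
proof -
  have "Y \<le> G" using graded_subspaceD(2)[OF assms(1)] by (auto simp: le_fun_def)
  then show "coideal Y" "y \<in> Y n \<Longrightarrow> \<Delta> y \<in> htensor Y G n"
    using assms(2) htensor_mono[of _ Y Y] unfolding bicoideal_def coideal_def by blast+
qed

lemma coideal_gen_union:
  assumes A: "graded_subspace A" "coideal A" and Y: "graded_subspace Y" "coideal Y"
  shows "coideal (gen (\<lambda>n. A n \<union> Y n))"
proof (rule coideal_gen)
  show "(\<lambda>n. A n \<union> Y n) \<le> G"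
    using graded_subspaceD(2)[OF A(1)] graded_subspaceD(2)[OF Y(1)] by (auto simp: le_fun_def)
  have AE: "A \<le> gen (\<lambda>n. A n \<union> Y n)" and YE: "Y \<le> gen (\<lambda>n. A n \<union> Y n)"
    using subset_gen[of "\<lambda>n. A n \<union> Y n"] by (auto simp: le_fun_def)
  fix n x assume "x \<in> A n \<union> Y n"
  then have "\<Delta> x \<in> htensor G A n \<or> \<Delta> x \<in> htensor G Y n" using A(2) Y(2) unfolding coideal_def by blast
  then show "\<Delta> x \<in> htensor G (gen (\<lambda>n. A n \<union> Y n)) n"
    using htensor_mono[OF _ order_refl AE] htensor_mono[OF _ order_refl YE] by blast
qed

text \<open>
  Write \<open>c\<close> as a sum of terms \<open>a v\<close> with \<open>a \<in> A\<close>, \<open>v \<in> Y\<close>, and look at the terms in which \<open>v\<close> has the largest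
  degree \<open>m\<close>. After elimination of redundant terms, there is a functional \<open>\<phi>\<close> of degree \<open>m\<close> that vanishes on the
  ideal generated by the positive part of \<open>A\<close> and singles out one of the \<open>v\<close>. Then \<open>D \<phi>\<close> is \<open>A\<close>-linear and
  annihilates terms with \<open>v\<close> of smaller degree, so up to an element of \<open>Y\<close>, \<open>D \<phi> c\<close> is the coefficient \<open>a\<close> of this \<open>v\<close>. By hypothesis it lies
  in \<open>Y\<close>, hence so does \<open>a v\<close>, and this term can be removed from \<open>c\<close>.
\<close>

theorem product_of_subalgebras_splits:
  assumes A: "graded_subalgebra A" "coideal A" and Y: "graded_subalgebra Y" "bicoideal Y"
    and c: "c \<in> gen (\<lambda>n. A n \<union> Y n) d"
    and Dc: "\<And>\<phi> m. functional \<phi> \<Longrightarrow> of_degree m \<phi> \<Longrightarrow> (\<And>i v. v \<in> A i \<Longrightarrow> \<phi> v = 0) \<Longrightarrow> m \<le> d \<Longrightarrow>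
      D \<phi> c \<in> Y (d - m)"
  shows "\<exists>y\<in>Y d. c - y \<in> A d"
proof -
  note gA = graded_subspaceD[OF graded_subalgebraD(1)[OF A(1)]]
  note gY = graded_subspaceD[OF graded_subalgebraD(1)[OF Y(1)]]
  let ?T = "product_filtration A Y"
  note subT = subspace_product_filtration
  define E where "E = gen (\<lambda>n. A n \<union> Y n)"
  have XG: "(\<lambda>n. A n \<union> Y n) \<le> G" using gA(2) gY(2) by (auto simp: le_fun_def)
  have E: "graded_subalgebra E" unfolding E_def by (rule graded_subalgebra_gen[OF XG])
  note gE = graded_subspaceD[OF graded_subalgebraD(1)[OF E]]
  have coidY: "coideal Y" and \<Delta>Y: "\<And>y n. y \<in> Y n \<Longrightarrow> \<Delta> y \<in> htensor Y G n"
    using coideal_bicoideal[OF graded_subalgebraD(1)[OF Y(1)] Y(2)] by blast+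
  have AE: "a \<in> E i" if "a \<in> A i" for a i using that subset_gen[of "\<lambda>n. A n \<union> Y n"] unfolding E_def le_fun_def by blast
  have YE: "y \<in> E i" if "y \<in> Y i" for y i using that subset_gen[of "\<lambda>n. A n \<union> Y n"] unfolding E_def le_fun_def by blast
  have \<Delta>E: "\<Delta> y \<in> htensor G E n" if "y \<in> E n" for y n
    using coideal_gen_union[OF graded_subalgebraD(1)[OF A(1)] A(2) graded_subalgebraD(1)[OF Y(1)] coidY] that
    unfolding E_def coideal_def by blast
  have E_T: "e \<in> ?T m n" if "e \<in> E n" "n \<le> m" for e n m
    using gen_union_subset_products[OF A(1) Y(1)] product_filtration_mono[OF that(2)] that(1)
    unfolding E_def by blast
  have claim: "\<exists>y\<in>Y d. c - y \<in> A d" if "c - y0 \<in> ?T m d" "y0 \<in> Y d" for m y0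
    using that
  proof (induction m arbitrary: y0)
    case 0
    have "?T 0 d \<subseteq> A d" unfolding product_filtration_def
    proof (rule span_minimal[OF _ gA(1)], rule subsetI)
      fix z assume "z \<in> {a * y |a y. \<exists>i j. a \<in> A i \<and> y \<in> Y j \<and> i + j = d \<and> j \<le> 0}"
      then obtain a y where z: "z = a * y" "a \<in> A d" "y \<in> Y 0" by auto
      then have "y \<in> G 0" using gY(2) by blast
      then have "a * y = \<epsilon> y *s a" by (rule G_0_mult(2))
      then show "z \<in> A d" using z gA(6) by simp
    qed
    then show ?case using 0 by blast
  next
    case (Suc m)
    have terms: "\<exists>y\<in>Y d. c - y \<in> A d"
      if "\<And>i. i < r \<Longrightarrow> Suc m \<le> d \<and> a i \<in> A (d - Suc m) \<and> v i \<in> Y (Suc m)"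
        "f \<in> ?T m d" "c - y1 = (\<Sum>i<r. a i * v i) + f" "y1 \<in> Y d" for r :: nat and a v f y1
      using that
    proof (induction r arbitrary: a f y1)
      case 0
      then show ?case using Suc.IH[of y1] by simp
    next
      case (Suc r)
      note avf = Suc.prems
      have md: "Suc m \<le> d" and ar: "a r \<in> A (d - Suc m)" and vr: "v r \<in> Y (Suc m)"
        using avf(1)[of r] by simp_all
      define W where "W = {b * e |b e. \<exists>i j. b \<in> A i \<and> e \<in> E j \<and> 0 < i \<and> i + j = Suc m}"
      let ?V = "span (v ` {..<r} \<union> W)"
      have aW: "a r * t \<in> ?T m d" if "t \<in> span W" for t
        using that
      proof (induction rule: span_induct_alt)
        case base
        show ?case using subspace_0[OF subT] by simp
      next
        case (step k z z')
        then obtain b e i j where z: "z = b * e" "b \<in> A i" "e \<in> E j" "0 < i" "i + j = Suc m"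
          unfolding W_def by blast
        have "e \<in> ?T m j" by (rule E_T[OF z(3)]) (use z in simp)
        moreover have "a r * b \<in> A (d - Suc m + i)" by (rule graded_subalgebraD(3)[OF A(1) ar z(2)])
        ultimately have "(a r * b) * e \<in> ?T m (d - Suc m + i + j)"
          by (intro product_filtration_mult_left[OF A(1)])
        moreover have "d - Suc m + i + j = d" using z(5) md by simp
        ultimately have "k *s ((a r * b) * e) + a r * z' \<in> ?T m d"
          by (intro subspace_add[OF subT] subspace_scale[OF subT] step(2)) simp
        then show ?case by (simp add: z(1) distrib_left scale_mult_right mult.assoc)
      qed
      \<comment> \<open>Either the last term is redundant, or a functional isolates its coefficient.\<close>
      show ?case
      proof (cases "v r \<in> ?V")
        case True
        then obtain s t where st: "v r = s + t" "s \<in> span (v ` {..<r})" "t \<in> span W"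
          unfolding span_Un by blast
        obtain \<alpha> where \<alpha>: "s = (\<Sum>i<r. \<alpha> i *s v i)" using span_image_lessThan[OF st(2)] by blast
        have "a r * s = (\<Sum>i<r. (\<alpha> i *s a r) * v i)"
          unfolding \<alpha> sum_distrib_left
          by (simp only: scale_mult_left[symmetric] scale_mult_right[symmetric])
        then have "c - y1 = (\<Sum>i<r. (a i + \<alpha> i *s a r) * v i) + (f + a r * t)"
          using avf(3) st(1) by (simp add: distrib_left distrib_right sum.distrib add_ac)
        moreover have "f + a r * t \<in> ?T m d" by (rule subspace_add[OF subT avf(2) aW[OF st(3)]])
        moreover have "Suc m \<le> d \<and> a i + \<alpha> i *s a r \<in> A (d - Suc m) \<and> v i \<in> Y (Suc m)" if "i < r" for i
          using avf(1)[of i] that gA(4,6) ar by simp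
        ultimately show ?thesis using Suc.IH[of "\<lambda>i. a i + \<alpha> i *s a r" "f + a r * t" y1] avf(4) by blast
      next
        case False
        have VG: "?V \<subseteq> G (Suc m)"
        proof (rule span_minimal[OF _ subspace_G], rule Un_least)
          show "v ` {..<r} \<subseteq> G (Suc m)" using avf(1) gY(2) by auto
          show "W \<subseteq> G (Suc m)" 
            unfolding W_def using gA(2) gE(2) graded_subalgebraD(4)[OF graded_subalgebra_G] by blast
        qed
        obtain \<phi> where \<phi>: "functional \<phi>" "of_degree (Suc m) \<phi>" and \<phi>V: "\<And>x. x \<in> ?V \<Longrightarrow> \<phi> x = 0"
          and \<phi>v: "\<phi> (v r) = 1"
          using functional_vanishing_on[OF subspace_span VG gY(2)[OF vr] False] by blast
        note D = additive_D[OF \<phi>(1)]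
        have \<phi>W: "\<phi> (b * e) = 0" if "b \<in> A i" "e \<in> E j" "0 < i" for b e i j
        proof (cases "i + j = Suc m")
          case True
          then have "b * e \<in> W" unfolding W_def using that by blast
          then show ?thesis using \<phi>V span_base by blast
        next
          case False
          moreover have "b * e \<in> G (i + j)" using that gA(2) gE(2) mult_in_G by blast
          ultimately show ?thesis using \<phi>(2) unfolding of_degree_def by metis
        qed
        have \<phi>A: "\<phi> b = 0" if "b \<in> A i" for b i
        proof (cases "i = 0")
          case True
          then have "b \<in> G 0" using gA(2)[OF that] by simp
          then show ?thesis using \<phi>(2) unfolding of_degree_def by (metis nat.distinct(1))
        next
          case False
          then show ?thesis using \<phi>W[OF that graded_subalgebraD(2)[OF E]] by simp
        qed
        have \<phi>_mult: "\<phi> (b * e) = \<epsilon> b * \<phi> e" if "b \<in> A i" "e \<in> E j" for b e i j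
        proof (cases "i = 0")
          case True
          then have "b \<in> G 0" using gA(2) that by blast
      then have "b * e = \<epsilon> b *s e" by (rule G_0_mult(1))
          then show ?thesis using functionalD(2)[OF \<phi>(1)] by simp
        next
          case False
          then show ?thesis using \<phi>W[OF that] counit_degree[OF gA(2)[OF that(1)]] by simp
        qed
        have D_mult: "D \<phi> (b * y) = b * D \<phi> y" if "b \<in> A i" "y \<in> Y j" for b y i j
        proof -
          have \<Delta>b: "\<Delta> b \<in> htensor G A i" using A(2) that(1) unfolding coideal_def by blast
          show ?thesis
            by (rule D_mult_left[where E = E, OF \<phi>(1) graded_subalgebraD(1)[OF A(1)] _ \<Delta>b \<Delta>E[OF YE[OF that(2)]]])
              (rule \<phi>_mult)
        qed
        have D_T: "D \<phi> z = 0" if "z \<in> ?T m d" for z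
          using that unfolding product_filtration_def
        proof (induction rule: span_induct_alt)
          case base
          show ?case by (rule additive.zero[OF D])
        next
          case (step k z z')
          then obtain b y i j where z: "z = b * y" "b \<in> A i" "y \<in> Y j" "j \<le> m" by blast
          have "k *s b \<in> A i" by (rule gA(6)[OF z(2)])
          moreover have "D \<phi> y = 0"
            by (rule D_in(2)[OF \<phi> graded_subspace_G comult_in_htensor[OF gY(2)[OF z(3)]]]) (use z in simp)
          ultimately have "D \<phi> ((k *s b) * y) = 0" using D_mult[OF _ z(3)] by simp
          then show ?case using step(2) by (simp add: z(1) additive.add[OF D] scale_mult_left)
        qed
        have "D \<phi> (a i * v i) = (if i = r then a r else 0)" if "i < Suc r" for i
        proof -
          have "D \<phi> (a i * v i) = a i * (\<phi> (v i) *s 1)"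
            using D_mult D_top_degree[OF \<phi>, of "v i"] gY(2) avf(1)[OF that] by metis
          moreover have "\<phi> (v i) = 0" if "i < r"
            by (rule \<phi>V, rule span_base) (use that in simp)
          ultimately show ?thesis using \<phi>v \<open>i < Suc r\<close> by (cases "i = r") auto
        qed
        then have "(\<Sum>i<Suc r. D \<phi> (a i * v i)) = a r" by simp
        moreover have "D \<phi> (\<Sum>i<Suc r. a i * v i) = (\<Sum>i<Suc r. D \<phi> (a i * v i))"
          by (rule additive.sum[OF D])
        ultimately have "D \<phi> (c - y1) = a r"
          unfolding avf(3) additive.add[OF D] using D_T[OF avf(2)] by simp
        then have "a r = D \<phi> c - D \<phi> y1" by (simp add: additive.diff[OF D])
        moreover have "D \<phi> c \<in> Y (d - Suc m)" by (rule Dc[OF \<phi> \<phi>A md])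
        moreover have "D \<phi> y1 \<in> Y (d - Suc m)"
          by (rule D_in(1)[OF \<phi> graded_subalgebraD(1)[OF Y(1)] \<Delta>Y[OF avf(4)] md])
        ultimately have "a r \<in> Y (d - Suc m)" using gY(5) by simp
        then have "a r * v r \<in> Y d" by (rule graded_subalgebraD(4)[OF Y(1) _ vr]) (use md in simp)
        then have "y1 + a r * v r \<in> Y d" by (rule gY(4)[OF avf(4)])
        moreover have "c - (y1 + a r * v r) = (\<Sum>i<r. a i * v i) + f" using avf(3) by (simp add: algebra_simps)
        ultimately show ?thesis using Suc.IH[of a f "y1 + a r * v r"] avf(1,2) by auto
      qed
    qed
    from Suc.prems(1) graded_subalgebraD(1)[OF A(1)] show ?case
    proof (cases rule: product_filtration_Suc_cases)
      case (1 r a v f)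
      then show ?thesis using terms[of r a v f y0] Suc.prems(2) by blast
    qed
  qed
  have "c \<in> E d" using c unfolding E_def .
  then have "c - 0 \<in> ?T d d" using E_T by simp
  then show ?thesis using claim gY(3) by blast
qed

text \<open>
  This generalizes the theorem of Milnor and Moore that a decomposable primitive element of a commutative
  Hopf algebra is a \<open>p\<close>-th power, from the ground field to a subalgebra \<open>A\<close> as base. The previous two results
  apply with the subalgebra generated by \<open>A\<close> and the \<open>p\<close>-th powers.
\<close>

theorem decomposable_primitive_modulo_subalgebra:
  assumes Y: "graded_subalgebra Y" "bicoideal Y" and A: "graded_subalgebra A" "coideal A"
    and c: "c \<in> Y d" "c \<in> decomposables Y d" "\<Delta> c - 1 \<otimes>\<^sub>t c \<in> htensor G A d"
  shows "\<exists>y\<in>power_family Y d. c - y \<in> A d"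
proof -
  let ?F = "power_family Y"
  let ?E = "gen (\<lambda>n. A n \<union> ?F n)"
  note gY = graded_subspaceD[OF graded_subalgebraD(1)[OF Y(1)]]
  have YG: "Y \<le> G" using gY(2) by (auto simp: le_fun_def)
  have F: "graded_subalgebra ?F" "bicoideal ?F"
    by (rule graded_subalgebra_power_family[OF Y(1)], rule bicoideal_power_family[OF Y])
  have sub: "(\<lambda>n. A n \<union> ?F n) \<le> ?E" by (rule subset_gen)
  have "c \<in> ?E d"
  proof (rule decomposable_primitive_in_subalgebra[OF Y])
    show "graded_subalgebra ?E"
      by (rule graded_subalgebra_gen)
        (use graded_subspaceD(2)[OF graded_subalgebraD(1)[OF A(1)]] in \<open>auto simp: le_fun_def power_family_def\<close>)
    show "coideal ?E"
      by (rule coideal_gen_union[OF graded_subalgebraD(1)[OF A(1)] A(2) graded_subalgebraD(1)[OF F(1)]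
          coideal_bicoideal(1)[OF graded_subalgebraD(1)[OF F(1)] F(2)]])
    show "x ^ p \<in> ?E (n * p)" if "x \<in> Y n" for n x
      using power_familyI[OF YG that] sub by (auto simp: le_fun_def)
    show "\<Delta> c - 1 \<otimes>\<^sub>t c \<in> htensor G ?E d"
      by (rule htensor_mono[OF c(3) order_refl]) (use sub in \<open>auto simp: le_fun_def\<close>)
  qed (rule c)+
  then show ?thesis
  proof (rule product_of_subalgebras_splits[OF A F])
    fix \<phi> m assume \<phi>: "functional \<phi>" "of_degree m \<phi>" "\<And>i v. v \<in> A i \<Longrightarrow> \<phi> v = 0" "m \<le> d"
    have "slice \<phi> (\<Delta> c - 1 \<otimes>\<^sub>t c) = 0" by (rule slice_zero[OF \<phi>(1,3) c(3)])
    then have D: "D \<phi> c = \<phi> c *s 1"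
      unfolding D_def by (simp add: additive.diff[OF additive_slice[OF \<phi>(1)]] slice_tensor[OF \<phi>(1)])
    note gF = graded_subspaceD[OF graded_subalgebraD(1)[OF F(1)]]
    show "D \<phi> c \<in> ?F (d - m)"
    proof (cases "m = d")
      case True
      then show ?thesis unfolding D using gF(6)[OF graded_subalgebraD(2)[OF F(1)]] by simp
    next
      case False
      then have "\<phi> c = 0" using \<phi>(2) gY(2)[OF c(1)] unfolding of_degree_def by metis
      then show ?thesis unfolding D using gF(3) by simp
    qed
  qed
qed

section \<open>The module of indecomposables\<close>

text \<open>
  The quotient by this family is the module of indecomposables.
\<close>

definition scalars_and_decomposables :: "nat \<Rightarrow> 'a set" where
  "scalars_and_decomposables n = (if n = 0 then G 0 else decomposables G n)"

lemma subspace_decomposables: "subspace (decomposables Y n)"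
  unfolding decomposables_def by (rule subspace_span)

lemma decomposables_base:
  "u \<in> Y i \<Longrightarrow> v \<in> Y j \<Longrightarrow> 0 < i \<Longrightarrow> 0 < j \<Longrightarrow> i + j = n \<Longrightarrow> u * v \<in> decomposables Y n"
  unfolding decomposables_def by (rule span_base) blast

lemma stable_scalars_and_decomposables: "stable scalars_and_decomposables"
proof -
  have gs: "graded_subspace scalars_and_decomposables"
    unfolding graded_subspace_def scalars_and_decomposables_def
    using subspace_G subspace_decomposables decomposables_subset[OF graded_subalgebra_G, of _ G] by simp
  have P: "\<P> a x \<in> scalars_and_decomposables (n + \<delta> a)" if x: "x \<in> scalars_and_decomposables n" for x n a
  proof (cases "n = 0")
    case True
    then have "x \<in> G 0" using x by (simp add: scalars_and_decomposables_def)
    show ?thesis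
    proof (cases "a = 0")
      case True
      then show ?thesis using x by (simp add: \<P>_0 \<delta>_0)
    next
      case False
      then have "\<P> a x = 0" using \<P>_unstable[OF \<open>x \<in> G 0\<close>] w_pos by simp
      then show ?thesis using graded_subspaceD(3)[OF gs] by simp
    qed
  next
    case False
    then have "x \<in> decomposables G n" using x by (simp add: scalars_and_decomposables_def)
    then have "\<P> a x \<in> decomposables G (n + \<delta> a)"
      unfolding decomposables_def[of G n]
    proof (induction rule: span_induct_alt)
      case base
      show ?case using subspace_0[OF subspace_decomposables] by (simp add: \<P>.zero)
    next
      case (step c z z')
      then obtain u v i j where z: "z = u * v" "0 < i" "0 < j" "i + j = n" "u \<in> G i" "v \<in> G j" by blast
      have "\<P> b u * \<P> (a - b) v \<in> decomposables G (n + \<delta> a)" if "b \<le> a" for b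
      proof (rule decomposables_base[of "\<P> b u" G "i + \<delta> b" "\<P> (a - b) v" "j + \<delta> (a - b)"])
        have "\<delta> b + \<delta> (a - b) = \<delta> a" using that by (simp add: \<delta>_add[symmetric])
        then show "i + \<delta> b + (j + \<delta> (a - b)) = n + \<delta> a" using z(4) by simp
      qed (use z \<P>_in_G in simp_all)
      then have "\<P> a z \<in> decomposables G (n + \<delta> a)"
        unfolding z(1) \<P>_cartan by (intro subspace_sum[OF subspace_decomposables]) simp
      then show ?case
        using subspace_add[OF subspace_decomposables subspace_scale[OF subspace_decomposables] step(2)]
        by (simp add: \<P>.add \<P>.scale)
    qed
    then show ?thesis using False by (simp add: scalars_and_decomposables_def)
  qed
  have B: "\<beta> x \<in> scalars_and_decomposables (n + 1)" if x: "x \<in> scalars_and_decomposables n" for x n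
  proof (cases "n = 0")
    case True
    then have "x \<in> G 0" using x by (simp add: scalars_and_decomposables_def)
    then have "\<beta> x = 0" using \<beta>_\<P>_unstable[of x 0 0] by (simp add: \<P>_0)
    then show ?thesis using graded_subspaceD(3)[OF gs] by simp
  next
    case False
    then have "x \<in> decomposables G n" using x by (simp add: scalars_and_decomposables_def)
    then have "\<beta> x \<in> decomposables G (n + 1)"
      unfolding decomposables_def[of G n]
    proof (induction rule: span_induct_alt)
      case base
      show ?case using subspace_0[OF subspace_decomposables] by (simp add: \<beta>.zero)
    next
      case (step c z z')
      then obtain u v i j where z: "z = u * v" "0 < i" "0 < j" "i + j = n" "u \<in> G i" "v \<in> G j" by blast
      have "\<beta> u * v \<in> decomposables G (n + 1)"
        by (rule decomposables_base[of _ _ "i + 1" _ j]) (use z \<beta>_in_G[OF z(5)] in simp_all)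
      moreover have "(-1) ^ i * (u * \<beta> v) \<in> decomposables G (n + 1)"
        by (rule minus_one_power_mult_in[OF subspace_decomposables],
            rule decomposables_base[of _ _ i _ "j + 1"]) (use z \<beta>_in_G[OF z(6)] in simp_all)
      ultimately have "\<beta> z \<in> decomposables G (n + 1)"
        unfolding z(1) \<beta>_cartan[OF z(5)] by (rule subspace_add[OF subspace_decomposables])
      then show ?case
        using subspace_add[OF subspace_decomposables subspace_scale[OF subspace_decomposables] step(2)]
        by (simp add: \<beta>.add \<beta>.scale)
    qed
    then show ?thesis by (simp add: scalars_and_decomposables_def)
  qed
  show ?thesis unfolding stable_def \<P>_closed_def \<beta>_closed_def using gs P B by blast
qed

lemma unstable_scalars_and_decomposables: "unstable_modulo 0 scalars_and_decomposables"
  unfolding unstable_modulo_def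
  using \<P>_unstable \<beta>_\<P>_unstable graded_subspaceD(3)[OF stableD(1)[OF stable_scalars_and_decomposables]]
  by simp

text \<open>
  Operations are linear combinations of composites of generators.
\<close>

lemma mem_stable_of_operation:
  assumes T: "\<And>g x. g \<in> steenrod_gens p \<Longrightarrow> x \<in> T \<Longrightarrow> act g x \<in> T" and sub: "subspace T"
    and \<theta>: "\<theta> \<in> steenrod_operations p scale act" and x: "x \<in> T"
  shows "\<theta> x \<in> T"
  using \<theta> by induction (use x T subspace_add[OF sub] subspace_scale[OF sub] in auto)

text \<open>
  The elements with all components in \<open>K\<close> form a subalgebra, because \<open>K\<close> contains all products of elements of
  positive degree.
\<close>

lemma family_eq_G_of_generators:
  assumes K: "stable K" "scalars_and_decomposables \<le> K"
    and S: "UNIV = subalgebra scale hull {\<theta> x |\<theta> x. \<theta> \<in> steenrod_operations p scale act \<and> x \<in> S}"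
    and SK: "\<And>x n. x \<in> S \<Longrightarrow> component G x n \<in> K n"
  shows "K = G"
proof -
  note gK = graded_subspaceD[OF stableD(1)[OF K(1)]]
  define T where "T = {x. \<forall>n. component G x n \<in> K n}"
  have KT: "K n \<subseteq> T" for n
  proof
    fix x assume "x \<in> K n"
    then show "x \<in> T" unfolding T_def using component_homogeneous[OF gK(2)] gK(3) by simp
  qed
  have sub: "subspace T"
    unfolding subspace_def T_def by (simp add: component_zero component_add component_scale gK)
  have by_components: "f x \<in> T" if f: "additive f" and "\<And>n. f (component G x n) \<in> T" for f x
  proof -
    have "f x = (\<Sum>n | component G x n \<noteq> 0. f (component G x n))"
      by (subst (1) sum_component[of x, symmetric]) (rule additive.sum[OF f])
    moreover have "(\<Sum>n | component G x n \<noteq> 0. f (component G x n)) \<in> T"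
      by (rule subspace_sum[OF sub]) (rule that(2))
    ultimately show ?thesis by (simp only:)
  qed
  have act: "act g x \<in> T" if g: "g \<in> steenrod_gens p" and x: "x \<in> T" for g x
  proof (rule by_components[of "act g"])
    interpret lin: Vector_Spaces.linear scale scale "act g" by (rule act_linear[OF g])
    show "additive (act g)" by (simp add: additive_def lin.add)
    fix n
    have c: "component G x n \<in> K n" using x unfolding T_def by blast
    from gens_cases[OF g] show "act g (component G x n) \<in> T"
    proof cases
      case (1 i)
      then show ?thesis using KT stableD(2)[OF K(1) c, of i] by auto
    next
      case 2
      then show ?thesis using KT stableD(3)[OF K(1) c] by auto
    qed
  qed
  have mult_hom: "a * b \<in> T" if "a \<in> K i" "b \<in> K j" for a b i j
  proof -
    consider "i = 0" | "j = 0" | "0 < i" "0 < j" by blast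
    then show ?thesis
    proof cases
      case 1
      then have "a \<in> G 0" using gK(2) that by blast
      then have "a * b = \<epsilon> a *s b" by (rule G_0_mult(1))
      then show ?thesis using KT gK(6)[OF that(2)] by auto
    next
      case 2
      then have "b \<in> G 0" using gK(2) that by blast
      then have "a * b = \<epsilon> b *s a" by (rule G_0_mult(2))
      then show ?thesis using KT gK(6)[OF that(1)] by auto
    next
      case 3
      then have "a * b \<in> decomposables G (i + j)"
        using that gK(2) by (intro decomposables_base[of a G i b j]) auto
      then have "a * b \<in> scalars_and_decomposables (i + j)"
        using 3 by (simp add: scalars_and_decomposables_def)
      then show ?thesis using K(2) KT by (auto simp: le_fun_def)
    qed
  qed
  have mult: "a * b \<in> T" if "a \<in> T" "b \<in> T" for a b
  proof (rule by_components[of "\<lambda>a. a * b"])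
    show "additive (\<lambda>a. a * b)" by (simp add: additive_def distrib_right)
    show "component G a n * b \<in> T" for n
    proof (rule by_components[of "(*) (component G a n)"])
      show "additive ((*) (component G a n))" by (simp add: additive_def distrib_left)
      show "component G a n * component G b m \<in> T" for m
        using mult_hom that unfolding T_def by blast
    qed
  qed
  have "1 \<in> scalars_and_decomposables 0" using one_in_G by (simp add: scalars_and_decomposables_def)
  then have "1 \<in> T" using K(2) KT by (auto simp: le_fun_def)
  then have "subalgebra scale T" unfolding subalgebra_def using sub mult by blast
  moreover have "S \<subseteq> T" using SK unfolding T_def by blast
  then have "{\<theta> x |\<theta> x. \<theta> \<in> steenrod_operations p scale act \<and> x \<in> S} \<subseteq> T"
    using mem_stable_of_operation[OF act sub] by blast
  ultimately have "UNIV \<subseteq> T" unfolding S by (intro hull_minimal)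
  have "G n \<subseteq> K n" for n
  proof
    fix x assume "x \<in> G n"
    then have "component G x n = x" using component_homogeneous by simp
    moreover have "component G x n \<in> K n" using \<open>UNIV \<subseteq> T\<close> unfolding T_def by blast
    ultimately show "x \<in> K n" by simp
  qed
  then show ?thesis using gK(2) by (auto intro!: ext)
qed

theorem acc_indecomposables:
  assumes "finitely_generated_unstable p scale act UNIV"
  shows "ascending_chain_condition (submodule_above scalars_and_decomposables)"
proof -
  obtain S where S: "finite S"
    "UNIV = subalgebra scale hull {\<theta> x |\<theta> x. \<theta> \<in> steenrod_operations p scale act \<and> x \<in> S}"
    using assms unfolding finitely_generated_unstable_def by blast
  define F where "F n = (\<lambda>x. component G x n) ` S - {0}" for n
  have "finite (\<Union>x\<in>S. {n. component G x n \<noteq> 0})" using S(1) finite_component by blast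
  then obtain r where r: "\<And>n. n \<in> (\<Union>x\<in>S. {n. component G x n \<noteq> 0}) \<Longrightarrow> n < r"
    unfolding finite_nat_set_iff_bounded by blast
  show ?thesis
  proof (rule acc_submodules_of_finitely_generated[OF stable_scalars_and_decomposables
        unstable_scalars_and_decomposables, where F = F and r = r])
    show "finite (F n)" for n unfolding F_def using S(1) by simp
    show "F n \<subseteq> G n" for n unfolding F_def using component_in by blast
    show "F n = {}" if "0 + r \<le> n" for n
      unfolding F_def using r[of n] that by (auto dest: leD)
    show "K = G" if K: "stable K" "scalars_and_decomposables \<le> K" "F \<le> K" for K
    proof (rule family_eq_G_of_generators[OF K(1,2) S(2)])
      show "component G x n \<in> K n" if "x \<in> S" for x n
        using that le_funD[OF K(3), of n] graded_subspaceD(3)[OF stableD(1)[OF K(1)], of n]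
        unfolding F_def by (cases "component G x n = 0") auto
    qed
  qed
qed

section \<open>Frobenius roots of a subalgebra\<close>

text \<open>
  The classes in the module of indecomposables of the elements with \<open>p\<^sup>k\<close>-th power in \<open>A\<close>: the leading
  coefficients of \<open>A\<close> with respect to the Frobenius map.
\<close>

definition frobenius_roots :: "nat \<Rightarrow> (nat \<Rightarrow> 'a set) \<Rightarrow> nat \<Rightarrow> 'a set" where
  "frobenius_roots k A n = {x \<in> G n. \<exists>y\<in>G n.
    y ^ (p ^ k) \<in> A (n * p ^ k) \<and> x - y \<in> scalars_and_decomposables n}"

text \<open>
  The powers satisfy \<open>\<P> (p\<^sup>k i) (y\<^bsup>p^k\<^esup>) = (\<P> i y)\<^bsup>p^k\<^esup>\<close>, so the roots are a submodule over the algebra of powers. For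
  odd \<open>p\<close> they need not be closed under the Bockstein, since elements of odd degree are always roots for \<open>k > 0\<close>.
\<close>

lemma submodule_above_frobenius_roots:
  assumes A: "graded_subspace A" "\<P>_closed A"
  shows "submodule_above scalars_and_decomposables (frobenius_roots k A)"
proof -
  let ?J = scalars_and_decomposables
  note gA = graded_subspaceD[OF A(1)] and gG = graded_subspaceD[OF graded_subspace_G]
  note gJ = graded_subspaceD[OF stableD(1)[OF stable_scalars_and_decomposables]]
  have above: "x \<in> frobenius_roots k A n" if "x \<in> ?J n" for x n
  proof -
    have "(0 :: 'a) ^ (p ^ k) = 0" using p_ge_2 by (simp add: zero_power)
    then show ?thesis unfolding frobenius_roots_def using that gJ(2)[OF that] gA(3)
      by (auto intro!: bexI[of _ 0])
  qed
  have "subspace (frobenius_roots k A n)" for n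
    unfolding subspace_def
  proof (intro conjI ballI allI)
    show "0 \<in> frobenius_roots k A n" by (rule above) (rule gJ)
    fix x x' assume "x \<in> frobenius_roots k A n" "x' \<in> frobenius_roots k A n"
    then obtain y y' where *: "x \<in> G n" "x' \<in> G n" "y \<in> G n" "y' \<in> G n"
      "y ^ (p ^ k) \<in> A (n * p ^ k)" "y' ^ (p ^ k) \<in> A (n * p ^ k)" "x - y \<in> ?J n" "x' - y' \<in> ?J n"
      unfolding frobenius_roots_def by blast
    have "(y + y') ^ (p ^ k) \<in> A (n * p ^ k)"
      unfolding power_pk_add[OF *(3,4)] by (rule gA(4)[OF *(5,6)])
    moreover have "x + x' - (y + y') \<in> ?J n"
      using gJ(4)[OF *(7,8)] by (simp add: algebra_simps)
    ultimately show "x + x' \<in> frobenius_roots k A n"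
      unfolding frobenius_roots_def using gG(4)[OF *(1,2)] gG(4)[OF *(3,4)] by blast
  next
    fix c x assume "x \<in> frobenius_roots k A n"
    then obtain y where *: "x \<in> G n" "y \<in> G n" "y ^ (p ^ k) \<in> A (n * p ^ k)" "x - y \<in> ?J n"
      unfolding frobenius_roots_def by blast
    have "(c *s y) ^ (p ^ k) \<in> A (n * p ^ k)"
      unfolding power_pk_scale[OF *(2)] by (rule gA(6)[OF *(3)])
    moreover have "c *s x - c *s y \<in> ?J n"
      using gJ(6)[OF *(4)] by (simp add: scale_right_diff_distrib)
    ultimately show "c *s x \<in> frobenius_roots k A n"
      unfolding frobenius_roots_def using gG(6)[OF *(1)] gG(6)[OF *(2)] by blast
  qed
  moreover have "\<P> i x \<in> frobenius_roots k A (n + \<delta> i)" if x: "x \<in> frobenius_roots k A n" for x n i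
  proof -
    obtain y where *: "x \<in> G n" "y \<in> G n" "y ^ (p ^ k) \<in> A (n * p ^ k)" "x - y \<in> ?J n"
      using x unfolding frobenius_roots_def by blast
    have "\<P> (p ^ k * i) (y ^ (p ^ k)) \<in> A (n * p ^ k + \<delta> (p ^ k * i))"
      using A(2) *(3) unfolding \<P>_closed_def by blast
    moreover have "n * p ^ k + \<delta> (p ^ k * i) = (n + \<delta> i) * p ^ k" by (simp add: \<delta>_def algebra_simps)
    ultimately have "(\<P> i y) ^ (p ^ k) \<in> A ((n + \<delta> i) * p ^ k)"
      unfolding \<P>_power_pk[OF *(2)] by simp
    moreover have "\<P> i x - \<P> i y \<in> ?J (n + \<delta> i)"
      using stableD(2)[OF stable_scalars_and_decomposables *(4), of i] by (simp add: \<P>.diff)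
    ultimately show ?thesis
      unfolding frobenius_roots_def using \<P>_in_G[OF *(1)] \<P>_in_G[OF *(2)] by blast
  qed
  ultimately show ?thesis
    unfolding submodule_above_def graded_subspace_def \<P>_closed_def le_fun_def
    using above by (auto simp: frobenius_roots_def)
qed

lemma frobenius_roots_mono: "A \<le> A' \<Longrightarrow> frobenius_roots k A \<le> frobenius_roots k A'"
  unfolding frobenius_roots_def le_fun_def by blast

lemma power_in_graded_subalgebra: "graded_subalgebra A \<Longrightarrow> x \<in> A n \<Longrightarrow> x ^ k \<in> A (n * k)"
  by (induction k) (auto simp: graded_subalgebraD)

lemma frobenius_roots_Suc_mono:
  assumes "graded_subalgebra A"
  shows "frobenius_roots k A \<le> frobenius_roots (Suc k) A"
proof -
  have "y ^ (p ^ Suc k) \<in> A (n * p ^ Suc k)" if "y ^ (p ^ k) \<in> A (n * p ^ k)" for y n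
    unfolding power_p_power using power_in_graded_subalgebra[OF assms that, of p] by (simp add: mult_ac)
  then show ?thesis unfolding frobenius_roots_def le_fun_def by blast
qed

text \<open>
  The Hopf subalgebra of \<open>p\<^sup>k\<close>-th powers.
\<close>

abbreviation power_families :: "nat \<Rightarrow> nat \<Rightarrow> 'a set" where
  "power_families k \<equiv> (power_family ^^ k) G"

lemma power_families_subalgebra: "graded_subalgebra (power_families k)" "bicoideal (power_families k)"
proof (induction k)
  case 0
  show "graded_subalgebra (power_families 0)" using graded_subalgebra_G by simp
  show "bicoideal (power_families 0)" unfolding bicoideal_def using comult_in_htensor by simp
next
  case (Suc k)
  show "graded_subalgebra (power_families (Suc k))" using graded_subalgebra_power_family Suc by simp
  show "bicoideal (power_families (Suc k))" using bicoideal_power_family Suc by simp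
qed

lemma power_families_le: "power_families k \<le> G"
  using graded_subspaceD(2)[OF graded_subalgebraD(1)[OF power_families_subalgebra(1)]] by (auto simp: le_fun_def)

lemma power_in_power_families: "x \<in> G m \<Longrightarrow> x ^ (p ^ k) \<in> power_families k (m * p ^ k)"
proof (induction k)
  case (Suc k)
  then show ?case using power_familyI[OF power_families_le Suc.IH]
    unfolding power_p_power by (simp add: mult_ac)
qed simp

lemma power_families_cases:
  "y \<in> power_families k n \<Longrightarrow> y = 0 \<or> (\<exists>m x. x \<in> G m \<and> m * p ^ k = n \<and> y = x ^ (p ^ k))"
proof (induction k arbitrary: y n)
  case 0
  then show ?case by auto
next
  case (Suc k)
  have "y \<in> power_family (power_families k) n" using Suc.prems by simp
  with power_families_le show ?case
  proof (cases rule: power_family_cases)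
    case (2 m z)
    from Suc.IH[OF 2(2)] show ?thesis
    proof (elim disjE exE conjE)
      assume "z = 0"
      then show ?thesis using 2 p_ge_2 by (simp add: zero_power)
    next
      fix m' x assume "x \<in> G m'" "m' * p ^ k = m" "z = x ^ (p ^ k)"
      then show ?thesis using 2 power_p_power[of x k] by (intro disjI2 exI[of _ m'] exI[of _ x]) auto
    qed
  qed simp
qed

lemma power_of_decomposable:
  assumes "u \<in> decomposables G m"
  shows "u ^ (p ^ k) \<in> decomposables (power_families k) (m * p ^ k)"
proof -
  have "u \<in> G m \<and> u ^ (p ^ k) \<in> decomposables (power_families k) (m * p ^ k)"
    using assms unfolding decomposables_def[of G m]
  proof (induction rule: span_induct_alt)
    case base
    show ?case using subspace_0[OF subspace_decomposables] p_ge_2 by (simp add: zero_power)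
  next
    case (step c z z')
    then obtain x y i j where z: "z = x * y" "0 < i" "0 < j" "i + j = m" "x \<in> G i" "y \<in> G j" by blast
    have zG: "c *s z \<in> G m" "z \<in> G m"
      using z mult_in_G subspace_scale[OF subspace_G] by auto
    have "z ^ (p ^ k) = x ^ (p ^ k) * y ^ (p ^ k)" unfolding z(1) by (rule power_pk_mult[OF z(5,6)])
    moreover have "x ^ (p ^ k) * y ^ (p ^ k) \<in> decomposables (power_families k) (m * p ^ k)"
      by (rule decomposables_base[of _ _ "i * p ^ k" _ "j * p ^ k"])
        (use z p_ge_2 power_in_power_families in \<open>simp_all add: distrib_right[symmetric]\<close>)
    ultimately have "z ^ (p ^ k) \<in> decomposables (power_families k) (m * p ^ k)" by simp
    then have "c *s z ^ (p ^ k) + z' ^ (p ^ k) \<in> decomposables (power_families k) (m * p ^ k)"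
      by (intro subspace_add[OF subspace_decomposables] subspace_scale[OF subspace_decomposables])
        (use step in simp_all)
    then show ?case
      using power_pk_add[OF zG(1)] power_pk_scale[OF zG(2)] step(2) subspace_add[OF subspace_G zG(1)] by simp
  qed
  then show ?thesis ..
qed

text \<open>
  Suppose that \<open>c\<close> is \<open>z\<^bsup>p^k\<^esup>\<close> modulo \<open>A\<close>. Then \<open>z\<close> is a \<open>k\<close>-th root for \<open>A'\<close>, hence for \<open>A\<close>, so up to an
  element whose \<open>p\<^sup>k\<close>-th power is in \<open>A\<close> it is a decomposable \<open>u\<close>. Now \<open>u\<^bsup>p^k\<^esup>\<close> is decomposable in the Hopf algebra of
  \<open>p\<^sup>k\<close>-th powers and primitive modulo \<open>A\<close>, so it is a \<open>p\<close>-th power of a \<open>p\<^sup>k\<close>-th power modulo \<open>A\<close>. Hence \<open>k\<close> can be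
  replaced by \<open>k + 1\<close>, but for \<open>p\<^sup>k > d\<close> no element of degree \<open>d > 0\<close> is a nonzero \<open>p\<^sup>k\<close>-th power.
\<close>

theorem mem_of_equal_frobenius_roots:
  assumes A: "graded_subalgebra A" "coideal A" and A': "graded_subalgebra A'" and AA': "A \<le> A'"
    and roots: "\<And>k. frobenius_roots k A' \<le> frobenius_roots k A"
    and c: "c \<in> A' d" "\<Delta> c - 1 \<otimes>\<^sub>t c \<in> htensor G A d"
  shows "c \<in> A d"
proof (rule ccontr)
  assume cA: "c \<notin> A d"
  note gA = graded_subspaceD[OF graded_subalgebraD(1)[OF A(1)]]
  note gA' = graded_subspaceD[OF graded_subalgebraD(1)[OF A']]
  note gJ = graded_subspaceD[OF stableD(1)[OF stable_scalars_and_decomposables]]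
  have "0 < d" using cA scalar_in_subalgebra[OF A(1), of c] gA'(2)[OF c(1)] by (cases d) auto
  have claim: "\<exists>m z. z \<in> G m \<and> m * p ^ k = d \<and> c - z ^ (p ^ k) \<in> A d" for k
  proof (induction k)
    case 0
    show ?case using gA'(2)[OF c(1)] gA(3) by (intro exI[of _ d] exI[of _ c]) simp
  next
    case (Suc k)
    then obtain m z where z: "z \<in> G m" "m * p ^ k = d" "c - z ^ (p ^ k) \<in> A d" by blast
    have "m \<noteq> 0" using z(2) \<open>0 < d\<close> by auto
    have "c - (c - z ^ (p ^ k)) \<in> A' d"
      by (rule gA'(5)[OF c(1)]) (use z(3) AA' in \<open>auto simp: le_fun_def\<close>)
    then have "z \<in> frobenius_roots k A' m"
      unfolding frobenius_roots_def using z gJ(3) by auto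
    then have "z \<in> frobenius_roots k A m" using roots[of k] by (auto simp: le_fun_def)
    then obtain y where y: "y \<in> G m" "y ^ (p ^ k) \<in> A d" "z - y \<in> scalars_and_decomposables m"
      unfolding frobenius_roots_def z(2) by blast
    define u where "u = z - y"
    have u: "u \<in> decomposables G m" "u \<in> G m"
      using y(3) gJ(2)[OF y(3)] \<open>m \<noteq> 0\<close> unfolding u_def scalars_and_decomposables_def by simp_all
    have "z ^ (p ^ k) = u ^ (p ^ k) + y ^ (p ^ k)" using power_pk_add[OF u(2) y(1)] unfolding u_def by simp
    then have cu: "c - u ^ (p ^ k) \<in> A d" using gA(4)[OF z(3) y(2)] by (simp add: algebra_simps)
    let ?u = "u ^ (p ^ k)" and ?a = "c - u ^ (p ^ k)"
    have a: "\<Delta> ?a \<in> htensor G A d" using A(2) cu unfolding coideal_def by blast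
    have a': "1 \<otimes>\<^sub>t ?a \<in> htensor G A d" by (rule htensor_one) (rule cu)
    have "(\<Delta> c - 1 \<otimes>\<^sub>t c) - (\<Delta> ?a - 1 \<otimes>\<^sub>t ?a) \<in> htensor G A d"
      by (rule htensor_diff[OF c(2) htensor_diff[OF a a']])
    moreover have c_eq: "1 \<otimes>\<^sub>t c = 1 \<otimes>\<^sub>t ?a + 1 \<otimes>\<^sub>t ?u" using tensor_add_right[of 1 ?a ?u] by simp
    have "(\<Delta> c - 1 \<otimes>\<^sub>t c) - (\<Delta> ?a - 1 \<otimes>\<^sub>t ?a) = \<Delta> ?u - 1 \<otimes>\<^sub>t ?u"
      unfolding \<Delta>.diff c_eq by simp
    ultimately have "\<Delta> ?u - 1 \<otimes>\<^sub>t ?u \<in> htensor G A d" by simp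
    moreover have "?u \<in> power_families k d" using power_in_power_families[OF u(2), of k] z(2) by simp
    moreover have "?u \<in> decomposables (power_families k) d" using power_of_decomposable[OF u(1), of k] z(2) by simp
    ultimately obtain y' where y': "y' \<in> power_family (power_families k) d" "?u - y' \<in> A d"
      using decomposable_primitive_modulo_subalgebra[OF power_families_subalgebra A] by blast
    have cy': "c - y' \<in> A d" using gA(4)[OF cu y'(2)] by simp
    have "y' \<in> power_families (Suc k) d" using y'(1) by simp
    from power_families_cases[OF this] cy' cA show ?case by force
  qed
  obtain m z where "m * p ^ d = d" using claim[of d] by blast
  moreover have "d < p ^ d" using p_ge_2 by (intro power_gt_expt) simp
  ultimately show False using \<open>0 < d\<close> by (cases m) auto
qed

section \<open>Finitely generated unstable subalgebras\<close>

inductive steenrod_words :: "'a set \<Rightarrow> nat \<Rightarrow> 'a \<Rightarrow> bool" for S where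
  base: "x \<in> S \<Longrightarrow> x \<in> G n \<Longrightarrow> steenrod_words S n x"
| \<P>: "steenrod_words S n x \<Longrightarrow> steenrod_words S (n + \<delta> i) (\<P> i x)"
| \<beta>: "steenrod_words S n x \<Longrightarrow> steenrod_words S (n + 1) (\<beta> x)"

definition unstable_gen :: "'a set \<Rightarrow> nat \<Rightarrow> 'a set" where
  "unstable_gen S = gen (\<lambda>n. {x. steenrod_words S n x})"

lemma words_le: "(\<lambda>n. {x. steenrod_words S n x}) \<le> G"
proof -
  have "x \<in> G n" if "steenrod_words S n x" for n x
    using that by induction (auto simp: \<P>_in_G \<beta>_in_G[simplified])
  then show ?thesis by (auto simp: le_fun_def)
qed

lemma words_in_unstable_gen: "steenrod_words S n x \<Longrightarrow> x \<in> unstable_gen S n"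
  unfolding unstable_gen_def gen_def by (simp add: generated.base)

lemma base_in_unstable_gen: "x \<in> S \<Longrightarrow> x \<in> G n \<Longrightarrow> x \<in> unstable_gen S n"
  by (rule words_in_unstable_gen) (rule steenrod_words.base)

lemma graded_subalgebra_unstable_gen: "graded_subalgebra (unstable_gen S)"
  unfolding unstable_gen_def by (rule graded_subalgebra_gen[OF words_le])

lemma stable_unstable_gen: "stable (unstable_gen S)"
proof -
  note gS = graded_subspaceD[OF graded_subalgebraD(1)[OF graded_subalgebra_unstable_gen[of S]]]
  note mS = graded_subalgebraD(4)[OF graded_subalgebra_unstable_gen[of S]]
  let ?X = "\<lambda>n. {x. steenrod_words S n x}"
  have in_G: "x \<in> G n" if "generated ?X n x" for x n
    using that gS(2)[of x n] unfolding unstable_gen_def gen_def by simp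
  have "\<P> i x \<in> unstable_gen S (n + \<delta> i)" if "generated ?X n x" for n x i
    using that
  proof (induction arbitrary: i)
    case (base x n)
    then show ?case by (intro words_in_unstable_gen steenrod_words.\<P>) simp
  next
    case one
    show ?case
    proof (cases "i = 0")
      case True
      then show ?thesis using graded_subalgebraD(2)[OF graded_subalgebra_unstable_gen]
        by (simp add: \<P>_0 \<delta>_0)
    next
      case False
      then have "\<P> i 1 = 0" using \<P>_unstable[OF one_in_G] w_pos by simp
      then show ?thesis using gS(3) by simp
    qed
  next
    case (mult m x n y)
    have "\<P> j x * \<P> (i - j) y \<in> unstable_gen S (m + n + \<delta> i)" if "j \<le> i" for j
    proof (rule mS[OF mult.IH])
      have "\<delta> j + \<delta> (i - j) = \<delta> i" using that by (simp add: \<delta>_add[symmetric])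
      then show "m + \<delta> j + (n + \<delta> (i - j)) = m + n + \<delta> i" by simp
    qed
    then show ?case unfolding \<P>_cartan by (intro subspace_sum[OF gS(1)]) simp
  qed (simp_all add: \<P>.zero \<P>.add \<P>.scale gS)
  moreover have "\<beta> x \<in> unstable_gen S (n + 1)" if "generated ?X n x" for n x
    using that
  proof induction
    case (base x n)
    then show ?case by (intro words_in_unstable_gen steenrod_words.\<beta>) simp
  next
    case one
    have "\<beta> 1 = 0" using \<beta>_\<P>_unstable[OF one_in_G, of 0] by (simp add: \<P>_0)
    then show ?case using gS(3) by simp
  next
    case (mult m x n y)
    have xy: "x \<in> unstable_gen S m" "y \<in> unstable_gen S n"
      using mult.hyps unfolding unstable_gen_def gen_def by simp_all
    have "\<beta> x * y \<in> unstable_gen S (m + n + 1)" by (rule mS[OF mult.IH(1) xy(2)]) simp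
    moreover have "(-1) ^ m * (x * \<beta> y) \<in> unstable_gen S (m + n + 1)"
      by (rule minus_one_power_mult_in[OF gS(1)], rule mS[OF xy(1) mult.IH(2)]) simp
    ultimately show ?case unfolding \<beta>_cartan[OF in_G[OF mult.hyps(1)]] by (rule gS(4))
  qed (simp_all add: \<beta>.zero \<beta>.add \<beta>.scale gS[simplified])
  ultimately show ?thesis
    unfolding stable_def \<P>_closed_def \<beta>_closed_def
    using graded_subalgebraD(1)[OF graded_subalgebra_unstable_gen[of S]]
    unfolding unstable_gen_def gen_def by blast
qed

lemma unstable_gen_mono:
  assumes "S \<subseteq> S'"
  shows "unstable_gen S \<le> unstable_gen S'"
proof -
  have "steenrod_words S' n x" if "steenrod_words S n x" for n x
    using that by induction (use assms in \<open>blast intro: steenrod_words.intros\<close>)+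
  then show ?thesis unfolding unstable_gen_def by (intro gen_mono[OF _ words_le]) (auto simp: le_fun_def)
qed

text \<open>
  Compatibility of the coproduct with products and operations reduces the condition to the generators.
\<close>

lemma coideal_unstable_gen:
  assumes "\<And>x n. x \<in> S \<Longrightarrow> x \<in> G n \<Longrightarrow> \<Delta> x \<in> htensor G (unstable_gen S) n"
  shows "coideal (unstable_gen S)"
  unfolding unstable_gen_def
proof (rule coideal_gen[OF words_le])
  note st = stable_unstable_gen[of S, unfolded stable_def]
  fix n x assume "x \<in> {x. steenrod_words S n x}"
  then have "steenrod_words S n x" by simp
  then have "\<Delta> x \<in> htensor G (unstable_gen S) n"
    by induction (use assms comult_\<P>_in_htensor comult_\<beta>_in_htensor st in auto)
  then show "\<Delta> x \<in> htensor G (gen (\<lambda>n. {x. steenrod_words S n x})) n" unfolding unstable_gen_def .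
qed

lemma subalgebra_hull: "subalgebra scale (subalgebra scale hull X)"
  by (rule hull_in) (auto simp: subalgebra_def subspace_Inter)

text \<open>
  The words in the generators of the Steenrod algebra are operations, so what they generate lies in the
  subalgebra of the definition; conversely that subalgebra is contained in \<open>C\<close>.
\<close>

lemma finitely_generated_of_unstable_gen:
  assumes C: "subalgebra scale C" "\<And>g x. g \<in> steenrod_gens p \<Longrightarrow> x \<in> C \<Longrightarrow> act g x \<in> C"
    "\<And>x n. x \<in> C \<Longrightarrow> component G x n \<in> C"
    and S: "finite S" "S \<subseteq> C" and gen: "\<And>n. C \<inter> G n \<subseteq> unstable_gen S n"
  shows "finitely_generated_unstable p scale act C"
proof -
  let ?X = "{\<theta> x |\<theta> x. \<theta> \<in> steenrod_operations p scale act \<and> x \<in> S}"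
  let ?H = "subalgebra scale hull ?X"
  have subC: "subspace C" using C(1) unfolding subalgebra_def by blast
  have "?X \<subseteq> C" using mem_stable_of_operation[OF C(2) subC] S(2) by blast
  then have "?H \<subseteq> C" using C(1) by (rule hull_minimal)
  moreover have "C \<subseteq> ?H"
  proof
    have H: "subspace ?H" "1 \<in> ?H" "\<And>x y. x \<in> ?H \<Longrightarrow> y \<in> ?H \<Longrightarrow> x * y \<in> ?H"
      using subalgebra_hull[of ?X] unfolding subalgebra_def by blast+
    have "\<exists>\<theta>\<in>steenrod_operations p scale act. \<exists>y\<in>S. x = \<theta> y" if "steenrod_words S n x" for n x
      using that
    proof induction
      case (base x n)
      then show ?case using steenrod_operations.one by (intro bexI[of _ "\<lambda>x. x"] bexI[of _ x]) auto
    next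
      case (\<P> n x i)
      then obtain \<theta> y where *: "\<theta> \<in> steenrod_operations p scale act" "y \<in> S" "x = \<theta> y" by blast
      obtain g where "g \<in> steenrod_gens p" "\<P> i = act g" using \<P>_act by blast
      then show ?case using steenrod_operations.gen_mult[OF _ *(1), of g] *(2,3)
        by (intro bexI[of _ "\<lambda>x. act g (\<theta> x)"] bexI[of _ y]) auto
    next
      case (\<beta> n x)
      then obtain \<theta> y where *: "\<theta> \<in> steenrod_operations p scale act" "y \<in> S" "x = \<theta> y" by blast
      consider "\<beta> = (\<lambda>x. 0)" | g where "g \<in> steenrod_gens p" "\<beta> = act g" using \<beta>_act by blast
      then show ?case
      proof cases
        case 1
        then show ?thesis using steenrod_operations.scale[OF *(1), of 0] *(2)
          by (intro bexI[of _ "\<lambda>x. 0 *s \<theta> x"] bexI[of _ y]) auto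
      next
        case (2 g)
        then show ?thesis using steenrod_operations.gen_mult[OF _ *(1), of g] *(2,3)
          by (intro bexI[of _ "\<lambda>x. act g (\<theta> x)"] bexI[of _ y]) auto
      qed
    qed
    then have "x \<in> ?H" if "steenrod_words S n x" for n x using that hull_inc[of x ?X] by blast
    moreover have "x \<in> ?H" if "generated (\<lambda>n. {x. steenrod_words S n x}) n x" for n x
      using that
      by induction (use calculation H subspace_0[OF H(1)] subspace_add[OF H(1)] subspace_scale[OF H(1)] in auto)
    ultimately have in_H: "unstable_gen S n \<subseteq> ?H" for n unfolding unstable_gen_def gen_def by blast
    fix x assume x: "x \<in> C"
    have "component G x n \<in> ?H" for n
      using C(3)[OF x] component_in gen in_H by blast
    then have "(\<Sum>n | component G x n \<noteq> 0. component G x n) \<in> ?H" by (intro subspace_sum[OF H(1)])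
    then show "x \<in> ?H" by (simp only: sum_component)
  qed
  ultimately show ?thesis unfolding finitely_generated_unstable_def using S by blast
qed

text \<open>
  Otherwise there is an infinite sequence of unstable subalgebras, each obtained from the previous one by
  adjoining an element \<open>c\<close> of \<open>C\<close> of least degree among the missing ones. As all elements of \<open>C\<close> of smaller
  degree are present, \<open>\<Delta> c - 1 \<otimes> c\<close> involves only elements of the previous subalgebra, and the sequence consists
  of coideals. By the chain condition, two consecutive members have the same roots, so they are equal.
\<close>

theorem finitely_generated_subalgebra:
  assumes fg: "finitely_generated_unstable p scale act UNIV"
    and sub: "unstable_hopf_subalgebra p scale G \<Delta> act C"
  shows "finitely_generated_unstable p scale act C"
proof (rule ccontr)
  assume nfg: "\<not> finitely_generated_unstable p scale act C"
  have C: "subalgebra scale C" "\<And>g x. g \<in> steenrod_gens p \<Longrightarrow> x \<in> C \<Longrightarrow> act g x \<in> C"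
    "\<And>x n. x \<in> C \<Longrightarrow> component G x n \<in> C" and \<Delta>C: "\<And>x. x \<in> C \<Longrightarrow> \<Delta> x \<in> tensor_sub C C"
    using sub unfolding unstable_hopf_subalgebra_def hopf_subalgebra_def by blast+
  define Cn where "Cn = (\<lambda>n. C \<inter> G n)"
  have CnG: "Cn \<le> G" unfolding Cn_def by (auto simp: le_fun_def)
  have subC: "subspace C" using C(1) unfolding subalgebra_def by blast
  have Cn: "graded_subspace Cn"
    unfolding graded_subspace_def Cn_def using subspace_inter[OF subC subspace_G] by blast
  have \<Delta>Cn: "\<Delta> x \<in> htensor G Cn n" if "x \<in> Cn n" for x n
  proof -
    have "\<Delta> x \<in> htensor Cn Cn n"
      unfolding Cn_def
      by (rule htensor_of_sub[OF comult_in_htensor \<Delta>C]) (use that C(3) in \<open>auto simp: Cn_def\<close>)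
    then show ?thesis by (rule htensor_mono[OF _ CnG order_refl])
  qed
  define good where "good S \<longleftrightarrow> finite S \<and> S \<subseteq> (\<Union>n. Cn n) \<and> coideal (unstable_gen S)" for S
  define step where "step S S' \<longleftrightarrow> (\<exists>c d. S' = insert c S \<and> c \<in> Cn d \<and> c \<notin> unstable_gen S d \<and>
    \<Delta> c - 1 \<otimes>\<^sub>t c \<in> htensor G (unstable_gen S) d)" for S S'
  have "\<exists>f. \<forall>n. good (f n) \<and> step (f n) (f (Suc n))"
  proof (rule dependent_nat_choice)
    have "coideal (unstable_gen {})" by (rule coideal_unstable_gen) simp
    then show "\<exists>S. good S" unfolding good_def by (intro exI[of _ "{}"]) simp
  next
    fix S and n :: nat assume S: "good S"
    have "S \<subseteq> C" using S unfolding good_def Cn_def by blast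
    then have "\<not> (\<forall>n. C \<inter> G n \<subseteq> unstable_gen S n)"
      using finitely_generated_of_unstable_gen[OF C, of S] S nfg unfolding good_def by blast
    then have ex: "\<exists>n. \<not> Cn n \<subseteq> unstable_gen S n" unfolding Cn_def by blast
    define d where "d = (LEAST n. \<not> Cn n \<subseteq> unstable_gen S n)"
    have "\<not> Cn d \<subseteq> unstable_gen S d" unfolding d_def using ex by (rule LeastI_ex)
    then obtain c where c: "c \<in> Cn d" "c \<notin> unstable_gen S d" by blast
    have low: "Cn j \<subseteq> unstable_gen S j" if "j < d" for j
      using not_less_Least[of j "\<lambda>n. \<not> Cn n \<subseteq> unstable_gen S n"] that d_def by simp
    have \<Delta>c: "\<Delta> c - 1 \<otimes>\<^sub>t c \<in> htensor G (unstable_gen S) d"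
    proof (rule htensor_mono[OF comult_minus_top(1)[OF Cn \<Delta>Cn[OF c(1)]] order_refl])
      show "truncate d Cn \<le> unstable_gen S"
        using low graded_subspaceD(3)[OF graded_subalgebraD(1)[OF graded_subalgebra_unstable_gen[of S]]]
        unfolding truncate_def le_fun_def by auto
    qed
    have "coideal (unstable_gen (insert c S))"
    proof (rule coideal_unstable_gen)
      fix x n assume x: "x \<in> insert c S" "x \<in> G n"
      have mono: "unstable_gen S \<le> unstable_gen (insert c S)" by (rule unstable_gen_mono) blast
      show "\<Delta> x \<in> htensor G (unstable_gen (insert c S)) n"
      proof (cases "x \<in> S")
        case True
        then have "\<Delta> x \<in> htensor G (unstable_gen S) n"
          using base_in_unstable_gen[OF True x(2)] S unfolding good_def coideal_def by blast
        then show ?thesis by (rule htensor_mono[OF _ order_refl mono])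
      next
        case False
        then have "x = c" using x by simp
        have "c \<noteq> 0"
          using c(2) graded_subspaceD(3)[OF graded_subalgebraD(1)[OF graded_subalgebra_unstable_gen[of S]]] by auto
        then have "n = d" using homogeneous_degree_unique[of c n d] x(2) c(1) \<open>x = c\<close> unfolding Cn_def by auto
        have "1 \<otimes>\<^sub>t c \<in> htensor G (unstable_gen (insert c S)) d"
          by (rule htensor_one) (rule base_in_unstable_gen, use c(1) in \<open>simp_all add: Cn_def\<close>)
        then have "\<Delta> c - 1 \<otimes>\<^sub>t c + 1 \<otimes>\<^sub>t c \<in> htensor G (unstable_gen (insert c S)) d"
          by (rule htensor_add[OF htensor_mono[OF \<Delta>c order_refl mono]])
        then show ?thesis using \<open>x = c\<close> \<open>n = d\<close> by simp
      qed
    qed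
    then have "good (insert c S)" using S c(1) unfolding good_def by blast
    moreover have "step S (insert c S)" unfolding step_def using c \<Delta>c by blast
    ultimately show "\<exists>S'. good S' \<and> step S S'" by blast
  qed
  then obtain f where good: "\<And>n. good (f n)" and step: "\<And>n. step (f n) (f (Suc n))" by blast
  define A where "A n = unstable_gen (f n)" for n
  have A: "graded_subalgebra (A n)" "coideal (A n)" "stable (A n)" for n
    unfolding A_def using graded_subalgebra_unstable_gen good stable_unstable_gen by (auto simp: good_def)
  have AA: "A n \<le> A (Suc n)" for n
    unfolding A_def using step[of n] unfolding step_def by (auto intro!: unstable_gen_mono)
  obtain N where N: "\<And>k i. N \<le> i \<Longrightarrow> frobenius_roots k (A i) = frobenius_roots k (A N)"
  proof (rule double_chain_stabilizes[OF acc_indecomposables[OF fg], of "\<lambda>k i. frobenius_roots k (A i)"])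
    show "submodule_above scalars_and_decomposables (frobenius_roots k (A i))" for k i
      using submodule_above_frobenius_roots A(3) unfolding stable_def by blast
    show "frobenius_roots k (A i) \<le> frobenius_roots (Suc k) (A i)" for k i
      by (rule frobenius_roots_Suc_mono[OF A(1)])
    show "frobenius_roots k (A i) \<le> frobenius_roots k (A (Suc i))" for k i
      by (rule frobenius_roots_mono[OF AA])
  qed blast
  obtain c d where c: "f (Suc N) = insert c (f N)" "c \<in> Cn d" "c \<notin> A N d"
    "\<Delta> c - 1 \<otimes>\<^sub>t c \<in> htensor G (A N) d"
    using step[of N] unfolding step_def A_def by blast
  have "c \<in> A (Suc N) d" unfolding A_def c(1) using c(2) by (intro base_in_unstable_gen) (auto simp: Cn_def)
  moreover have "frobenius_roots k (A (Suc N)) \<le> frobenius_roots k (A N)" for k using N[of "Suc N" k] by simp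
  ultimately have "c \<in> A N d"
    using mem_of_equal_frobenius_roots[OF A(1,2) A(1) AA] c(4) by blast
  then show False using c(3) by simp
qed

end

theorem theorem2p4:
  fixes p :: nat
    and scale :: "'k::field \<Rightarrow> 'a::ring_1 \<Rightarrow> 'a"
    and G :: "nat \<Rightarrow> 'a set"
    and \<Delta> :: "'a \<Rightarrow> ('a, 'a) tensor"
    and \<epsilon> :: "'a \<Rightarrow> 'k"
    and act :: "steenrod_gen \<Rightarrow> 'a \<Rightarrow> 'a"
    and C :: "'a set"
  assumes "prime p"
    and "CARD('k) = p"
    and "unstable_hopf_algebra p scale G \<Delta> \<epsilon> act"
    and "finitely_generated_unstable p scale act UNIV"
    and "unstable_hopf_subalgebra p scale G \<Delta> act C"
  shows "finitely_generated_unstable p scale act C"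
proof -
  interpret unstable_hopf_algebra p scale G \<Delta> \<epsilon> act by fact
  interpret fp_unstable_hopf_algebra p scale G \<Delta> \<epsilon> act by unfold_locales fact+
  show ?thesis using assms(4,5) by (rule finitely_generated_subalgebra)
qed

end
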